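(* Let $\varrho>0$ and let $\underline\omega(\cdot)$ be the constant rate totally asymmetric zero range process (TAZRP) started from its stationary distribution $\mu_\varrho^{\otimes\mathbb Z}$. Let $V^\varrho=\frac1{(1+\varrho)^2}$, and for $V\in\mathbb R$ let $J^{(V)}(t)=h_{[Vt]}(t)$ be the current seen by an observer moving at speed $V$. Then for every $V\neq V^\varrho$ $$\lim_{t\to\infty}\frac{\mathbf{Var}^\varrho J^{(V)}(t)}{t}=\mathbf{Var}^\varrho(\omega_0)\,|V^\varrho-V|.$$
   Context: TAZRP: the Markov process on $\Omega=\{0,1,2,\dots\}^{\mathbb Z}$ in which, independently at different sites, the jump $(\omega_i,\omega_{i+1})\to(\omega_i-1,\omega_{i+1}+1)$ occurs with rate $\mathbb I_{(\omega_i>0)}$. $\mu_\varrho(k)=\left(\frac{\varrho}{1+\varrho}\right)^k\frac1{1+\varrho}$, $k=0,1,2,\dots$ (geometric with mean $\varrho$). $\mathbf{Var}^\varrho$ is the variance in the stationary process started from $\mu_\varrho^{\otimes\mathbb Z}$; in particular $\mathbf{Var}^\varrho(\omega_0)=\varrho(1+\varrho)$. Heights: $h_0(0)=0$, $h_{i-1}(0)-h_i(0)=\omega_i(0)$ for all $i\in\mathbb Z$, and $h_i$ increases by $1$ at each jump of a particle from $i$ to $i+1$; hence $h_{i-1}(t)-h_i(t)=\omega_i(t)$ for all $t\geq 0$. $[x]$ denotes the first integer from $x$ towards the origin: $[x]=\lfloor x\rfloor$ for $x\ge0$ and $[x]=\lceil x\rceil$ for $x<0$. *)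

theory Defs
  imports "HOL-Probability.Probability"
begin

section \<open>Poisson processes\<close>

definition poisson_process :: "'a measure \<Rightarrow> real \<Rightarrow> (real \<Rightarrow> 'a \<Rightarrow> nat) \<Rightarrow> bool" where
  "poisson_process M r P \<longleftrightarrow>
     (\<forall>t\<ge>0. P t \<in> measurable M (count_space UNIV)) \<and>
     (AE x in M. P 0 x = 0 \<and> mono_on {0..} (\<lambda>t. P t x) \<and>
                 (\<forall>t\<ge>0. continuous (at_right t) (\<lambda>s. P s x))) \<and>
     (\<forall>s t. 0 \<le> s \<and> s < t \<longrightarrow>
        distr M (count_space UNIV) (\<lambda>x. P t x - P s x)
          = measure_pmf (poisson_pmf (r * (t - s)))) \<and>
     (\<forall>(\<tau> :: nat \<Rightarrow> real) n. 0 \<le> \<tau> 0 \<and> mono \<tau> \<longrightarrow>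
        prob_space.indep_vars M (\<lambda>_. count_space UNIV)
          (\<lambda>k x. P (\<tau> (Suc k)) x - P (\<tau> k) x) {..<n})"


section \<open>The constant rate TAZRP\<close>

type_synonym config = "int \<Rightarrow> nat"

abbreviation config_space :: "config measure" where
  "config_space \<equiv> Pi\<^sub>M UNIV (\<lambda>_. count_space UNIV)"

abbreviation path_space :: "(real \<Rightarrow> nat) measure" where
  "path_space \<equiv> Pi\<^sub>M {0..} (\<lambda>_. count_space UNIV)"

text \<open>
  The process is given by its graphical construction: each site carries a rate 1 exponential clock,
  the clocks being independent of each other and of the initial state, and whenever the clock of
  site i rings a particle jumps from i to i + 1 provided that i is occupied just before that time.
  Thus jumps out of i occur at rate 1 while i is occupied and at rate 0 otherwise.

  A path that is monotone or piecewise constant has a left limit at s in the discrete sense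
  (it is constant on some interval to the left of s), so statements about the state just before s
  are expressed with the filter \<^term>\<open>at_left s\<close>.
\<close>

definition jump_times :: "(real \<Rightarrow> nat) \<Rightarrow> (real \<Rightarrow> config) \<Rightarrow> int \<Rightarrow> real \<Rightarrow> real set" where
  "jump_times clock \<eta> i t =
     {s \<in> {0<..t}. (\<forall>\<^sub>F u in at_left s. clock u < clock s) \<and> (\<forall>\<^sub>F u in at_left s. \<eta> u i > 0)}"

text \<open>
  \<^term>\<open>jumps N \<omega> i t x\<close> is the number of jumps from i to i + 1 during the time interval (0, t].
  The set counted is finite whenever the path of the clock of site i is nondecreasing.
\<close>

definition jumps ::
    "(int \<Rightarrow> real \<Rightarrow> 'a \<Rightarrow> nat) \<Rightarrow> (real \<Rightarrow> 'a \<Rightarrow> config) \<Rightarrow> int \<Rightarrow> real \<Rightarrow> 'a \<Rightarrow> nat" where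
  "jumps N \<omega> i t x = card (jump_times (\<lambda>s. N i s x) (\<lambda>s. \<omega> s x) i t)"

definition tazrp ::
    "'a measure \<Rightarrow> (int \<Rightarrow> real \<Rightarrow> 'a \<Rightarrow> nat) \<Rightarrow> (real \<Rightarrow> 'a \<Rightarrow> config) \<Rightarrow> bool" where
  "tazrp M N \<omega> \<longleftrightarrow>
     prob_space M \<and>
     (\<forall>i. poisson_process M 1 (N i)) \<and>
     (\<forall>t\<ge>0. \<omega> t \<in> measurable M config_space) \<and>
     \<comment> \<open>\<^const>\<open>None\<close> indexes the initial state, \<^term>\<open>Some i\<close> the clock of site i\<close>
     prob_space.indep_sets M
       (case_option
          (sets (vimage_algebra (space M) (\<omega> 0) config_space))
          (\<lambda>i. sets (vimage_algebra (space M) (\<lambda>x. \<lambda>t\<in>{0..}. N i t x) path_space)))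
       UNIV \<and>
     (AE x in M. \<forall>i. \<forall>t\<ge>0.
        int (\<omega> t x i) = int (\<omega> 0 x i) + int (jumps N \<omega> (i - 1) t x) - int (jumps N \<omega> i t x))"

definition geom_mu :: "real \<Rightarrow> nat pmf" where
  "geom_mu \<rho> = geometric_pmf (1 / (1 + \<rho>))"

lemma pmf_geom_mu:
  assumes "\<rho> > 0"
  shows "pmf (geom_mu \<rho>) k = (\<rho> / (1 + \<rho>)) ^ k * (1 / (1 + \<rho>))"
proof -
  have "0 < 1 / (1 + \<rho>)" "1 / (1 + \<rho>) \<le> 1" "1 - 1 / (1 + \<rho>) = \<rho> / (1 + \<rho>)"
    using assms by (auto simp: field_simps)
  then show ?thesis by (simp add: geom_mu_def)
qed

text \<open>
  The product of the measures \<^term>\<open>geom_mu \<rho>\<close> is stationary for the TAZRP, so prescribing it at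
  time 0 gives the stationary process.
\<close>

definition stationary_tazrp ::
    "'a measure \<Rightarrow> real \<Rightarrow> (int \<Rightarrow> real \<Rightarrow> 'a \<Rightarrow> nat) \<Rightarrow> (real \<Rightarrow> 'a \<Rightarrow> config) \<Rightarrow> bool" where
  "stationary_tazrp M \<rho> N \<omega> \<longleftrightarrow>
     tazrp M N \<omega> \<and>
     distr M config_space (\<omega> 0) = Pi\<^sub>M UNIV (\<lambda>_. measure_pmf (geom_mu \<rho>))"


section \<open>Heights and the current\<close>

definition heights ::
    "'a measure \<Rightarrow> (int \<Rightarrow> real \<Rightarrow> 'a \<Rightarrow> nat) \<Rightarrow> (real \<Rightarrow> 'a \<Rightarrow> config) \<Rightarrow>
     (int \<Rightarrow> real \<Rightarrow> 'a \<Rightarrow> int) \<Rightarrow> bool" where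
  "heights M N \<omega> h \<longleftrightarrow>
     (\<forall>i. \<forall>t\<ge>0. h i t \<in> measurable M (count_space UNIV)) \<and>
     (AE x in M.
        h 0 0 x = 0 \<and>
        (\<forall>i. h (i - 1) 0 x - h i 0 x = int (\<omega> 0 x i)) \<and>
        (\<forall>i. \<forall>t\<ge>0. h i t x = h i 0 x + int (jumps N \<omega> i t x)))"

definition toward_zero :: "real \<Rightarrow> int" where
  "toward_zero y = (if y \<ge> 0 then \<lfloor>y\<rfloor> else \<lceil>y\<rceil>)"

definition current :: "(int \<Rightarrow> real \<Rightarrow> 'a \<Rightarrow> int) \<Rightarrow> real \<Rightarrow> real \<Rightarrow> 'a \<Rightarrow> int" where
  "current h V t x = h (toward_zero (V * t)) t x"

definition char_speed :: "real \<Rightarrow> real" where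
  "char_speed \<rho> = 1 / (1 + \<rho>)\<^sup>2"

end

theory Submission
  imports Defs "HOL-Real_Asymp.Real_Asymp"
begin

text \<open>
  Characteristics move at speed \<^term>\<open>char_speed \<rho>\<close>: writing \<open>k\<close> for the integer part of
  \<^term>\<open>char_speed \<rho> * t\<close> and \<open>j = [V t] - k\<close>, the current is
  \<open>h j 0 + (h (j + k) t - h j 0)\<close>. The first summand is a sum of \<open>\<bar>j\<bar>\<close> independent
  geometric variables, so it suffices that the increment along the characteristic has variance
  \<open>o(t)\<close>; by Cauchy-Schwarz it does not contribute to the limit.

  Let \<open>D\<close> be that increment, \<open>m\<close> its mean, and \<open>Y = (D - m) / sqrt t\<close>. Since \<open>Y\<close> has
  mean at most 0 and bounded exponential moments, it suffices to show
  \<open>limsup E exp (- s Y) \<le> 2\<close> for every \<open>s > 0\<close>. Put \<open>\<epsilon> = s / sqrt t\<close>. Heights evolve by the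
  rule \<open>h i := min (h i + 1) (h (i - 1))\<close>, which preserves pointwise minima, so the stationary
  process with ratio \<open>\<gamma> = \<rho> / (1 + \<rho>)\<close> lies above the minimum of the processes started from the
  step profiles (left, right) = \<open>(\<gamma>, \<gamma> exp (- \<epsilon>))\<close> and \<open>(\<gamma> exp \<epsilon>, \<gamma>)\<close>. For a step profile
  \<open>(\<alpha>, \<alpha> exp \<theta>)\<close> the exponential moment \<open>E exp (\<theta> h k)\<close> is explicit: tilting the initial
  state on the right cancels the initial height and leaves \<open>E exp (\<theta> J)\<close> in the stationary process
  with ratio \<open>\<alpha>\<close>, where the number \<open>J\<close> of jumps out of \<open>k\<close> is Poisson by Burke's theorem.
\<close>

text \<open>In the stationary process the number of departures depends on the initial height to
  which it is added, so \<open>E exp (\<theta> h k)\<close> has no closed form there; step profiles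
  enter because the tilted half removes that initial height. Bounds on the lower exponential moments
  suffice: \<open>E exp (- s Y)\<close> bounded for every \<open>s\<close> makes the negative part
  of \<open>Y\<close> of order \<open>1 / s\<close>, and a mean at most 0 then controls the positive
  part. The 2 counts the profiles, each contributing a term that tends to 1.

  The obstacle is that the system is infinite and known only through its paths. Influence travels to
  the right, so a silent site decouples its right side from its left; one exists in
  \<open>{a..0}\<close> with probability near 1 when \<open>a\<close> is very negative. On the
  remaining finite window, time is cut into \<open>n\<close> cells of length
  \<open>\<delta> = t / n\<close>, and paths with two rings in one cell are set aside, an event of
  probability of order \<open>1 / n\<close>. Since only upper bounds are wanted, estimates can be
  \<open>nn_integral\<close> inequalities with an error of order \<open>\<delta>\<^sup>2\<close> per
  cell, and Fatou's lemma removes the restriction to favourable paths.\<close>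

section \<open>Discrete dynamics of the heights\<close>

text \<open>
  For nonincreasing heights a ring at \<open>i\<close> moves a particle iff \<open>H i < H (i - 1)\<close>. The form with
  \<open>min\<close> agrees with this rule and is monotone and compatible with minima for all \<open>H\<close>.
\<close>

definition fire :: "(int \<Rightarrow> bool) \<Rightarrow> (int \<Rightarrow> int) \<Rightarrow> int \<Rightarrow> int" where
  "fire b H i = (if b i then min (H i + 1) (H (i - 1)) else H i)"

definition hts :: "config \<Rightarrow> int \<Rightarrow> int" where
  "hts \<eta> i = (\<Sum>l\<in>{i<..0}. int (\<eta> l)) - (\<Sum>l\<in>{0<..i}. int (\<eta> l))"

lemma hts_diff: "hts \<eta> (i - 1) - hts \<eta> i = int (\<eta> i)"
proof (cases "i \<le> 0")
  case True
  then have "{i - 1<..0} = insert i {i<..0}" by auto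
  with True show ?thesis by (simp add: hts_def)
next
  case False
  then have "{0<..i} = insert i {0<..i-1}" by auto
  with False show ?thesis by (simp add: hts_def)
qed

lemma hts_0 [simp]: "hts \<eta> 0 = 0"
  by (simp add: hts_def)

lemma fold_fire_mono:
  assumes "\<And>i. H i \<le> H' i"
  shows "fold fire bs H i \<le> fold fire bs H' i"
  using assms
proof (induction bs arbitrary: H H')
  case (Cons b bs)
  have "fire b H i \<le> fire b H' i" for i
    using Cons.prems[of i] Cons.prems[of "i - 1"] by (auto simp: fire_def min_def)
  from Cons.IH[OF this] show ?case by simp
qed simp

lemma fold_fire_min:
  "fold fire bs (\<lambda>i. min (H i) (H' i)) i = min (fold fire bs H i) (fold fire bs H' i)"
proof (induction bs arbitrary: H H')
  case (Cons b bs)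
  have "fire b (\<lambda>i. min (H i) (H' i)) = (\<lambda>i. min (fire b H i) (fire b H' i))"
    by (auto simp: fire_def fun_eq_iff min_def)
  then show ?case by (simp add: Cons.IH)
qed simp

text \<open>A ring at \<open>i\<close> reads only the heights at \<open>i\<close> and
  \<open>i - 1\<close>, so influence travels to the right. The height at \<sigma> stays frozen, and
  whatever happens left of it is never passed on.\<close>

lemma fold_fire_silent:
  assumes "\<forall>b\<in>set bs. \<not> b \<sigma>" and "\<And>i. \<sigma> \<le> i \<Longrightarrow> H i = H' i" and "\<sigma> \<le> i"
  shows "fold fire bs H i = fold fire bs H' i"
  using assms(1,2)
proof (induction bs arbitrary: H H')
  case Nil
  then show ?case using assms(3) by simp
next
  case (Cons b bs)
  have "fire b H i = fire b H' i" if "\<sigma> \<le> i" for i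
  proof (cases "i = \<sigma>")
    case True
    then show ?thesis using Cons.prems by (simp add: fire_def)
  next
    case False
    then have "\<sigma> \<le> i - 1" using that by simp
    then show ?thesis using Cons.prems(2) that by (simp add: fire_def)
  qed
  moreover have "\<forall>b\<in>set bs. \<not> b \<sigma>" using Cons.prems(1) by auto
  ultimately have "fold fire bs (fire b H) i = fold fire bs (fire b H') i" by (intro Cons.IH)
  then show ?case by simp
qed

text \<open>
  Before each step a particle enters at the left end \<open>a\<close> of the window with probability \<open>q\<close>, which
  raises the height at \<open>a - 1\<close>. A site that never rings shields everything to its right, so these
  fictitious arrivals may be averaged over at no cost; they make the product measure stationary.
\<close>

primrec open_avg :: "real \<Rightarrow> real \<Rightarrow> int \<Rightarrow> int \<Rightarrow> (int \<Rightarrow> bool) list \<Rightarrow> (int \<Rightarrow> int) \<Rightarrow> ennreal" where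
  "open_avg \<theta> q a k [] H = ennreal (exp (\<theta> * H k))"
| "open_avg \<theta> q a k (b # bs) H =
     ennreal (1 - q) * open_avg \<theta> q a k bs (fire b H)
       + ennreal q * open_avg \<theta> q a k bs (fire b (H(a - 1 := H (a - 1) + 1)))"

lemma open_avg_silent:
  assumes "\<forall>b\<in>set bs. \<not> b \<sigma>" "a \<le> \<sigma>" "\<sigma> \<le> k" "0 \<le> q" "q \<le> 1"
  shows "open_avg \<theta> q a k bs H = ennreal (exp (\<theta> * fold fire bs H k))"
  using assms(1)
proof (induction bs arbitrary: H)
  case (Cons b bs)
  have "fold fire (b # bs) (H(a - 1 := H (a - 1) + 1)) k = fold fire (b # bs) H k"
    using Cons.prems assms by (intro fold_fire_silent[of _ \<sigma>]) auto
  moreover have "ennreal (1 - q) * x + ennreal q * x = x" for x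
    using assms by (metis add.commute diff_add_cancel distrib_right ennreal_1 ennreal_plus
        diff_ge_0_iff_ge mult_1)
  moreover have "open_avg \<theta> q a k bs K = ennreal (exp (\<theta> * fold fire bs K k))" for K
    using Cons.prems by (intro Cons.IH) auto
  ultimately show ?case by simp
qed simp

text \<open>The value 0 outside the window is the default of the \<open>Pi_pmf\<close> in
  \<open>geo\<close>, so that \<open>conf_hts\<close> can be an equality of functions on the whole
  line.\<close>

definition conf :: "int \<Rightarrow> int \<Rightarrow> (int \<Rightarrow> int) \<Rightarrow> config" where
  "conf a k H i = (if i \<in> {a..k} then nat (H (i - 1) - H i) else 0)"

text \<open>
  Generator terms acting on functions of the configuration, weighted by \<^term>\<open>exp \<theta>\<close> for each
  particle that leaves the window through its last site \<open>k\<close>.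
\<close>

definition site_op :: "real \<Rightarrow> int \<Rightarrow> int \<Rightarrow> (config \<Rightarrow> ennreal) \<Rightarrow> config \<Rightarrow> ennreal" where
  "site_op \<theta> k i f \<eta> =
     (if \<eta> i = 0 then f \<eta>
      else if i < k then f (\<eta>(i := \<eta> i - 1, i + 1 := \<eta> (i + 1) + 1))
      else ennreal (exp \<theta>) * f (\<eta>(i := \<eta> i - 1)))"

text \<open>An upper bound for one time cell restricted to at most one ring: the exponential is the
  probability that no clock of the window rings, and \<delta> bounds the probability that only the
  clock of \<open>i\<close> does.\<close>

definition fire_op :: "real \<Rightarrow> int \<Rightarrow> int \<Rightarrow> real \<Rightarrow> (config \<Rightarrow> ennreal) \<Rightarrow> config \<Rightarrow> ennreal" where
  "fire_op \<theta> a k \<delta> f \<eta> =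
     ennreal (exp (- (\<delta> * card {a..k}))) * f \<eta> + ennreal \<delta> * (\<Sum>i\<in>{a..k}. site_op \<theta> k i f \<eta>)"

definition open_op ::
    "real \<Rightarrow> real \<Rightarrow> int \<Rightarrow> int \<Rightarrow> real \<Rightarrow> (config \<Rightarrow> ennreal) \<Rightarrow> config \<Rightarrow> ennreal" where
  "open_op \<theta> q a k \<delta> f \<eta> =
     ennreal (1 - q) * fire_op \<theta> a k \<delta> f \<eta> + ennreal q * fire_op \<theta> a k \<delta> f (\<eta>(a := \<eta> a + 1))"

definition bern :: "int set \<Rightarrow> real \<Rightarrow> (int \<Rightarrow> bool) pmf" where
  "bern S p = Pi_pmf S False (\<lambda>_. bernoulli_pmf p)"

definition single :: "(int \<Rightarrow> bool) \<Rightarrow> bool" where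
  "single b \<longleftrightarrow> (\<forall>i j. b i \<longrightarrow> b j \<longrightarrow> i = j)"

text \<open>Among the patterns supported in \<open>S\<close> only the empty one and the one-point
  patterns are \<open>single\<close>. A one-point pattern has probability at most
  \<open>1 - exp (- \<delta>)\<close>, hence at most \<delta>; what is given away is of second
  order.\<close>

lemma nn_integral_bern_single:
  assumes "finite S" "0 < \<delta>"
  shows "(\<integral>\<^sup>+b. indicator {b. single b} b * g b \<partial>bern S (1 - exp (- \<delta>)))
           \<le> ennreal (exp (- (\<delta> * card S))) * g (\<lambda>_. False) + ennreal \<delta> * (\<Sum>i\<in>S. g (\<lambda>j. j = i))"
proof -
  define A where "A = (\<lambda>i j. j = (i::int)) ` S"
  define \<beta> where "\<beta> = bern S (1 - exp (- \<delta>))"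
  have inj: "inj_on (\<lambda>i j. j = (i::int)) S"
    by (auto simp: inj_on_def fun_eq_iff)
  have p: "0 \<le> 1 - exp (- \<delta>)" "1 - exp (- \<delta>) \<le> 1" using assms by auto
  have pm: "pmf \<beta> b = (\<Prod>x\<in>S. pmf (bernoulli_pmf (1 - exp (- \<delta>))) (b x))"
    if "\<And>x. x \<notin> S \<Longrightarrow> \<not> b x" for b
    unfolding \<beta>_def bern_def using that assms by (subst pmf_Pi') auto
  have p0: "pmf \<beta> (\<lambda>_. False) = exp (- (\<delta> * card S))"
    using p by (subst pm) (auto simp: exp_of_nat_mult[symmetric] mult_ac)
  have p1: "pmf \<beta> (\<lambda>j. j = i) \<le> \<delta>" if "i \<in> S" for i
  proof -
    have "pmf \<beta> (\<lambda>j. j = i) = (\<Prod>x\<in>S. pmf (bernoulli_pmf (1 - exp (- \<delta>))) (x = i))"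
      using that by (subst pm) auto
    also have "\<dots> = (1 - exp (- \<delta>)) * (\<Prod>x\<in>S - {i}. pmf (bernoulli_pmf (1 - exp (- \<delta>))) (x = i))"
      using that assms p by (subst prod.remove[of _ i]) auto
    also have "\<dots> \<le> (1 - exp (- \<delta>)) * 1"
      using p by (intro mult_left_mono prod_le_1) (auto simp: pmf_le_1)
    also have "\<dots> \<le> \<delta>" using exp_ge_add_one_self[of "-\<delta>"] by simp
    finally show ?thesis .
  qed
  have "(\<integral>\<^sup>+b. indicator {b. single b} b * g b \<partial>\<beta>)
      = (\<integral>\<^sup>+b. ennreal (pmf \<beta> b) * (indicator {b. single b} b * g b) \<partial>count_space UNIV)"
    by (rule nn_integral_measure_pmf)
  also have "\<dots> = (\<integral>\<^sup>+b. ennreal (pmf \<beta> b) * (indicator {b. single b} b * g b)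
                     \<partial>count_space (insert (\<lambda>_. False) A))"
  proof (rule nn_integral_count_space_eq, goal_cases)
    case (1 b)
    show ?case
    proof (cases "b \<in> set_pmf \<beta> \<and> single b")
      case True
      then have S: "b x \<Longrightarrow> x \<in> S" for x
        using set_Pi_pmf_subset[OF assms(1), of False "\<lambda>_. bernoulli_pmf (1 - exp (- \<delta>))"]
        unfolding \<beta>_def bern_def by blast
      have "b \<in> insert (\<lambda>_. False) A"
      proof (cases "\<exists>i. b i")
        case ex: True
        then obtain i where "b i" by blast
        then have "b = (\<lambda>j. j = i)" using True by (auto simp: single_def fun_eq_iff)
        then show ?thesis using S[OF \<open>b i\<close>] by (auto simp: A_def)
      qed (auto simp: fun_eq_iff)
      then show ?thesis using 1 by simp
    qed (auto simp: indicator_def pmf_eq_0_set_pmf)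
  qed auto
  also have "\<dots> = (\<Sum>b\<in>insert (\<lambda>_. False) A. ennreal (pmf \<beta> b) * (indicator {b. single b} b * g b))"
    using assms by (intro nn_integral_count_space_finite) (auto simp: A_def)
  also have "\<dots> = ennreal (exp (- (\<delta> * card S))) * g (\<lambda>_. False)
      + (\<Sum>b\<in>A. ennreal (pmf \<beta> b) * (indicator {b. single b} b * g b))"
  proof -
    have "(\<lambda>_. False) \<notin> A" by (auto simp: A_def fun_eq_iff)
    moreover have "single (\<lambda>_. False)" by (simp add: single_def)
    ultimately show ?thesis using assms p0 by (subst sum.insert) (auto simp: A_def)
  qed
  also have "(\<Sum>b\<in>A. ennreal (pmf \<beta> b) * (indicator {b. single b} b * g b))
      \<le> (\<Sum>i\<in>S. ennreal \<delta> * g (\<lambda>j. j = i))"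
    unfolding A_def
  proof (subst sum.reindex[OF inj], unfold o_def, rule sum_mono)
    fix i assume "i \<in> S"
    then have "ennreal (pmf \<beta> (\<lambda>j. j = i)) * (indicator {b. single b} (\<lambda>j. j = i) * g (\<lambda>j. j = i))
        \<le> ennreal \<delta> * (1 * g (\<lambda>j. j = i))"
      using p1 by (intro mult_mono ennreal_leI) (auto simp: indicator_def)
    then show "ennreal (pmf \<beta> (\<lambda>j. j = i)) * (indicator {b. single b} (\<lambda>j. j = i) * g (\<lambda>j. j = i))
        \<le> ennreal \<delta> * g (\<lambda>j. j = i)" by simp
  qed
  finally show ?thesis by (simp add: \<beta>_def sum_distrib_left)
qed

text \<open>The height at \<open>k\<close> rises only when a particle leaves through
  \<open>k\<close>, which is where \<open>site_op\<close> carries the factor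
  \<open>exp \<theta>\<close>. So the weight of the height at \<open>k\<close> splits off and a
  function of the configuration alone remains.\<close>

lemma conf_fire_single:
  fixes \<theta> :: real
  assumes H: "\<And>j. j \<in> {a..k} \<Longrightarrow> H j \<le> H (j - 1)" and i: "i \<in> {a..k}"
  shows "\<And>j. j \<in> {a..k} \<Longrightarrow> fire (\<lambda>j. j = i) H j \<le> fire (\<lambda>j. j = i) H (j - 1)"
    and "ennreal (exp (\<theta> * fire (\<lambda>j. j = i) H k)) * f (conf a k (fire (\<lambda>j. j = i) H))
          = ennreal (exp (\<theta> * H k)) * site_op \<theta> k i f (conf a k H)"
proof -
  show "fire (\<lambda>j. j = i) H j \<le> fire (\<lambda>j. j = i) H (j - 1)" if "j \<in> {a..k}" for j
    using H[OF that] H[OF i] by (auto simp: fire_def min_def)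
  have Hi: "H i \<le> H (i - 1)" using H i by auto
  show "ennreal (exp (\<theta> * fire (\<lambda>j. j = i) H k)) * f (conf a k (fire (\<lambda>j. j = i) H))
          = ennreal (exp (\<theta> * H k)) * site_op \<theta> k i f (conf a k H)"
  proof (cases "H i = H (i - 1)")
    case True
    then have "fire (\<lambda>j. j = i) H = H" by (auto simp: fire_def fun_eq_iff)
    then show ?thesis using True i by (simp add: site_op_def conf_def)
  next
    case False
    then have fH: "fire (\<lambda>j. j = i) H = H(i := H i + 1)" using Hi by (auto simp: fire_def fun_eq_iff)
    have ne: "conf a k H i \<noteq> 0" using False Hi i by (simp add: conf_def)
    show ?thesis
    proof (cases "i < k")
      case True
      have "conf a k (H(i := H i + 1))
          = (conf a k H)(i := conf a k H i - 1, i + 1 := conf a k H (i + 1) + 1)"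
        using i True False H[of "i + 1"] Hi by (auto simp: conf_def fun_eq_iff nat_diff_distrib)
      then show ?thesis using True ne fH by (simp add: site_op_def)
    next
      case F: False
      then have ik: "i = k" using i by simp
      have "conf a k (H(i := H i + 1)) = (conf a k H)(i := conf a k H i - 1)"
        using i ik False Hi by (auto simp: conf_def fun_eq_iff)
      then show ?thesis using ik ne fH
        by (simp add: site_op_def algebra_simps exp_add ennreal_mult)
    qed
  qed
qed

lemma ennreal_le_indicator_mult: "indicator A x * (y::ennreal) \<le> y"
  by (auto simp: indicator_def)

lemma nn_integral_pmf_linear:
  fixes c A B :: ennreal
  shows "(\<integral>\<^sup>+x. c * (f x * (A * g x + B * h x)) \<partial>measure_pmf p)
           = c * (A * (\<integral>\<^sup>+x. f x * g x \<partial>measure_pmf p) + B * (\<integral>\<^sup>+x. f x * h x \<partial>measure_pmf p))"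
proof -
  have "(\<lambda>x. c * (f x * (A * g x + B * h x))) = (\<lambda>x. c * (A * (f x * g x) + B * (f x * h x)))"
    by (simp add: distrib_left mult_ac)
  then show ?thesis
    by (simp add: nn_integral_cmult nn_integral_add)
qed

text \<open>With \<open>exp (\<theta> * H k)\<close> split off, the heights matter only through
  \<open>conf a k H\<close>, and averaging over arrival and rings of one cell becomes one
  application of \<open>open_op\<close>. The induction quantifies over all profiles that are
  nonincreasing on the window, since firing and arrivals preserve this property.\<close>

lemma open_avg_le:
  assumes "a \<le> k" "0 < \<delta>" "0 \<le> q" "q \<le> 1" "\<And>j. j \<in> {a..k} \<Longrightarrow> H j \<le> H (j - 1)"
  shows "(\<integral>\<^sup>+bs. indicator {bs. \<forall>b\<in>set bs. single b} bs * open_avg \<theta> q a k bs H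
            \<partial>replicate_pmf n (bern {a..k} (1 - exp (- \<delta>))))
         \<le> ennreal (exp (\<theta> * H k)) * ((open_op \<theta> q a k \<delta> ^^ n) (\<lambda>_. 1)) (conf a k H)"
  using assms(5)
proof (induction n arbitrary: H)
  case 0
  then show ?case by simp
next
  case (Suc n)
  define \<beta> where "\<beta> = bern {a..k} (1 - exp (- \<delta>))"
  define F where "F = (open_op \<theta> q a k \<delta> ^^ n) (\<lambda>_. 1)"
  define G where "G = (\<lambda>H. ennreal (exp (\<theta> * real_of_int (H k))) * F (conf a k H))"
  define E where "E = (\<lambda>H. \<integral>\<^sup>+bs. indicator {bs. \<forall>b\<in>set bs. single b} bs * open_avg \<theta> q a k bs H
            \<partial>replicate_pmf n \<beta>)"
  define H' where "H' = H(a - 1 := H (a - 1) + 1)"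
  have H'le: "H' j \<le> H' (j - 1)" if "j \<in> {a..k}" for j
    using Suc.prems[OF that] that by (auto simp: H'_def)
  have fop: "(\<integral>\<^sup>+b. indicator {b. single b} b * E (fire b K) \<partial>\<beta>)
      \<le> ennreal (exp (\<theta> * K k)) * fire_op \<theta> a k \<delta> F (conf a k K)"
    if K: "\<And>j. j \<in> {a..k} \<Longrightarrow> K j \<le> K (j - 1)" for K
  proof -
    have "(\<integral>\<^sup>+b. indicator {b. single b} b * E (fire b K) \<partial>\<beta>)
      \<le> ennreal (exp (- (\<delta> * card {a..k}))) * E (fire (\<lambda>_. False) K)
         + ennreal \<delta> * (\<Sum>i\<in>{a..k}. E (fire (\<lambda>j. j = i) K))"
      unfolding \<beta>_def using assms by (intro nn_integral_bern_single) auto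
    also have "\<dots> \<le> ennreal (exp (- (\<delta> * card {a..k}))) * G K
         + ennreal \<delta> * (\<Sum>i\<in>{a..k}. G (fire (\<lambda>j. j = i) K))"
    proof (intro add_mono mult_left_mono sum_mono)
      have "fire (\<lambda>_. False) K = K" by (simp add: fire_def fun_eq_iff)
      then show "E (fire (\<lambda>_. False) K) \<le> G K"
        using Suc.IH[of K] K by (simp add: E_def G_def F_def \<beta>_def)
      show "E (fire (\<lambda>j. j = i) K) \<le> G (fire (\<lambda>j. j = i) K)" if "i \<in> {a..k}" for i
        unfolding E_def G_def F_def \<beta>_def
        by (rule Suc.IH, rule conf_fire_single) (use K that in auto)
    qed auto
    also have "(\<Sum>i\<in>{a..k}. G (fire (\<lambda>j. j = i) K))
        = (\<Sum>i\<in>{a..k}. ennreal (exp (\<theta> * K k)) * site_op \<theta> k i F (conf a k K))"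
      unfolding G_def
    proof (rule sum.cong[OF refl])
      fix i assume i: "i \<in> {a..k}"
      show
        "ennreal (exp (\<theta> * real_of_int (fire (\<lambda>j. j = i) K k))) * F (conf a k (fire (\<lambda>j. j = i) K))
           = ennreal (exp (\<theta> * K k)) * site_op \<theta> k i F (conf a k K)"
        by (rule conf_fire_single(2)) (use K i in auto)
    qed
    also have "ennreal (exp (- (\<delta> * card {a..k}))) * G K + ennreal \<delta> * \<dots>
       = ennreal (exp (\<theta> * K k)) * fire_op \<theta> a k \<delta> F (conf a k K)"
      by (simp add: G_def fire_op_def algebra_simps flip: sum_distrib_left)
    finally show ?thesis .
  qed
  have "(\<integral>\<^sup>+bs. indicator {bs. \<forall>b\<in>set bs. single b} bs * open_avg \<theta> q a k bs H
            \<partial>replicate_pmf (Suc n) \<beta>)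
     = (\<integral>\<^sup>+b. \<integral>\<^sup>+bs. indicator {b. single b} b * (indicator {bs. \<forall>b\<in>set bs. single b} bs *
         (ennreal (1 - q) * open_avg \<theta> q a k bs (fire b H) + ennreal q * open_avg \<theta> q a k bs (fire b H')))
         \<partial>replicate_pmf n \<beta> \<partial>\<beta>)"
    unfolding H'_def replicate_pmf.simps nn_integral_bind_pmf nn_integral_return_pmf
    by (intro nn_integral_cong) (auto simp: indicator_def)
  also have "\<dots> = (\<integral>\<^sup>+b. indicator {b. single b} b * (ennreal (1 - q) * E (fire b H) + ennreal q * E (fire b H')) \<partial>\<beta>)"
  proof (intro nn_integral_cong)
    fix b
    show "(\<integral>\<^sup>+bs. indicator {b. single b} b * (indicator {bs. \<forall>b\<in>set bs. single b} bs *
         (ennreal (1 - q) * open_avg \<theta> q a k bs (fire b H) + ennreal q * open_avg \<theta> q a k bs (fire b H')))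
         \<partial>replicate_pmf n \<beta>) = indicator {b. single b} b * (ennreal (1 - q) * E (fire b H) + ennreal q * E (fire b H'))"
      unfolding E_def by (rule nn_integral_pmf_linear)
  qed
  also have "\<dots> = ennreal (1 - q) * (\<integral>\<^sup>+b. indicator {b. single b} b * E (fire b H) \<partial>\<beta>)
      + ennreal q * (\<integral>\<^sup>+b. indicator {b. single b} b * E (fire b H') \<partial>\<beta>)"
    using nn_integral_pmf_linear[where c = 1 and f = "indicator {b. single b}"] by simp
  also have "\<dots> \<le> ennreal (1 - q) * (ennreal (exp (\<theta> * H k)) * fire_op \<theta> a k \<delta> F (conf a k H))
      + ennreal q * (ennreal (exp (\<theta> * H' k)) * fire_op \<theta> a k \<delta> F (conf a k H'))"
    using Suc.prems H'le by (intro add_mono mult_left_mono fop) auto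
  \<comment> \<open>Raising the height at \<open>a - 1\<close> adds a particle at \<open>a\<close>
    and, as \<open>a \<le> k\<close>, leaves the height at \<open>k\<close> alone.\<close>
  also have "conf a k H' = (conf a k H)(a := conf a k H a + 1)"
    using Suc.prems[of a] assms(1) by (auto simp: conf_def H'_def fun_eq_iff)
  also have "H' k = H k" using assms(1) by (simp add: H'_def)
  also have "ennreal (1 - q) * (ennreal (exp (\<theta> * H k)) * fire_op \<theta> a k \<delta> F (conf a k H))
      + ennreal q * (ennreal (exp (\<theta> * H k)) * fire_op \<theta> a k \<delta> F ((conf a k H)(a := conf a k H a + 1)))
      = ennreal (exp (\<theta> * H k)) * open_op \<theta> q a k \<delta> F (conf a k H)"
    by (simp add: open_op_def algebra_simps)
  finally show ?case by (simp add: \<beta>_def F_def)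
qed

section \<open>Burke's theorem in tilted form\<close>

text \<open>Successive weights of the geometric law have ratio \<alpha>. The indicator removes the
  term at 0, where truncated subtraction would count \<open>G 0\<close> a second time.\<close>

lemma nn_integral_geometric_shift:
  assumes "0 < \<alpha>" "\<alpha> < 1"
  shows "(\<integral>\<^sup>+x. indicator {x. x \<noteq> 0} x * G (x - 1) \<partial>geometric_pmf (1 - \<alpha>))
           = ennreal \<alpha> * (\<integral>\<^sup>+x. G x \<partial>geometric_pmf (1 - \<alpha>))"
proof -
  define f where "f n = ennreal (pmf (geometric_pmf (1 - \<alpha>)) n) * (indicator {x. x \<noteq> 0} n * G (n - 1))" for n
  have "suminf f = (\<Sum>j. f (j + 1)) + (\<Sum>j<1. f j)"
    by (rule suminf_offset) simp
  also have "\<dots> = (\<Sum>j. ennreal \<alpha> * (ennreal (pmf (geometric_pmf (1 - \<alpha>)) j) * G j))"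
    using assms by (simp add: f_def mult.assoc ennreal_mult' mult.left_commute)
  finally show ?thesis
    unfolding f_def nn_integral_measure_pmf nn_integral_count_space_nat ennreal_suminf_cmult .
qed

text \<open>
  The parameter of each site is the ratio \<open>\<alpha> i\<close> of the geometric law, not its mean
  \<open>\<alpha> i / (1 - \<alpha> i)\<close>.
\<close>

definition geo :: "int set \<Rightarrow> (int \<Rightarrow> real) \<Rightarrow> config pmf" where
  "geo S \<alpha> = Pi_pmf S 0 (\<lambda>i. geometric_pmf (1 - \<alpha> i))"

lemma nn_integral_geo_shift:
  assumes "finite S" "i \<in> S" "0 < \<alpha> i" "\<alpha> i < 1"
  shows "(\<integral>\<^sup>+\<eta>. indicator {\<eta>. \<eta> i \<noteq> 0} \<eta> * g (\<eta>(i := \<eta> i - 1)) \<partial>geo S \<alpha>)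
           = ennreal (\<alpha> i) * (\<integral>\<^sup>+\<eta>. g \<eta> \<partial>geo S \<alpha>)"
proof -
  define A where "A = S - {i}"
  have S: "geo S \<alpha> = map_pmf (\<lambda>(y,f). f(i := y)) (pair_pmf (geometric_pmf (1 - \<alpha> i)) (geo A \<alpha>))"
    unfolding geo_def A_def using assms insert_Diff[of i S]
    by (subst Pi_pmf_insert[symmetric]) auto
  have "(\<integral>\<^sup>+\<eta>. indicator {\<eta>. \<eta> i \<noteq> 0} \<eta> * g (\<eta>(i := \<eta> i - 1)) \<partial>geo S \<alpha>)
    = (\<integral>\<^sup>+f. \<integral>\<^sup>+y. indicator {y. y \<noteq> 0} y * g (f(i := y - 1)) \<partial>geometric_pmf (1 - \<alpha> i) \<partial>geo A \<alpha>)"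
    unfolding S by (subst pair_commute_pmf) (simp add: nn_integral_pair_pmf' case_prod_unfold indicator_def)
  also have "\<dots> = (\<integral>\<^sup>+f. ennreal (\<alpha> i) * (\<integral>\<^sup>+y. g (f(i := y)) \<partial>geometric_pmf (1 - \<alpha> i)) \<partial>geo A \<alpha>)"
    using assms by (subst nn_integral_geometric_shift) auto
  also have "\<dots> = ennreal (\<alpha> i) * (\<integral>\<^sup>+\<eta>. g \<eta> \<partial>geo S \<alpha>)"
    unfolding S by (subst pair_commute_pmf) (simp add: nn_integral_pair_pmf' case_prod_unfold nn_integral_cmult)
  finally show ?thesis .
qed

text \<open>This is the adjoint of \<open>site_op\<close> under the product measure. Removing a
  particle at \<open>i\<close> yields a factor \<alpha>; a neighbour inside the window turns it into
  the indicator that the neighbour is occupied, while at \<open>i = k\<close> it survives as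
  \<open>\<alpha> * exp \<theta>\<close>.\<close>

lemma nn_integral_site_op:
  assumes \<alpha>: "0 < \<alpha>" "\<alpha> < 1" and i: "i \<in> {a..k}"
  shows "(\<integral>\<^sup>+\<eta>. site_op \<theta> k i f \<eta> \<partial>geo {a..k} (\<lambda>_. \<alpha>))
     = (\<integral>\<^sup>+\<eta>. f \<eta> * (indicator {\<eta>. \<eta> i = 0} \<eta>
           + (if i < k then indicator {\<eta>. \<eta> (i + 1) \<noteq> 0} \<eta> else ennreal (\<alpha> * exp \<theta>))) \<partial>geo {a..k} (\<lambda>_. \<alpha>))"
proof -
  define \<pi> where "\<pi> = geo {a..k} (\<lambda>_. \<alpha>)"
  define g where "g = (\<lambda>\<eta>. if i < k then f (\<eta>(i + 1 := \<eta> (i + 1) + 1)) else ennreal (exp \<theta>) * f \<eta>)"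
  have "site_op \<theta> k i f \<eta> = f \<eta> * indicator {\<eta>. \<eta> i = 0} \<eta>
      + indicator {\<eta>. \<eta> i \<noteq> 0} \<eta> * g (\<eta>(i := \<eta> i - 1))" for \<eta>
    by (auto simp: site_op_def g_def)
  then have "(\<integral>\<^sup>+\<eta>. site_op \<theta> k i f \<eta> \<partial>\<pi>) = (\<integral>\<^sup>+\<eta>. f \<eta> * indicator {\<eta>. \<eta> i = 0} \<eta> \<partial>\<pi>)
      + (\<integral>\<^sup>+\<eta>. indicator {\<eta>. \<eta> i \<noteq> 0} \<eta> * g (\<eta>(i := \<eta> i - 1)) \<partial>\<pi>)"
    by (simp add: nn_integral_add)
  also have "(\<integral>\<^sup>+\<eta>. indicator {\<eta>. \<eta> i \<noteq> 0} \<eta> * g (\<eta>(i := \<eta> i - 1)) \<partial>\<pi>) = ennreal \<alpha> * (\<integral>\<^sup>+\<eta>. g \<eta> \<partial>\<pi>)"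
    unfolding \<pi>_def using assms by (intro nn_integral_geo_shift) auto
  also have "\<dots> = (\<integral>\<^sup>+\<eta>. f \<eta> * (if i < k then indicator {\<eta>. \<eta> (i + 1) \<noteq> 0} \<eta> else ennreal (\<alpha> * exp \<theta>)) \<partial>\<pi>)"
  proof (cases "i < k")
    case True
    \<comment> \<open>The same shift identity, now read backwards at \<open>i + 1\<close>:
      \<open>g\<close> puts a particle there, so removing it again gives back
      \<open>f\<close>.\<close>
    then have "(\<integral>\<^sup>+\<eta>. indicator {\<eta>. \<eta> (i + 1) \<noteq> 0} \<eta> * g (\<eta>(i + 1 := \<eta> (i + 1) - 1)) \<partial>\<pi>)
        = ennreal \<alpha> * (\<integral>\<^sup>+\<eta>. g \<eta> \<partial>\<pi>)"
      unfolding \<pi>_def using assms by (intro nn_integral_geo_shift) auto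
    moreover have "indicator {\<eta>. \<eta> (i + 1) \<noteq> 0} \<eta> * g (\<eta>(i + 1 := \<eta> (i + 1) - 1))
        = f \<eta> * indicator {\<eta>. \<eta> (i + 1) \<noteq> 0} \<eta>" for \<eta>
      using True by (auto simp: g_def indicator_def)
    ultimately show ?thesis using True by simp
  next
    case False
    then have "(\<integral>\<^sup>+\<eta>. g \<eta> \<partial>\<pi>) = ennreal (exp \<theta>) * (\<integral>\<^sup>+\<eta>. f \<eta> \<partial>\<pi>)"
      by (simp add: g_def nn_integral_cmult)
    then show ?thesis using False \<alpha>
      by (simp add: nn_integral_multc) (simp add: ennreal_mult mult_ac)
  qed
  also have "(\<integral>\<^sup>+\<eta>. f \<eta> * indicator {\<eta>. \<eta> i = 0} \<eta> \<partial>\<pi>) + \<dots>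
     = (\<integral>\<^sup>+\<eta>. f \<eta> * (indicator {\<eta>. \<eta> i = 0} \<eta>
           + (if i < k then indicator {\<eta>. \<eta> (i + 1) \<noteq> 0} \<eta> else ennreal (\<alpha> * exp \<theta>))) \<partial>\<pi>)"
    by (simp add: distrib_left flip: nn_integral_add)
  finally show ?thesis by (simp add: \<pi>_def)
qed

text \<open>Regrouped by site, the indicators of an empty and of an occupied site add up to 1. The
  occupied ones run over \<open>a + 1\<close> to \<open>k\<close> only, so the extra summand
  completes the pair at \<open>a\<close>.\<close>

lemma sum_site_weights:
  fixes \<eta> :: config and c :: ennreal
  assumes "a \<le> k"
  shows "(\<Sum>i\<in>{a..k}. indicator {\<eta>. \<eta> i = 0} \<eta>
           + (if i < k then indicator {\<eta>. \<eta> (i + 1) \<noteq> 0} \<eta> else c)) + indicator {\<eta>. \<eta> a \<noteq> 0} \<eta>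
         = of_nat (card {a..k}) + c"
proof -
  let ?z = "\<lambda>i. indicator {\<eta>. \<eta> i = 0} \<eta> :: ennreal" and ?o = "\<lambda>i. indicator {\<eta>. \<eta> i \<noteq> 0} \<eta> :: ennreal"
  have "(\<Sum>i\<in>{a..k}. if i < k then ?o (i + 1) else c) = (\<Sum>i\<in>{a..<k}. ?o (i + 1)) + c"
  proof -
    have "{a..k} = insert k {a..<k}" using assms by auto
    then show ?thesis by (simp add: add.commute)
  qed
  also have "(\<Sum>i\<in>{a..<k}. ?o (i + 1)) = (\<Sum>i\<in>{a<..k}. ?o i)"
    by (rule sum.reindex_bij_witness[of _ "\<lambda>i. i - 1" "\<lambda>i. i + 1"]) auto
  finally have 1: "(\<Sum>i\<in>{a..k}. if i < k then ?o (i + 1) else c) = (\<Sum>i\<in>{a<..k}. ?o i) + c" .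
  have "(\<Sum>i\<in>{a..k}. ?o i) = ?o a + (\<Sum>i\<in>{a<..k}. ?o i)"
  proof -
    have "{a..k} = insert a {a<..k}" using assms by auto
    then show ?thesis by simp
  qed
  moreover have "(\<Sum>i\<in>{a..k}. ?z i) + (\<Sum>i\<in>{a..k}. ?o i) = (\<Sum>i\<in>{a..k}. 1)"
    unfolding sum.distrib[symmetric] by (intro sum.cong) (auto simp: indicator_def)
  ultimately show ?thesis using 1 by (simp add: sum.distrib ac_simps)
qed

text \<open>Here \<open>z\<close> stands for \<open>exp \<theta>\<close> and \<open>m\<close> for
  the number of sites. To first order \<open>m\<close> cancels and the Poisson exponent
  \<open>\<alpha> * (z - 1)\<close> is left. In the coefficient of \<open>\<delta>\<^sup>2\<close>,
  the term \<open>m\<^sup>2\<close> comes from expanding the exponential, \<open>2 * m\<close> from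
  the cross term and the last summand, and \<open>z\<close> from the last summand.\<close>

lemma burke_rate_bound:
  fixes \<alpha> \<delta> m z :: real
  assumes "0 \<le> \<alpha>" "\<alpha> \<le> 1" "0 \<le> \<delta>" "\<alpha> * \<delta> \<le> 1" "0 \<le> m" "0 \<le> z"
  shows "(1 - \<alpha> * \<delta>) * exp (- (\<delta> * m)) + \<delta> * (m + \<alpha> * z) + \<delta>\<^sup>2 * (m + \<alpha> * z)
           \<le> exp (\<alpha> * (z - 1) * \<delta> + (m\<^sup>2 + 2 * m + z) * \<delta>\<^sup>2)"
proof -
  define x where "x = \<delta> * m"
  have x: "0 \<le> x" using assms by (simp add: x_def)
  have "exp (- x) * (1 + x) \<le> exp (- x) * exp x"
    by (intro mult_left_mono) auto
  also have "\<dots> = 1" by (simp flip: exp_add)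
  also have "1 \<le> (1 - x + x\<^sup>2) * (1 + x)"
    using x by (simp add: algebra_simps power2_eq_square)
  finally have "exp (- x) \<le> 1 - x + x\<^sup>2" using x by (auto dest: mult_right_le_imp_le)
  then have "(1 - \<alpha> * \<delta>) * exp (- x) \<le> (1 - \<alpha> * \<delta>) * (1 - x + x\<^sup>2)"
    using assms by (intro mult_left_mono) auto
  also have "\<dots> = 1 - \<alpha> * \<delta> - x + \<alpha> * (\<delta> * x) + x\<^sup>2 - \<alpha> * \<delta> * x\<^sup>2"
    by (simp add: algebra_simps)
  also have "\<dots> \<le> 1 - \<alpha> * \<delta> - x + 1 * (\<delta> * x) + x\<^sup>2 - 0"
    using assms x by (intro add_mono diff_mono mult_right_mono order.refl) auto
  finally have 1: "(1 - \<alpha> * \<delta>) * exp (- x) \<le> 1 - \<alpha> * \<delta> - \<delta> * m + \<delta>\<^sup>2 * m + \<delta>\<^sup>2 * m\<^sup>2"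
    by (simp add: x_def power2_eq_square algebra_simps)
  have "\<delta>\<^sup>2 * (\<alpha> * z) \<le> \<delta>\<^sup>2 * z"
    using assms by (intro mult_left_mono mult_left_le_one_le) auto
  with 1 have "(1 - \<alpha> * \<delta>) * exp (- (\<delta> * m)) + \<delta> * (m + \<alpha> * z) + \<delta>\<^sup>2 * (m + \<alpha> * z)
      \<le> 1 + (\<alpha> * (z - 1) * \<delta> + (m\<^sup>2 + 2 * m + z) * \<delta>\<^sup>2)"
    by (simp add: x_def algebra_simps)
  also have "\<dots> \<le> exp (\<alpha> * (z - 1) * \<delta> + (m\<^sup>2 + 2 * m + z) * \<delta>\<^sup>2)"
    by (rule exp_ge_add_one_self)
  finally show ?thesis .
qed

text \<open>
  Burke's theorem: up to \<open>O(\<delta>\<^sup>2)\<close> the product measure is a left eigenvector of the tilted open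
  dynamics, the eigenvalue being that of a Poisson process of rate \<open>\<alpha>\<close>. The bookkeeping is
  \<open>sum_site_weights\<close>: the deficit at the site \<open>a\<close> without neighbour is what the arrivals supply.
\<close>

lemma nn_integral_open_op_le:
  assumes \<alpha>: "0 < \<alpha>" "\<alpha> < 1" and ak: "a \<le> k" and \<delta>: "0 < \<delta>" "\<alpha> * \<delta> \<le> 1"
  shows "(\<integral>\<^sup>+\<eta>. open_op \<theta> (\<alpha> * \<delta>) a k \<delta> f \<eta> \<partial>geo {a..k} (\<lambda>_. \<alpha>))
     \<le> ennreal (exp (\<alpha> * (exp \<theta> - 1) * \<delta>
           + ((real (card {a..k}))\<^sup>2 + 2 * real (card {a..k}) + exp \<theta>) * \<delta>\<^sup>2))
         * (\<integral>\<^sup>+\<eta>. f \<eta> \<partial>geo {a..k} (\<lambda>_. \<alpha>))"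
proof -
  define \<pi> where "\<pi> = geo {a..k} (\<lambda>_. \<alpha>)"
  define m where "m = real (card {a..k})"
  define I where "I = (\<integral>\<^sup>+\<eta>. f \<eta> \<partial>\<pi>)"
  define w where "w = ennreal (exp (- (\<delta> * m)))"
  define L where "L = fire_op \<theta> a k \<delta> f"
  define X where "X = (\<Sum>i\<in>{a..k}. \<integral>\<^sup>+\<eta>. site_op \<theta> k i f \<eta> \<partial>\<pi>)"
  define Y where "Y = (\<integral>\<^sup>+\<eta>. f \<eta> * indicator {\<eta>. \<eta> a \<noteq> 0} \<eta> \<partial>\<pi>)"
  have L: "L \<eta> = w * f \<eta> + ennreal \<delta> * (\<Sum>i\<in>{a..k}. site_op \<theta> k i f \<eta>)" for \<eta>
    by (simp add: L_def fire_op_def w_def m_def)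
  have XY: "X + Y = ennreal (m + \<alpha> * exp \<theta>) * I"
  proof -
    have "X + Y = (\<integral>\<^sup>+\<eta>. f \<eta> * ((\<Sum>i\<in>{a..k}. indicator {\<eta>. \<eta> i = 0} \<eta>
           + (if i < k then indicator {\<eta>. \<eta> (i + 1) \<noteq> 0} \<eta> else ennreal (\<alpha> * exp \<theta>)))
           + indicator {\<eta>. \<eta> a \<noteq> 0} \<eta>) \<partial>\<pi>)"
      unfolding X_def Y_def \<pi>_def using \<alpha>
      by (simp add: nn_integral_site_op nn_integral_sum[symmetric] nn_integral_add[symmetric]
          distrib_left[symmetric] sum_distrib_left[symmetric] del: nn_integral_sum)
    also have "\<dots> = (\<integral>\<^sup>+\<eta>. f \<eta> * ennreal (m + \<alpha> * exp \<theta>) \<partial>\<pi>)"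
      using \<alpha> unfolding sum_site_weights[OF ak] m_def by (simp add: ennreal_of_nat_eq_real_of_nat)
    finally show ?thesis by (simp add: I_def nn_integral_multc mult.commute)
  qed
  have X: "X \<le> ennreal (m + \<alpha> * exp \<theta>) * I"
    unfolding XY[symmetric] by simp
  have EL: "(\<integral>\<^sup>+\<eta>. L \<eta> \<partial>\<pi>) = w * I + ennreal \<delta> * X"
    by (simp add: L I_def X_def nn_integral_add nn_integral_cmult nn_integral_sum)
  \<comment> \<open>By the shift identity, an arrival weighted with \<alpha> is the restriction to
    configurations with \<open>a\<close> occupied. Its leading part \<open>\<delta> * Y\<close> is
    exactly what completes \<open>X\<close> to \<open>X + Y\<close>; the remainder carries
    \<open>\<delta>\<^sup>2\<close>.\<close>
  have EA: "ennreal (\<alpha> * \<delta>) * (\<integral>\<^sup>+\<eta>. L (\<eta>(a := \<eta> a + 1)) \<partial>\<pi>) \<le> ennreal \<delta> * Y + ennreal (\<delta>\<^sup>2) * X"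
  proof -
    have "ennreal \<alpha> * (\<integral>\<^sup>+\<eta>. L (\<eta>(a := \<eta> a + 1)) \<partial>\<pi>)
        = (\<integral>\<^sup>+\<eta>. indicator {\<eta>. \<eta> a \<noteq> 0} \<eta> * L ((\<eta>(a := \<eta> a - 1))(a := (\<eta>(a := \<eta> a - 1)) a + 1)) \<partial>\<pi>)"
      unfolding \<pi>_def using assms by (subst nn_integral_geo_shift) auto
    also have "\<dots> = (\<integral>\<^sup>+\<eta>. indicator {\<eta>. \<eta> a \<noteq> 0} \<eta> * L \<eta> \<partial>\<pi>)"
      by (intro nn_integral_cong) (auto simp: indicator_def)
    also have "\<dots> \<le> (\<integral>\<^sup>+\<eta>. f \<eta> * indicator {\<eta>. \<eta> a \<noteq> 0} \<eta>
          + ennreal \<delta> * (\<Sum>i\<in>{a..k}. site_op \<theta> k i f \<eta>) \<partial>\<pi>)"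
    proof (intro nn_integral_mono)
      fix \<eta> :: config
      have "w * f \<eta> \<le> 1 * f \<eta>" using \<delta> by (intro mult_right_mono) (auto simp: w_def m_def)
      then show "indicator {\<eta>. \<eta> a \<noteq> 0} \<eta> * L \<eta> \<le> f \<eta> * indicator {\<eta>. \<eta> a \<noteq> 0} \<eta>
          + ennreal \<delta> * (\<Sum>i\<in>{a..k}. site_op \<theta> k i f \<eta>)"
        unfolding L by (auto simp: indicator_def intro: add_mono)
    qed
    also have "\<dots> = Y + ennreal \<delta> * X"
      by (simp add: Y_def X_def nn_integral_add nn_integral_cmult nn_integral_sum)
    finally have "ennreal \<delta> * (ennreal \<alpha> * (\<integral>\<^sup>+\<eta>. L (\<eta>(a := \<eta> a + 1)) \<partial>\<pi>)) \<le> ennreal \<delta> * (Y + ennreal \<delta> * X)"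
      by (rule mult_left_mono) simp
    then show ?thesis using \<alpha> \<delta>
      by (simp add: ennreal_mult power2_eq_square distrib_left mult_ac)
  qed
  have "(\<integral>\<^sup>+\<eta>. open_op \<theta> (\<alpha> * \<delta>) a k \<delta> f \<eta> \<partial>\<pi>)
     = ennreal (1 - \<alpha> * \<delta>) * (\<integral>\<^sup>+\<eta>. L \<eta> \<partial>\<pi>) + ennreal (\<alpha> * \<delta>) * (\<integral>\<^sup>+\<eta>. L (\<eta>(a := \<eta> a + 1)) \<partial>\<pi>)"
    by (simp add: open_op_def L_def nn_integral_add nn_integral_cmult)
  also have "\<dots> \<le> ennreal (1 - \<alpha> * \<delta>) * (w * I + ennreal \<delta> * X) + (ennreal \<delta> * Y + ennreal (\<delta>\<^sup>2) * X)"
    unfolding EL by (intro add_mono EA order.refl)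
  also have "\<dots> \<le> ennreal (1 - \<alpha> * \<delta>) * (w * I) + 1 * (ennreal \<delta> * X) + (ennreal \<delta> * Y + ennreal (\<delta>\<^sup>2) * X)"
  proof -
    have "ennreal (1 - \<alpha> * \<delta>) * (ennreal \<delta> * X) \<le> 1 * (ennreal \<delta> * X)"
      using \<alpha> \<delta> by (intro mult_right_mono) auto
    then show ?thesis by (simp add: distrib_left add_mono)
  qed
  also have "\<dots> = ennreal (1 - \<alpha> * \<delta>) * (w * I) + ennreal \<delta> * (X + Y) + ennreal (\<delta>\<^sup>2) * X"
    by (simp add: distrib_left ac_simps)
  also have "\<dots> \<le> ennreal (1 - \<alpha> * \<delta>) * (w * I) + ennreal \<delta> * (X + Y)
       + ennreal (\<delta>\<^sup>2) * (ennreal (m + \<alpha> * exp \<theta>) * I)"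
    by (intro add_mono mult_left_mono X order.refl) auto
  also have "\<dots> = ennreal ((1 - \<alpha> * \<delta>) * exp (- (\<delta> * m)) + \<delta> * (m + \<alpha> * exp \<theta>) + \<delta>\<^sup>2 * (m + \<alpha> * exp \<theta>)) * I"
  proof -
    have "0 \<le> m + \<alpha> * exp \<theta>" using \<alpha> by (simp add: m_def)
    then show ?thesis
      unfolding XY w_def using \<alpha> \<delta> by (simp add: ennreal_plus ennreal_mult distrib_right mult.assoc)
  qed
  also have "\<dots> \<le> ennreal (exp (\<alpha> * (exp \<theta> - 1) * \<delta> + (m\<^sup>2 + 2 * m + exp \<theta>) * \<delta>\<^sup>2)) * I"
    using \<alpha> \<delta> by (intro mult_right_mono ennreal_leI burke_rate_bound) (auto simp: m_def)
  finally show ?thesis by (simp add: I_def \<pi>_def m_def)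
qed

lemma nn_integral_open_op_power_le:
  assumes \<alpha>: "0 < \<alpha>" "\<alpha> < 1" and ak: "a \<le> k" and \<delta>: "0 < \<delta>" "\<alpha> * \<delta> \<le> 1"
  shows "(\<integral>\<^sup>+\<eta>. (open_op \<theta> (\<alpha> * \<delta>) a k \<delta> ^^ n) (\<lambda>_. 1) \<eta> \<partial>geo {a..k} (\<lambda>_. \<alpha>))
     \<le> ennreal (exp (\<alpha> * (exp \<theta> - 1) * \<delta>
           + ((real (card {a..k}))\<^sup>2 + 2 * real (card {a..k}) + exp \<theta>) * \<delta>\<^sup>2)) ^ n"
proof (induction n)
  case (Suc n)
  let ?c = "ennreal (exp (\<alpha> * (exp \<theta> - 1) * \<delta>
           + ((real (card {a..k}))\<^sup>2 + 2 * real (card {a..k}) + exp \<theta>) * \<delta>\<^sup>2))"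
  have "(\<integral>\<^sup>+\<eta>. (open_op \<theta> (\<alpha> * \<delta>) a k \<delta> ^^ Suc n) (\<lambda>_. 1) \<eta> \<partial>geo {a..k} (\<lambda>_. \<alpha>))
     \<le> ?c * (\<integral>\<^sup>+\<eta>. (open_op \<theta> (\<alpha> * \<delta>) a k \<delta> ^^ n) (\<lambda>_. 1) \<eta> \<partial>geo {a..k} (\<lambda>_. \<alpha>))"
    using nn_integral_open_op_le[OF assms] by simp
  also have "\<dots> \<le> ?c * ?c ^ n"
    by (intro mult_left_mono Suc.IH) simp
  finally show ?case by simp
qed simp

section \<open>Stationary and step initial profiles\<close>

text \<open>The silent site is sought in \<open>{a..0}\<close> so that it lies to the left of every
  end \<open>k \<ge> 0\<close>, and so that its existence depends on the number of sites there, not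
  on \<open>k\<close>.\<close>

definition good :: "int \<Rightarrow> (int \<Rightarrow> bool) list \<Rightarrow> bool" where
  "good a bs \<longleftrightarrow> (\<forall>b\<in>set bs. single b) \<and> (\<exists>\<sigma>\<in>{a..0}. \<forall>b\<in>set bs. \<not> b \<sigma>)"

definition run_mgf :: "real \<Rightarrow> int \<Rightarrow> int \<Rightarrow> real \<Rightarrow> nat \<Rightarrow> config \<Rightarrow> ennreal" where
  "run_mgf \<theta> a k \<delta> n \<eta> = (\<integral>\<^sup>+bs. indicator {bs. good a bs} bs
      * ennreal (exp (\<theta> * real_of_int (fold fire bs (hts \<eta>) k))) \<partial>replicate_pmf n (bern {a..k} (1 - exp (- \<delta>))))"

lemma conf_hts:
  assumes "\<eta> \<in> set_pmf (geo {a..k} \<alpha>)"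
  shows "conf a k (hts \<eta>) = \<eta>"
  using assms set_Pi_pmf_subset[of "{a..k}" 0 "\<lambda>i. geometric_pmf (1 - \<alpha> i)"]
  by (fastforce simp: conf_def hts_diff geo_def fun_eq_iff)

text \<open>The silent site serves to insert the fictitious arrivals at no cost. It is then dropped
  from the indicator, which only enlarges the integral, and what remains is the open system for
  which the product measure is almost an eigenvector.\<close>

lemma stationary_run_mgf_le:
  assumes \<alpha>: "0 < \<alpha>" "\<alpha> < 1" and ak: "a \<le> 0" "0 \<le> k" and \<delta>: "0 < \<delta>" "\<alpha> * \<delta> \<le> 1"
  shows "(\<integral>\<^sup>+\<eta>. ennreal (exp (- \<theta> * real_of_int (hts \<eta> k))) * run_mgf \<theta> a k \<delta> n \<eta> \<partial>geo {a..k} (\<lambda>_. \<alpha>))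
     \<le> ennreal (exp (\<alpha> * (exp \<theta> - 1) * \<delta>
           + ((real (card {a..k}))\<^sup>2 + 2 * real (card {a..k}) + exp \<theta>) * \<delta>\<^sup>2)) ^ n"
proof -
  let ?T = "(open_op \<theta> (\<alpha> * \<delta>) a k \<delta> ^^ n) (\<lambda>_. 1)"
  have "ennreal (exp (- \<theta> * real_of_int (hts \<eta> k))) * run_mgf \<theta> a k \<delta> n \<eta> \<le> ?T \<eta>"
    if \<eta>: "\<eta> \<in> set_pmf (geo {a..k} (\<lambda>_. \<alpha>))" for \<eta>
  proof -
    have "run_mgf \<theta> a k \<delta> n \<eta> \<le> (\<integral>\<^sup>+bs. indicator {bs. \<forall>b\<in>set bs. single b} bs
        * open_avg \<theta> (\<alpha> * \<delta>) a k bs (hts \<eta>) \<partial>replicate_pmf n (bern {a..k} (1 - exp (- \<delta>))))"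
      unfolding run_mgf_def
    proof (intro nn_integral_mono)
      fix bs :: "(int \<Rightarrow> bool) list"
      show "indicator {bs. good a bs} bs * ennreal (exp (\<theta> * real_of_int (fold fire bs (hts \<eta>) k)))
          \<le> indicator {bs. \<forall>b\<in>set bs. single b} bs * open_avg \<theta> (\<alpha> * \<delta>) a k bs (hts \<eta>)"
      proof (cases "good a bs")
        case True
        then obtain \<sigma> where "\<sigma> \<in> {a..0}" "\<forall>b\<in>set bs. \<not> b \<sigma>" by (auto simp: good_def)
        then show ?thesis
          using True open_avg_silent[of bs \<sigma> a k "\<alpha> * \<delta>" \<theta> "hts \<eta>"] ak \<alpha> \<delta>
          by (auto simp: good_def)
      qed simp
    qed
    also have "\<dots> \<le> ennreal (exp (\<theta> * real_of_int (hts \<eta> k))) * ?T (conf a k (hts \<eta>))"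
    proof (rule open_avg_le)
      show "hts \<eta> j \<le> hts \<eta> (j - 1)" for j
        using hts_diff[of \<eta> j] by linarith
    qed (use \<alpha> ak \<delta> in auto)
    finally have "ennreal (exp (- \<theta> * real_of_int (hts \<eta> k))) * run_mgf \<theta> a k \<delta> n \<eta>
        \<le> ennreal (exp (- \<theta> * real_of_int (hts \<eta> k))) * (ennreal (exp (\<theta> * real_of_int (hts \<eta> k))) * ?T (conf a k (hts \<eta>)))"
      by (rule mult_left_mono) simp
    also have "\<dots> = ?T \<eta>"
      unfolding conf_hts[OF \<eta>] mult.assoc[symmetric]
      by (simp flip: ennreal_mult exp_add)
    finally show ?thesis .
  qed
  then have "(\<integral>\<^sup>+\<eta>. ennreal (exp (- \<theta> * real_of_int (hts \<eta> k))) * run_mgf \<theta> a k \<delta> n \<eta> \<partial>geo {a..k} (\<lambda>_. \<alpha>))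
      \<le> (\<integral>\<^sup>+\<eta>. ?T \<eta> \<partial>geo {a..k} (\<lambda>_. \<alpha>))"
    by (intro nn_integral_mono_AE) (simp add: AE_measure_pmf_iff)
  then show ?thesis
    using nn_integral_open_op_power_le[where \<alpha> = \<alpha> and a = a and k = k and \<delta> = \<delta> and \<theta> = \<theta> and n = n] assms
    by simp
qed

text \<open>
  The tilt produces exactly the factor \<^term>\<open>exp (- \<theta> * real_of_int (hts \<eta> k))\<close> that turns the final
  height into the number of departures.
\<close>

lemma nn_integral_geo_tilt:
  assumes \<alpha>: "0 < \<alpha>" "\<alpha> < 1" "\<alpha> * exp \<theta> < 1" and ak: "a \<le> 0" "0 \<le> k"
  shows "(\<integral>\<^sup>+\<eta>. F \<eta> \<partial>geo {a..k} (\<lambda>i. if i \<le> 0 then \<alpha> else \<alpha> * exp \<theta>))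
     = ennreal (((1 - \<alpha> * exp \<theta>) / (1 - \<alpha>)) ^ nat k)
         * (\<integral>\<^sup>+\<eta>. ennreal (exp (- \<theta> * real_of_int (hts \<eta> k))) * F \<eta> \<partial>geo {a..k} (\<lambda>_. \<alpha>))"
proof -
  define \<beta> where "\<beta> = \<alpha> * exp \<theta>"
  define c where "c = ((1 - \<beta>) / (1 - \<alpha>)) ^ nat k"
  define p where "p = (\<lambda>i::int. if i \<le> 0 then \<alpha> else \<beta>)"
  have \<beta>: "0 < \<beta>" "\<beta> < 1" using \<alpha> by (auto simp: \<beta>_def)
  have S: "{a..k} = {a..0} \<union> {0<..k}" "{a..0} \<inter> {0<..k} = {}" using ak by auto
  have "pmf (geo {a..k} p) \<eta> = c * exp (- \<theta> * real_of_int (hts \<eta> k)) * pmf (geo {a..k} (\<lambda>_. \<alpha>)) \<eta>" for \<eta>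
  proof (cases "\<forall>x. x \<notin> {a..k} \<longrightarrow> \<eta> x = 0")
    case True
    have "pmf (geo {a..k} p) \<eta> = (\<Prod>x\<in>{a..k}. p x ^ \<eta> x * (1 - p x))"
      unfolding geo_def using True \<alpha> \<beta> by (subst pmf_Pi') (auto simp: p_def)
    also have "\<dots> = (\<Prod>x\<in>{a..0}. \<alpha> ^ \<eta> x * (1 - \<alpha>)) * (\<Prod>x\<in>{0<..k}. \<beta> ^ \<eta> x * (1 - \<beta>))"
      unfolding S(1) by (subst prod.union_disjoint) (auto simp: p_def)
    also have "(\<Prod>x\<in>{0<..k}. \<beta> ^ \<eta> x * (1 - \<beta>))
       = (\<Prod>x\<in>{0<..k}. ((1 - \<beta>) / (1 - \<alpha>)) * exp (\<theta> * \<eta> x) * (\<alpha> ^ \<eta> x * (1 - \<alpha>)))"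
      using \<alpha> by (intro prod.cong) (auto simp: \<beta>_def power_mult_distrib exp_of_nat2_mult field_simps)
    also have "\<dots> = c * exp (- \<theta> * real_of_int (hts \<eta> k)) * (\<Prod>x\<in>{0<..k}. \<alpha> ^ \<eta> x * (1 - \<alpha>))"
    proof -
      have "- \<theta> * real_of_int (hts \<eta> k) = (\<Sum>x\<in>{0<..k}. \<theta> * real (\<eta> x))"
        using ak by (simp add: hts_def sum_distrib_left sum_negf)
      then have "exp (- \<theta> * real_of_int (hts \<eta> k)) = (\<Prod>x\<in>{0<..k}. exp (\<theta> * real (\<eta> x)))"
        by (simp only: exp_sum[OF finite_greaterThanAtMost_int])
      then show ?thesis by (simp only: prod.distrib c_def prod_constant) simp
    qed
    also have "(\<Prod>x\<in>{a..0}. \<alpha> ^ \<eta> x * (1 - \<alpha>)) * \<dots>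
       = c * exp (- \<theta> * real_of_int (hts \<eta> k)) * (\<Prod>x\<in>{a..k}. \<alpha> ^ \<eta> x * (1 - \<alpha>))"
      unfolding S(1) by (subst prod.union_disjoint) auto
    also have "(\<Prod>x\<in>{a..k}. \<alpha> ^ \<eta> x * (1 - \<alpha>)) = pmf (geo {a..k} (\<lambda>_. \<alpha>)) \<eta>"
      unfolding geo_def using True \<alpha> by (subst pmf_Pi') auto
    finally show ?thesis .
  next
    case False
    then show ?thesis by (auto simp: geo_def pmf_Pi)
  qed
  moreover have "0 \<le> c" using \<alpha> \<beta> by (simp add: c_def)
  ultimately have "(\<integral>\<^sup>+\<eta>. F \<eta> \<partial>geo {a..k} p)
      = ennreal c * (\<integral>\<^sup>+\<eta>. ennreal (exp (- \<theta> * real_of_int (hts \<eta> k))) * F \<eta> \<partial>geo {a..k} (\<lambda>_. \<alpha>))"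
    by (simp add: nn_integral_measure_pmf ennreal_mult mult_ac flip: nn_integral_cmult)
  then show ?thesis unfolding p_def c_def \<beta>_def .
qed

text \<open>All these profiles vanish at the origin. For \<open>i \<le> 0\<close> the height
  involves only sites of the left half, so the first profile coincides with the one on the right;
  for \<open>i > 0\<close> only the right half enters and the second coincides with it.\<close>

lemma hts_min_le:
  "min (hts (\<lambda>x. if x \<in> {a..0} then f x else g' x) i) (hts (\<lambda>x. if x \<in> {a..0} then f' x else g x) i)
     \<le> hts (\<lambda>x. if x \<in> {a..0} then f x else g x) i" if "a - 1 \<le> i" for a :: int
proof (cases "i \<le> 0")
  case True
  then show ?thesis using that by (intro min.coboundedI1) (auto simp: hts_def intro!: sum_mono)
next
  case False
  then have "(\<Sum>l\<in>{0<..i}. int (if l \<in> {a..0} then u l else g l)) = (\<Sum>l\<in>{0<..i}. int (g l))" for u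
    by (intro sum.cong) auto
  then show ?thesis using False by (intro min.coboundedI2) (simp add: hts_def)
qed

lemma run_mgf_min_le:
  assumes "\<theta> \<le> 0" "a \<le> 0" "0 \<le> k"
  shows "run_mgf \<theta> a k \<delta> n (\<lambda>x. if x \<in> {a..0} then f x else g x)
     \<le> run_mgf \<theta> a k \<delta> n (\<lambda>x. if x \<in> {a..0} then f x else g' x)
       + run_mgf \<theta> a k \<delta> n (\<lambda>x. if x \<in> {a..0} then f' x else g x)"
  unfolding run_mgf_def
proof (subst nn_integral_add[symmetric], simp, simp, intro nn_integral_mono)
  fix bs :: "(int \<Rightarrow> bool) list"
  let ?R = "\<lambda>f g. fold fire bs (hts (\<lambda>x. if x \<in> {a..0} then f x else g x)) k"
  let ?E = "\<lambda>x. ennreal (exp (\<theta> * real_of_int x))"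
  let ?I = "indicator {bs. good a bs} bs :: ennreal"
  show "?I * ?E (?R f g) \<le> ?I * ?E (?R f g') + ?I * ?E (?R f' g)"
  proof (cases "good a bs")
    case True
    then obtain \<sigma> where \<sigma>: "\<sigma> \<in> {a..0}" "\<forall>b\<in>set bs. \<not> b \<sigma>" by (auto simp: good_def)
    \<comment> \<open>The comparison of initial heights is available only from \<open>a - 1\<close>
      on, whereas \<open>fold_fire_mono\<close> asks for it everywhere. Left of the silent site the
      heights are never read, so they may be replaced by 0.\<close>
    define cut where "cut = (\<lambda>H i. if \<sigma> \<le> i then H i else (0::int))"
    have cut: "fold fire bs H k = fold fire bs (cut H) k" for H
      using \<sigma> assms by (intro fold_fire_silent[of _ \<sigma>]) (auto simp: cut_def)
    have "min (?R f g') (?R f' g) = fold fire bs (\<lambda>i. min (cut (hts (\<lambda>x. if x \<in> {a..0} then f x else g' x)) i)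
         (cut (hts (\<lambda>x. if x \<in> {a..0} then f' x else g x)) i)) k"
      by (simp only: fold_fire_min cut[symmetric])
    also have "\<dots> \<le> fold fire bs (cut (hts (\<lambda>x. if x \<in> {a..0} then f x else g x))) k"
    proof (rule fold_fire_mono)
      fix i
      show "min (cut (hts (\<lambda>x. if x \<in> {a..0} then f x else g' x)) i)
         (cut (hts (\<lambda>x. if x \<in> {a..0} then f' x else g x)) i)
         \<le> cut (hts (\<lambda>x. if x \<in> {a..0} then f x else g x)) i"
        using hts_min_le[of a i f g' f' g] \<sigma> by (auto simp: cut_def)
    qed
    finally have "min (?R f g') (?R f' g) \<le> ?R f g" by (simp only: cut[symmetric])
    then have "?E (?R f g) \<le> ?E (min (?R f g') (?R f' g))"
      using assms by (intro ennreal_leI) (simp add: mult_left_mono_neg)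
    also have "\<dots> \<le> ?E (?R f g') + ?E (?R f' g)"
      by (simp add: min_def)
    finally show ?thesis using True by simp
  qed simp
qed

lemma nn_integral_geo_split:
  assumes "a \<le> 0" "0 \<le> k"
  shows "(\<integral>\<^sup>+\<eta>. F \<eta> \<partial>geo {a..k} (\<lambda>i. if i \<le> 0 then \<alpha> else \<beta>))
    = (\<integral>\<^sup>+f. \<integral>\<^sup>+g. F (\<lambda>x. if x \<in> {a..0} then f x else g x) \<partial>geo {0<..k} (\<lambda>_. \<beta>) \<partial>geo {a..0} (\<lambda>_. \<alpha>))"
proof -
  have S: "{a..k} = {a..0} \<union> {0<..k}" using assms by auto
  have 1: "geo {a..0} (\<lambda>i. if i \<le> 0 then \<alpha> else \<beta>) = geo {a..0} (\<lambda>_. \<alpha>)"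
    and 2: "geo {0<..k} (\<lambda>i. if i \<le> 0 then \<alpha> else \<beta>) = geo {0<..k} (\<lambda>_. \<beta>)"
    unfolding geo_def by (intro Pi_pmf_cong; simp)+
  have "geo {a..k} (\<lambda>i. if i \<le> 0 then \<alpha> else \<beta>)
     = map_pmf (\<lambda>(f,g) x. if x \<in> {a..0} then f x else g x)
          (pair_pmf (geo {a..0} (\<lambda>_. \<alpha>)) (geo {0<..k} (\<lambda>_. \<beta>)))"
    unfolding 1[symmetric] 2[symmetric] unfolding geo_def S by (rule Pi_pmf_union) auto
  then show ?thesis by (simp add: nn_integral_pair_pmf')
qed

text \<open>The replacement halves \<open>f'\<close> and \<open>g'\<close> are drawn independently
  of the stationary ones, so the comparison can be made for fixed halves. Each of the two resulting
  terms depends on one left and one right half, and the other two integrate to 1.\<close>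

lemma stationary_le_step_profiles:
  assumes "\<theta> \<le> 0" "a \<le> 0" "0 \<le> k"
  shows "(\<integral>\<^sup>+\<eta>. run_mgf \<theta> a k \<delta> n \<eta> \<partial>geo {a..k} (\<lambda>_. \<gamma>))
    \<le> (\<integral>\<^sup>+\<eta>. run_mgf \<theta> a k \<delta> n \<eta> \<partial>geo {a..k} (\<lambda>i. if i \<le> 0 then \<gamma> else \<beta>))
     + (\<integral>\<^sup>+\<eta>. run_mgf \<theta> a k \<delta> n \<eta> \<partial>geo {a..k} (\<lambda>i. if i \<le> 0 then \<alpha> else \<gamma>))"
proof -
  let ?F = "\<lambda>f g. run_mgf \<theta> a k \<delta> n (\<lambda>x. if x \<in> {a..0} then f x else g x)"
  let ?L = "\<lambda>\<alpha>. geo {a..0} (\<lambda>_. \<alpha>)" and ?R = "\<lambda>\<beta>. geo {0<..k} (\<lambda>_. \<beta>)"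
  have c: "(\<integral>\<^sup>+_. c \<partial>measure_pmf p) = c" for c :: ennreal and p :: "config pmf"
    by (simp add: measure_pmf.emeasure_space_1[simplified])
  have "(\<integral>\<^sup>+\<eta>. run_mgf \<theta> a k \<delta> n \<eta> \<partial>geo {a..k} (\<lambda>_. \<gamma>)) = (\<integral>\<^sup>+f. \<integral>\<^sup>+g. ?F f g \<partial>?R \<gamma> \<partial>?L \<gamma>)"
    using nn_integral_geo_split[OF assms(2,3), where \<alpha> = \<gamma> and \<beta> = \<gamma>] by simp
  also have "\<dots> = (\<integral>\<^sup>+f. \<integral>\<^sup>+g. \<integral>\<^sup>+f'. \<integral>\<^sup>+g'. ?F f g \<partial>?R \<beta> \<partial>?L \<alpha> \<partial>?R \<gamma> \<partial>?L \<gamma>)"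
    by (simp only: c)
  also have "\<dots> \<le> (\<integral>\<^sup>+f. \<integral>\<^sup>+g. \<integral>\<^sup>+f'. \<integral>\<^sup>+g'. ?F f g' + ?F f' g \<partial>?R \<beta> \<partial>?L \<alpha> \<partial>?R \<gamma> \<partial>?L \<gamma>)"
    by (intro nn_integral_mono run_mgf_min_le assms)
  also have "\<dots> = (\<integral>\<^sup>+f. \<integral>\<^sup>+g'. ?F f g' \<partial>?R \<beta> \<partial>?L \<gamma>) + (\<integral>\<^sup>+g. \<integral>\<^sup>+f'. ?F f' g \<partial>?L \<alpha> \<partial>?R \<gamma>)"
    by (simp add: nn_integral_add c)
  also have "(\<integral>\<^sup>+g. \<integral>\<^sup>+f'. ?F f' g \<partial>?L \<alpha> \<partial>?R \<gamma>) = (\<integral>\<^sup>+f'. \<integral>\<^sup>+g. ?F f' g \<partial>?R \<gamma> \<partial>?L \<alpha>)"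
  proof -
    have "(\<integral>\<^sup>+g. \<integral>\<^sup>+f'. ?F f' g \<partial>?L \<alpha> \<partial>?R \<gamma>) = (\<integral>\<^sup>+p. ?F (snd p) (fst p) \<partial>pair_pmf (?R \<gamma>) (?L \<alpha>))"
      by (simp only: nn_integral_pair_pmf' fst_conv snd_conv)
    also have "\<dots> = (\<integral>\<^sup>+p. ?F (fst p) (snd p) \<partial>pair_pmf (?L \<alpha>) (?R \<gamma>))"
      by (subst pair_commute_pmf) (simp only: nn_integral_map_pmf case_prod_unfold fst_conv snd_conv)
    also have "\<dots> = (\<integral>\<^sup>+f'. \<integral>\<^sup>+g. ?F f' g \<partial>?R \<gamma> \<partial>?L \<alpha>)"
      by (simp only: nn_integral_pair_pmf' fst_conv snd_conv)
    finally show ?thesis .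
  qed
  finally show ?thesis unfolding nn_integral_geo_split[OF assms(2,3)] .
qed

text \<open>The error \<open>C * (t / n)\<^sup>2\<close> of one cell adds up over \<open>n\<close>
  cells to \<open>C * t\<^sup>2 / n\<close> in the exponent, which the slack \<open>e\<close>
  absorbs for large \<open>n\<close>.\<close>

lemma step_profile_bound:
  assumes \<alpha>: "0 < \<alpha>" "\<alpha> < 1" "\<alpha> * exp \<theta> < 1" and ak: "a \<le> 0" "0 \<le> k" and t: "0 < t"
    and e: "0 < e"
  shows "\<forall>\<^sub>F n in sequentially.
    (\<integral>\<^sup>+\<eta>. run_mgf \<theta> a k (t / real n) n \<eta> \<partial>geo {a..k} (\<lambda>i. if i \<le> 0 then \<alpha> else \<alpha> * exp \<theta>))
     \<le> ennreal (((1 - \<alpha> * exp \<theta>) / (1 - \<alpha>)) ^ nat k * exp (\<alpha> * (exp \<theta> - 1) * t) + e)"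
proof -
  define c where "c = ((1 - \<alpha> * exp \<theta>) / (1 - \<alpha>)) ^ nat k"
  define C where "C = (real (card {a..k}))\<^sup>2 + 2 * real (card {a..k}) + exp \<theta>"
  have c: "0 \<le> c" using \<alpha> by (simp add: c_def)
  have "(\<lambda>n. c * exp (\<alpha> * (exp \<theta> - 1) * t + C * t\<^sup>2 / real n)) \<longlonglongrightarrow> c * exp (\<alpha> * (exp \<theta> - 1) * t + 0)"
    by (intro tendsto_intros tendsto_divide_0[OF tendsto_const] filterlim_real_at_infinity_sequentially)
  then have "\<forall>\<^sub>F n in sequentially. c * exp (\<alpha> * (exp \<theta> - 1) * t + C * t\<^sup>2 / real n)
      < c * exp (\<alpha> * (exp \<theta> - 1) * t) + e"
    using e by (intro order_tendstoD(2)) auto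
  \<comment> \<open>This makes the arrival probability \<open>\<alpha> * (t / n)\<close> at most
    1.\<close>
  moreover have "\<forall>\<^sub>F n in sequentially. real n \<ge> t + 1"
    by real_asymp
  ultimately show ?thesis
  proof eventually_elim
    case (elim n)
    then have n: "real n > 0" "t \<le> real n" using t by auto
    have "\<alpha> * t \<le> 1 * t" using \<alpha> t by (intro mult_right_mono) auto
    then have "\<alpha> * (t / real n) \<le> 1" using n \<alpha> by (simp add: field_simps)
    then have "(\<integral>\<^sup>+\<eta>. ennreal (exp (- \<theta> * real_of_int (hts \<eta> k))) * run_mgf \<theta> a k (t / real n) n \<eta> \<partial>geo {a..k} (\<lambda>_. \<alpha>))
      \<le> ennreal (exp (\<alpha> * (exp \<theta> - 1) * (t / real n) + C * (t / real n)\<^sup>2)) ^ n"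
      unfolding C_def using \<alpha> ak t n by (intro stationary_run_mgf_le) auto
    also have "\<dots> = ennreal (exp (\<alpha> * (exp \<theta> - 1) * t + C * t\<^sup>2 / n))"
      using n by (simp add: ennreal_power exp_of_nat_mult[symmetric] power2_eq_square field_simps)
    finally have "(\<integral>\<^sup>+\<eta>. run_mgf \<theta> a k (t / real n) n \<eta> \<partial>geo {a..k} (\<lambda>i. if i \<le> 0 then \<alpha> else \<alpha> * exp \<theta>))
      \<le> ennreal c * ennreal (exp (\<alpha> * (exp \<theta> - 1) * t + C * t\<^sup>2 / n))"
      unfolding nn_integral_geo_tilt[OF \<alpha> ak] c_def by (rule mult_left_mono) simp
    also have "\<dots> = ennreal (c * exp (\<alpha> * (exp \<theta> - 1) * t + C * t\<^sup>2 / n))"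
      using c by (simp add: ennreal_mult)
    also have "\<dots> \<le> ennreal (c * exp (\<alpha> * (exp \<theta> - 1) * t) + e)"
      using elim by (intro ennreal_leI) simp
    finally show ?case by (simp add: c_def)
  qed
qed

section \<open>From clocks to the discrete dynamics\<close>

text \<open>At a jump time the clock exceeds all its values just before, so a nondecreasing clock is
  injective on jump times and maps them into \<open>{..c t}\<close>.\<close>

lemma finite_jump_times:
  assumes "mono_on {0..} c"
  shows "finite (jump_times c \<eta> i t)"
proof (rule finite_imageD)
  have le: "c s \<le> c t" if "0 \<le> s" "s \<le> t" for s t
    using assms that by (auto simp: mono_on_def)
  show "finite (c ` jump_times c \<eta> i t)"
    by (rule finite_subset[of _ "{..c t}"]) (auto simp: jump_times_def intro!: le)
  have "c r < c s" if r: "r \<in> jump_times c \<eta> i t" and s: "s \<in> jump_times c \<eta> i t" and rs: "r < s" for r s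
  proof -
    from s obtain b where b: "b < s" "\<And>u. b < u \<Longrightarrow> u < s \<Longrightarrow> c u < c s"
      by (auto simp: jump_times_def eventually_at_left_field)
    obtain u where "max b r < u" "u < s"
      using dense[of "max b r" s] b(1) rs by auto
    then have "c r \<le> c u" "c u < c s"
      using b le[of r u] r by (auto simp: jump_times_def)
    then show ?thesis by simp
  qed
  then show "inj_on c (jump_times c \<eta> i t)"
    unfolding inj_on_def by (metis linorder_neqE less_irrefl)
qed

lemma jump_times_no_ring:
  assumes c: "mono_on {0..} c" and uv: "0 \<le> u" "u \<le> v" "c u = c v"
  shows "jump_times c \<eta> i v = jump_times c \<eta> i u"
proof -
  have "s \<le> u" if "s \<in> jump_times c \<eta> i v" for s
  proof (rule ccontr)
    assume "\<not> s \<le> u"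
    then have s: "u < s" "s \<le> v" using that by (auto simp: jump_times_def)
    from that obtain b where b: "b < s" "\<And>w. b < w \<Longrightarrow> w < s \<Longrightarrow> c w < c s"
      by (auto simp: jump_times_def eventually_at_left_field)
    obtain w where w: "max b u < w" "w < s"
      using dense[of "max b u" s] b(1) s by auto
    have "c u \<le> c w" using mono_onD[OF c, of u w] uv s w by simp
    moreover have "c s \<le> c v" using c uv s by (auto simp: mono_on_def)
    ultimately show False using b(2)[of w] w uv by simp
  qed
  then show ?thesis using uv by (auto simp: jump_times_def)
qed

text \<open>The ring takes place at the infimum \<open>s\<close> of the times with the new clock
  value. The hypothesis on \<eta> concerns only times before the ring, which is enough to identify
  the left limit at \<open>s\<close> that decides about the jump.\<close>

lemma card_jump_times_one_ring:
  assumes c: "mono_on {0..} c" and rc: "\<forall>t\<ge>0. continuous (at_right t) c"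
    and uv: "0 \<le> u" "u < v" "c v = Suc (c u)"
    and \<eta>: "\<And>w. u \<le> w \<Longrightarrow> w \<le> v \<Longrightarrow> c w = c u \<Longrightarrow> \<eta> w i = \<eta> u i"
  shows "card (jump_times c \<eta> i v) = card (jump_times c \<eta> i u) + (if \<eta> u i > 0 then 1 else 0)"
proof -
  have le: "c s \<le> c t" if "0 \<le> s" "s \<le> t" for s t
    using c that by (auto simp: mono_on_def)
  define A where "A = {w\<in>{u..v}. c w = c v}"
  define s where "s = Inf A"
  have A: "v \<in> A" "bdd_below A" using uv by (auto simp: A_def)
  have us: "u \<le> s" and sv: "s \<le> v"
    using A unfolding s_def by (auto intro!: cInf_greatest cInf_lower simp: A_def)
  have before: "c w = c u" if "u \<le> w" "w < s" for w
  proof -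
    have "w \<notin> A" using that A cInf_lower[of w A] by (auto simp: s_def)
    then have "c w \<noteq> c v" using that sv by (auto simp: A_def)
    moreover have "c u \<le> c w" "c w \<le> c v" using le[of u w] le[of w v] uv that sv by auto
    ultimately show ?thesis using uv by simp
  qed
  have after: "c w = c v" if sw: "s < w" and wv: "w \<le> v" for w
  proof -
    obtain w' where "w' \<in> A" "w' < w" using sw A cInf_lessD[of A w] by (auto simp: s_def)
    then have "c v \<le> c w" using le[of w' w] uv by (auto simp: A_def)
    moreover have "c w \<le> c v" using le[of w v] uv us sw wv by auto
    ultimately show ?thesis by simp
  qed
  \<comment> \<open>Right continuity decides that the infimum itself already carries the new value,
    so that the ring is seen at \<open>s\<close> from the left.\<close>
  have cs: "c s = c v"
  proof (cases "s = v")
    case False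
    then have "s < v" using sv by simp
    have "(c \<longlongrightarrow> c s) (at_right s)"
      using rc us uv by (auto simp: continuous_within)
    then have "\<forall>\<^sub>F w in at_right s. c w = c s" by (simp add: tendsto_discrete)
    moreover have "\<forall>\<^sub>F w in at_right s. w < v"
      using \<open>s < v\<close> by (auto simp: eventually_at_right_field)
    moreover have "\<forall>\<^sub>F w in at_right s. s < w" by (simp add: eventually_at_right_less)
    ultimately have "\<forall>\<^sub>F w in at_right s. c w = c s \<and> w < v \<and> s < w" by eventually_elim simp
    then obtain w where "c w = c s" "w < v" "s < w"
      using eventually_happens'[of "at_right s"] by (auto simp: trivial_limit_at_right_real)
    then show ?thesis using after[of w] by simp
  qed simp
  have us': "u < s" using us cs uv by (cases "u = s") auto
  have jump_s: "s \<in> jump_times c \<eta> i v \<longleftrightarrow> \<eta> u i > 0"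
  proof -
    have e1: "\<forall>\<^sub>F w in at_left s. u < w \<and> w < s"
      using us' by (auto simp: eventually_at_left_field)
    have "\<forall>\<^sub>F w in at_left s. c w < c s"
      using e1
    proof eventually_elim
      case (elim w)
      then show ?case using before[of w] cs uv(3) by simp
    qed
    moreover have "\<forall>\<^sub>F w in at_left s. \<eta> w i = \<eta> u i"
      using e1
    proof eventually_elim
      case (elim w)
      then show ?case using before[of w] \<eta>[of w] sv by simp
    qed
    then have "(\<forall>\<^sub>F w in at_left s. \<eta> w i > 0) \<longleftrightarrow> (\<forall>\<^sub>F w in at_left s. \<eta> u i > 0)"
      by (intro eventually_subst) (auto elim: eventually_mono)
    ultimately show ?thesis using us' uv sv by (simp add: jump_times_def)
  qed
  have only: "r = s" if r: "r \<in> jump_times c \<eta> i v" "u < r" for r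
  proof (rule ccontr)
    assume "r \<noteq> s"
    from r(1) have rv: "r \<le> v" by (auto simp: jump_times_def)
    from r(1) obtain b where b: "b < r" "\<And>w. b < w \<Longrightarrow> w < r \<Longrightarrow> c w < c r"
      by (auto simp: jump_times_def eventually_at_left_field)
    show False
    proof (cases "r < s")
      case True
      obtain w where "max b u < w" "w < r"
        using dense[of "max b u" r] b(1) r by auto
      then show False using b(2)[of w] before[of w] before[of r] True r by auto
    next
      case False
      then have "s < r" using \<open>r \<noteq> s\<close> by simp
      then obtain w where "max b s < w" "w < r"
        using dense[of "max b s" r] b(1) by auto
      then show False using b(2)[of w] after[of w] after[of r] rv \<open>s < r\<close> by auto
    qed
  qed
  have "jump_times c \<eta> i v = jump_times c \<eta> i u \<union> (if \<eta> u i > 0 then {s} else {})"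
  proof (intro set_eqI iffI)
    fix r assume r: "r \<in> jump_times c \<eta> i v"
    show "r \<in> jump_times c \<eta> i u \<union> (if \<eta> u i > 0 then {s} else {})"
    proof (cases "u < r")
      case True
      then show ?thesis using only[OF r] jump_s r by auto
    next
      case False
      then show ?thesis using r by (auto simp: jump_times_def)
    qed
  next
    fix r assume "r \<in> jump_times c \<eta> i u \<union> (if \<eta> u i > 0 then {s} else {})"
    then show "r \<in> jump_times c \<eta> i v"
      using jump_s uv by (auto simp: jump_times_def split: if_splits)
  qed
  moreover have "s \<notin> jump_times c \<eta> i u" using us' by (auto simp: jump_times_def)
  ultimately show ?thesis using finite_jump_times[OF c] by auto
qed

lemma hts_eqI:
  assumes "a \<le> 0" "0 \<le> k" "g 0 = 0" and g: "\<And>i. i \<in> {a..k} \<Longrightarrow> g (i - 1) - g i = int (\<eta> i)"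
    and i: "i \<in> {a - 1..k}"
  shows "hts \<eta> i = g i"
proof (cases "0 \<le> i")
  case True
  then show ?thesis using i
  proof (induction i rule: int_ge_induct)
    case base
    show ?case using assms by simp
  next
    case (step i)
    then show ?case using g[of "i + 1"] hts_diff[of \<eta> "i + 1"] assms(1) by auto
  qed
next
  case False
  then have "i \<le> 0" by simp
  then show ?thesis using i
  proof (induction i rule: int_le_induct)
    case base
    show ?case using assms by simp
  next
    case (step i)
    then show ?case using g[of i] hts_diff[of \<eta> i] assms(1,2) by auto
  qed
qed

text \<open>If \<open>i\<close> rings, then \<open>i - 1\<close> does not, so the occupation of
  \<open>i\<close> cannot change before the ring and its value at time \<open>u\<close> decides.
  Silence of \<sigma> keeps \<open>i - 1\<close> inside \<open>{\<sigma>..k}\<close>; rings further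
  left are not controlled.\<close>

lemma heights_step:
  fixes c :: "int \<Rightarrow> real \<Rightarrow> nat" and \<eta> :: "real \<Rightarrow> config" and h :: "int \<Rightarrow> real \<Rightarrow> int"
  assumes mono: "\<And>i. mono_on {0..} (c i)" and rc: "\<And>i. \<forall>t\<ge>0. continuous (at_right t) (c i)"
    and h: "\<And>i t. 0 \<le> t \<Longrightarrow> h i t = h i 0 + int (card (jump_times (c i) \<eta> i t))"
    and \<eta>: "\<And>i t. 0 \<le> t \<Longrightarrow> h (i - 1) t - h i t = int (\<eta> t i)"
    and uv: "0 \<le> u" "u < v" and silent: "c \<sigma> u = c \<sigma> v"
    and one: "\<And>i j. i \<in> {\<sigma>..k} \<Longrightarrow> j \<in> {\<sigma>..k} \<Longrightarrow> c i u < c i v \<Longrightarrow> c j u < c j v \<Longrightarrow> i = j"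
    and simple: "\<And>i. i \<in> {\<sigma>..k} \<Longrightarrow> c i v \<le> Suc (c i u)"
    and i: "i \<in> {\<sigma>..k}"
  shows "h i v = (if c i u < c i v then min (h i u + 1) (h (i - 1) u) else h i u)"
proof (cases "c i u < c i v")
  case False
  moreover have "c i u \<le> c i v" using mono[of i] uv by (auto simp: mono_on_def)
  ultimately have "c i u = c i v" by simp
  then have "jump_times (c i) \<eta> i v = jump_times (c i) \<eta> i u"
    using uv by (intro jump_times_no_ring mono) auto
  then show ?thesis using h[of u i] h[of v i] uv False by simp
next
  case True
  then have "i \<noteq> \<sigma>" using silent by auto
  then have i': "i - 1 \<in> {\<sigma>..k}" using i by auto
  then have "\<not> c (i - 1) u < c (i - 1) v" using one[of i "i - 1"] i True by auto
  then have c': "c (i - 1) u = c (i - 1) v"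
    using mono_onD[OF mono[of "i - 1"], of u v] uv by simp
  have *: "\<eta> w i = \<eta> u i" if w: "u \<le> w" "w \<le> v" "c i w = c i u" for w
  proof -
    have "c (i - 1) u \<le> c (i - 1) w" "c (i - 1) w \<le> c (i - 1) v"
      using mono[of "i - 1"] uv w by (auto simp: mono_on_def)
    then have "c (i - 1) u = c (i - 1) w" using c' by simp
    then have "jump_times (c (i - 1)) \<eta> (i - 1) w = jump_times (c (i - 1)) \<eta> (i - 1) u"
      using uv w by (intro jump_times_no_ring mono)
    moreover have "jump_times (c i) \<eta> i w = jump_times (c i) \<eta> i u"
      using uv w by (intro jump_times_no_ring mono) simp_all
    ultimately show ?thesis
      using h[of w i] h[of u i] h[of w "i - 1"] h[of u "i - 1"] \<eta>[of u i] \<eta>[of w i] uv w by auto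
  qed
  have "c i v = Suc (c i u)" using True simple[OF i] by simp
  then have "card (jump_times (c i) \<eta> i v) = card (jump_times (c i) \<eta> i u) + (if \<eta> u i > 0 then 1 else 0)"
    using uv by (intro card_jump_times_one_ring mono rc *)
  then show ?thesis using True h[of u i] h[of v i] \<eta>[of u i] uv by (auto simp: min_def)
qed

text \<open>The induction tracks only \<open>{\<sigma>..k}\<close>: further left the recursion may
  fail, because rings outside the window are not recorded in \<open>B\<close>, and sites beyond
  \<open>k\<close> do not act back. Subtracting \<open>h j 0\<close> gives the profile the value 0
  at the origin, as in \<open>hts\<close>.\<close>

lemma heights_eq_fold_fire:
  fixes c :: "int \<Rightarrow> real \<Rightarrow> nat" and \<eta> :: "real \<Rightarrow> config" and h :: "int \<Rightarrow> real \<Rightarrow> int"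
    and a k :: int and \<delta> :: real
  assumes mono: "\<And>i. mono_on {0..} (c i)" and rc: "\<And>i. \<forall>t\<ge>0. continuous (at_right t) (c i)"
    and h: "\<And>i t. 0 \<le> t \<Longrightarrow> h i t = h i 0 + int (card (jump_times (c i) \<eta> i t))"
    and \<eta>: "\<And>i t. 0 \<le> t \<Longrightarrow> h (i - 1) t - h i t = int (\<eta> t i)"
    and \<delta>: "0 < \<delta>" and ak: "a \<le> 0" "0 \<le> k"
    and B: "\<And>l i. B l i \<longleftrightarrow> i \<in> {a..k} \<and> c (j + i) (l * \<delta>) < c (j + i) (Suc l * \<delta>)"
    and \<xi>: "\<And>i. i \<in> {a..k} \<Longrightarrow> \<xi> i = \<eta> 0 (j + i)"
    and good: "good a (map B [0..<n])"
    and simple: "\<And>l i. l < n \<Longrightarrow> i \<in> {a..k} \<Longrightarrow> c (j + i) (Suc l * \<delta>) \<le> Suc (c (j + i) (l * \<delta>))"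
  shows "h (j + k) (n * \<delta>) - h j 0 = fold fire (map B [0..<n]) (hts \<xi>) k"
proof -
  from good obtain \<sigma> where \<sigma>: "\<sigma> \<in> {a..0}" "\<And>l. l < n \<Longrightarrow> \<not> B l \<sigma>"
    and single: "\<And>l. l < n \<Longrightarrow> single (B l)"
    by (force simp: good_def)
  have "\<forall>i\<in>{\<sigma>..k}. h (j + i) (l * \<delta>) - h j 0 = fold fire (map B [0..<l]) (hts \<xi>) i" if "l \<le> n" for l
    using that
  proof (induction l)
    case 0
    have "hts \<xi> i = h (j + i) 0 - h j 0" if "i \<in> {\<sigma>..k}" for i
    proof (rule hts_eqI[OF ak])
      show "h (j + (i - 1)) 0 - h j 0 - (h (j + i) 0 - h j 0) = int (\<xi> i)" if "i \<in> {a..k}" for i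
        using \<eta>[of 0 "j + i"] \<xi>[OF that] by (simp add: algebra_simps)
    qed (use that \<sigma> in auto)
    then show ?case by simp
  next
    case (Suc l)
    define F where "F = fold fire (map B [0..<l]) (hts \<xi>)"
    have IH: "h (j + i) (l * \<delta>) - h j 0 = F i" if "i \<in> {\<sigma>..k}" for i
      using Suc that by (simp add: F_def)
    show ?case
    proof
      fix i assume i: "i \<in> {\<sigma>..k}"
      have "h (j + i) (Suc l * \<delta>) = (if c (j + i) (l * \<delta>) < c (j + i) (Suc l * \<delta>)
          then min (h (j + i) (l * \<delta>) + 1) (h (j + i - 1) (l * \<delta>)) else h (j + i) (l * \<delta>))"
      proof (rule heights_step[OF mono rc h \<eta>, where \<sigma> = "j + \<sigma>" and k = "j + k"])
        show "0 \<le> real l * \<delta>" "real l * \<delta> < Suc l * \<delta>" using \<delta> by auto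
        show "c (j + \<sigma>) (l * \<delta>) = c (j + \<sigma>) (Suc l * \<delta>)"
        proof -
          have "c (j + \<sigma>) (l * \<delta>) \<le> c (j + \<sigma>) (Suc l * \<delta>)"
            using mono[of "j + \<sigma>"] \<delta> by (auto simp: mono_on_def)
          moreover have "\<not> c (j + \<sigma>) (l * \<delta>) < c (j + \<sigma>) (Suc l * \<delta>)"
            using \<sigma>(2)[of l] Suc.prems \<sigma>(1) ak B[of l \<sigma>] by auto
          ultimately show ?thesis by simp
        qed
        show "p = q" if "p \<in> {j + \<sigma>..j + k}" "q \<in> {j + \<sigma>..j + k}"
          "c p (l * \<delta>) < c p (Suc l * \<delta>)" "c q (l * \<delta>) < c q (Suc l * \<delta>)" for p q
        proof -
          have "B l (p - j)" "B l (q - j)" using that \<sigma>(1) by (auto simp: B)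
          then have "p - j = q - j" using single[of l] Suc.prems unfolding single_def by auto
          then show ?thesis by simp
        qed
        show "c p (Suc l * \<delta>) \<le> Suc (c p (l * \<delta>))" if "p \<in> {j + \<sigma>..j + k}" for p
          using simple[of l "p - j"] Suc.prems that \<sigma>(1) by auto
      qed (use i in auto)
      moreover have "i - 1 \<in> {\<sigma>..k}" if "B l i"
        using that i \<sigma>(2)[of l] Suc.prems by (cases "i = \<sigma>") auto
      moreover have "B l i \<longleftrightarrow> c (j + i) (l * \<delta>) < c (j + i) (Suc l * \<delta>)"
        using i \<sigma>(1) by (auto simp: B)
      ultimately have "h (j + i) (Suc l * \<delta>) - h j 0 = fire (B l) F i"
        using IH[OF i] IH[of "i - 1"] by (auto simp: fire_def min_def algebra_simps)
      then show "h (j + i) (Suc l * \<delta>) - h j 0 = fold fire (map B [0..<Suc l]) (hts \<xi>) i"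
        by (simp add: F_def)
    qed
  qed
  then show ?thesis using \<sigma>(1) ak by auto
qed

section \<open>Law of the clocks on a time grid\<close>

text \<open>The target type may be uncountable, as for configurations, but the support of
  \<open>p\<close> is countable. Since the fibres over the support have total probability 1,
  \<open>X\<close> lies in it almost surely, and the integral is a countable sum over fibres for
  arbitrary \<open>F\<close>.\<close>

lemma nn_integral_countable_law:
  assumes "prob_space M"
    and X: "\<And>y. y \<in> set_pmf p \<Longrightarrow> {x\<in>space M. X x = y} \<in> sets M"
    and law: "\<And>y. y \<in> set_pmf p \<Longrightarrow> measure M {x\<in>space M. X x = y} = pmf p y"
  shows "(\<integral>\<^sup>+x. F (X x) \<partial>M) = (\<integral>\<^sup>+y. F y \<partial>measure_pmf p)"
proof -
  interpret prob_space M by fact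
  define C where "C = set_pmf p"
  define E where "E = (\<lambda>y. {x\<in>space M. X x = y})"
  have C: "countable C" by (simp add: C_def)
  have E: "y \<in> C \<Longrightarrow> E y \<in> sets M" "y \<in> C \<Longrightarrow> emeasure M (E y) = ennreal (pmf p y)" for y
    using X[of y] law[of y] by (auto simp: C_def E_def emeasure_eq_measure)
  have total: "(\<integral>\<^sup>+y. ennreal (pmf p y) * G y \<partial>count_space C) = (\<integral>\<^sup>+y. G y \<partial>measure_pmf p)" for G
    unfolding nn_integral_measure_pmf C_def
    by (rule nn_integral_count_space_eq) (auto simp: set_pmf_iff)
  have "emeasure M (\<Union>y\<in>C. E y) = (\<integral>\<^sup>+y. emeasure M (E y) \<partial>count_space C)"
    using E C by (intro emeasure_UN_countable) (auto simp: disjoint_family_on_def E_def)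
  also have "\<dots> = (\<integral>\<^sup>+y. ennreal (pmf p y) * 1 \<partial>count_space C)"
    by (intro nn_integral_cong) (simp add: E)
  also have "\<dots> = 1" unfolding total by (simp add: measure_pmf.emeasure_space_1[simplified])
  finally have "prob (\<Union>y\<in>C. E y) = 1" by (simp add: emeasure_eq_measure)
  moreover have "(\<Union>y\<in>C. E y) \<in> events" using E C by (intro sets.countable_UN') auto
  ultimately have "AE x in M. x \<in> (\<Union>y\<in>C. E y)" by (subst prob_eq_1[symmetric]) auto
  then have ae: "AE x in M. X x \<in> C" by eventually_elim (auto simp: E_def)
  have "(\<integral>\<^sup>+x. F (X x) \<partial>M) = (\<integral>\<^sup>+x. \<integral>\<^sup>+y. F y * indicator (E y) x \<partial>count_space C \<partial>M)"
  proof (rule nn_integral_cong_AE)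
    show "AE x in M. F (X x) = (\<integral>\<^sup>+y. F y * indicator (E y) x \<partial>count_space C)"
      using ae AE_space
    proof eventually_elim
      case (elim x)
      have "(\<integral>\<^sup>+y. F y * indicator (E y) x \<partial>count_space C) = (\<integral>\<^sup>+y. F y * indicator (E y) x \<partial>count_space {X x})"
        using elim by (intro nn_integral_count_space_eq) (auto simp: E_def)
      also have "\<dots> = F (X x)" using elim by (simp add: nn_integral_count_space_finite E_def)
      finally show ?case ..
    qed
  qed
  also have "\<dots> = (\<integral>\<^sup>+y. \<integral>\<^sup>+x. F y * indicator (E y) x \<partial>M \<partial>count_space C)"
    using E C by (intro nn_integral_count_space_nn_integral) auto
  also have "\<dots> = (\<integral>\<^sup>+y. ennreal (pmf p y) * F y \<partial>count_space C)"
    using E by (intro nn_integral_cong) (simp add: nn_integral_cmult_indicator mult.commute)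
  finally show ?thesis unfolding total .
qed

text \<open>The sets supplied for different \<open>e\<close> need not be nested, so monotone
  convergence is not at hand. Along \<open>e = (1/2)^m\<close>, Borel-Cantelli puts almost every
  point in all but finitely many of them, and Fatou's lemma gives the bound.\<close>

lemma nn_integral_le_of_large_sets:
  assumes "prob_space M" and Z: "Z \<in> borel_measurable M" and R: "0 \<le> R"
    and large: "\<And>e. 0 < e \<Longrightarrow> \<exists>G\<in>sets M. measure M (space M - G) \<le> e
      \<and> (\<integral>\<^sup>+x. indicator G x * Z x \<partial>M) \<le> ennreal (R + e)"
  shows "(\<integral>\<^sup>+x. Z x \<partial>M) \<le> ennreal R"
proof -
  interpret prob_space M by fact
  have "\<forall>m. \<exists>G. G \<in> sets M \<and> prob (space M - G) \<le> (1/2)^m \<and> (\<integral>\<^sup>+x. indicator G x * Z x \<partial>M) \<le> ennreal (R + (1/2)^m)"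
    using large by (meson zero_less_power zero_less_divide_1_iff zero_less_numeral)
  then obtain G where G: "\<And>m. G m \<in> sets M" "\<And>m. prob (space M - G m) \<le> (1/2)^m"
    "\<And>m. (\<integral>\<^sup>+x. indicator (G m) x * Z x \<partial>M) \<le> ennreal (R + (1/2)^m)"
    by metis
  have "summable (\<lambda>m. prob (space M - G m))"
    by (rule summable_comparison_test'[of "\<lambda>m. (1/2::real)^m" 0]) (use G in auto)
  then have "AE x in M. eventually (\<lambda>m. x \<in> space M - (space M - G m)) sequentially"
    using G by (intro borel_cantelli_AE1) (auto simp: emeasure_eq_measure)
  then have ae: "AE x in M. Z x = liminf (\<lambda>m. indicator (G m) x * Z x)"
  proof eventually_elim
    case (elim x)
    then have "\<forall>\<^sub>F m in sequentially. indicator (G m) x * Z x = Z x"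
      by eventually_elim auto
    then have "(\<lambda>m. indicator (G m) x * Z x) \<longlonglongrightarrow> Z x"
      by (rule tendsto_eventually)
    then show ?case by (simp add: lim_imp_Liminf)
  qed
  have "(\<integral>\<^sup>+x. Z x \<partial>M) = (\<integral>\<^sup>+x. liminf (\<lambda>m. indicator (G m) x * Z x) \<partial>M)"
    by (rule nn_integral_cong_AE[OF ae])
  also have "\<dots> \<le> liminf (\<lambda>m. \<integral>\<^sup>+x. indicator (G m) x * Z x \<partial>M)"
    using G Z by (intro nn_integral_liminf) auto
  also have "\<dots> \<le> liminf (\<lambda>m. ennreal (R + (1/2)^m))"
    by (intro Liminf_mono always_eventually allI G)
  also have "\<dots> = ennreal R"
  proof -
    have "(\<lambda>m. ennreal (R + (1/2)^m)) \<longlonglongrightarrow> ennreal (R + 0)"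
      by (intro tendsto_intros LIMSEQ_power_zero) auto
    then show ?thesis by (simp add: lim_imp_Liminf)
  qed
  finally show ?thesis .
qed

lemma pmf_replicate_pmf:
  "length xs = n \<Longrightarrow> pmf (replicate_pmf n p) xs = (\<Prod>l<n. pmf p (xs ! l))"
proof (induction n arbitrary: xs)
  case (Suc n)
  then obtain y ys where xs: "xs = y # ys" "length ys = n" by (cases xs) auto
  have inj: "inj (\<lambda>(y, ys). y # ys)" by (auto simp: inj_def)
  have "replicate_pmf (Suc n) p = map_pmf (\<lambda>(y, ys). y # ys) (pair_pmf p (replicate_pmf n p))"
    by (simp add: pair_pmf_def map_bind_pmf)
  then have "pmf (replicate_pmf (Suc n) p) xs
      = pmf (map_pmf (\<lambda>(y, ys). y # ys) (pair_pmf p (replicate_pmf n p))) ((\<lambda>(y, ys). y # ys) (y, ys))"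
    by (simp add: xs)
  also have "\<dots> = pmf p y * pmf (replicate_pmf n p) ys"
    by (subst pmf_map_inj'[OF inj]) (simp add: pmf_pair)
  finally show ?case using Suc.IH[OF xs(2)] by (simp add: xs prod.lessThan_Suc_shift del: prod.lessThan_Suc)
qed simp

lemma poisson_ge_2:
  assumes "0 < \<delta>"
  shows "measure (measure_pmf (poisson_pmf \<delta>)) {2..} \<le> \<delta>\<^sup>2"
proof -
  have "measure (measure_pmf (poisson_pmf \<delta>)) {0, 1} = exp (- \<delta>) * (1 + \<delta>)"
    using assms by (simp add: measure_measure_pmf_finite algebra_simps)
  moreover have "(1 - \<delta>) * (1 + \<delta>) \<le> exp (- \<delta>) * (1 + \<delta>)"
    using assms exp_ge_add_one_self[of "- \<delta>"] by (intro mult_right_mono) auto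
  moreover have "{2..} = - {0, 1::nat}" by auto
  ultimately show ?thesis
    using measure_pmf.prob_compl[of "{0,1}" "poisson_pmf \<delta>"]
    by (simp add: Compl_eq_Diff_UNIV power2_eq_square algebra_simps)
qed

section \<open>The stationary process and its events on a finite window\<close>

locale stationary_tazrp_process =
  fixes M :: "'a measure" and \<rho> :: real
    and N :: "int \<Rightarrow> real \<Rightarrow> 'a \<Rightarrow> nat"
    and \<omega> :: "real \<Rightarrow> 'a \<Rightarrow> int \<Rightarrow> nat"
    and h :: "int \<Rightarrow> real \<Rightarrow> 'a \<Rightarrow> int"
  assumes rho: "\<rho> > 0"
    and stationary: "stationary_tazrp M \<rho> N \<omega>"
    and heights: "heights M N \<omega> h"
begin

text \<open>Besides being the ratio of the geometric marginals, this is the probability that a site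
  is occupied, and thus the flux as a function of the density.\<close>

definition \<gamma> :: real where "\<gamma> = \<rho> / (1 + \<rho>)"

lemma \<gamma>: "0 < \<gamma>" "\<gamma> < 1" "1 - \<gamma> = 1 / (1 + \<rho>)" "\<rho> = \<gamma> / (1 - \<gamma>)"
  using rho by (auto simp: \<gamma>_def field_simps)

lemma geom_mu_eq: "geom_mu \<rho> = geometric_pmf (1 - \<gamma>)"
  by (simp add: geom_mu_def \<gamma>(3))

sublocale prob_space M
  using stationary by (simp add: stationary_tazrp_def tazrp_def)

lemma poisson: "poisson_process M 1 (N i)"
  using stationary by (simp add: stationary_tazrp_def tazrp_def)

lemma N_measurable [measurable]: "0 \<le> t \<Longrightarrow> N i t \<in> measurable M (count_space UNIV)"
  using poisson by (simp add: poisson_process_def)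

lemma \<omega>_measurable: "0 \<le> t \<Longrightarrow> \<omega> t \<in> measurable M config_space"
  using stationary by (simp add: stationary_tazrp_def tazrp_def)

lemma h_measurable [measurable]: "0 \<le> t \<Longrightarrow> h i t \<in> measurable M (count_space UNIV)"
  using heights by (simp add: heights_def)

lemma indep:
  "indep_sets (case_option (sets (vimage_algebra (space M) (\<omega> 0) config_space))
     (\<lambda>i. sets (vimage_algebra (space M) (\<lambda>x. \<lambda>t\<in>{0..}. N i t x) path_space))) UNIV"
  using stationary by (simp add: stationary_tazrp_def tazrp_def)

lemma distr_\<omega>: "distr M config_space (\<omega> 0) = Pi\<^sub>M UNIV (\<lambda>_. measure_pmf (geom_mu \<rho>))"
  using stationary by (simp add: stationary_tazrp_def)

text \<open>A single null set serves all sites and all times at once, so that the comparison with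
  the discrete dynamics can be made path by path.\<close>

lemma AE_paths:
  "AE x in M. (\<forall>i. mono_on {0..} (\<lambda>t. N i t x) \<and> (\<forall>t\<ge>0. continuous (at_right t) (\<lambda>s. N i s x)))
     \<and> (\<forall>i. \<forall>t\<ge>0. h i t x = h i 0 x + int (card (jump_times (\<lambda>s. N i s x) (\<lambda>s. \<omega> s x) i t)))
     \<and> (\<forall>i. \<forall>t\<ge>0. h (i - 1) t x - h i t x = int (\<omega> t x i)) \<and> h 0 0 x = 0"
proof -
  have "AE x in M. \<forall>i. mono_on {0..} (\<lambda>t. N i t x) \<and> (\<forall>t\<ge>0. continuous (at_right t) (\<lambda>s. N i s x))"
    unfolding AE_all_countable
  proof
    fix i
    show "AE x in M. mono_on {0..} (\<lambda>t. N i t x) \<and> (\<forall>t\<ge>0. continuous (at_right t) (\<lambda>s. N i s x))"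
      using poisson[of i] unfolding poisson_process_def by (auto elim: eventually_mono)
  qed
  moreover have "AE x in M. h 0 0 x = 0 \<and> (\<forall>i. h (i - 1) 0 x - h i 0 x = int (\<omega> 0 x i)) \<and>
        (\<forall>i. \<forall>t\<ge>0. h i t x = h i 0 x + int (jumps N \<omega> i t x))"
    using heights by (simp add: heights_def)
  moreover have "AE x in M. \<forall>i. \<forall>t\<ge>0.
        int (\<omega> t x i) = int (\<omega> 0 x i) + int (jumps N \<omega> (i - 1) t x) - int (jumps N \<omega> i t x)"
    using stationary by (simp add: stationary_tazrp_def tazrp_def)
  ultimately show ?thesis
  proof eventually_elim
    case (elim x)
    have "h (i - 1) t x - h i t x = int (\<omega> t x i)" if "0 \<le> t" for i t
    proof -
      have "h (i - 1) t x = h (i - 1) 0 x + int (jumps N \<omega> (i - 1) t x)"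
        "h i t x = h i 0 x + int (jumps N \<omega> i t x)"
        "h (i - 1) 0 x - h i 0 x = int (\<omega> 0 x i)"
        "int (\<omega> t x i) = int (\<omega> 0 x i) + int (jumps N \<omega> (i - 1) t x) - int (jumps N \<omega> i t x)"
        using elim that by blast+
      then show ?thesis by linarith
    qed
    moreover have "\<forall>i. \<forall>t\<ge>0. h i t x = h i 0 x + int (card (jump_times (\<lambda>s. N i s x) (\<lambda>s. \<omega> s x) i t))"
      using elim(2) unfolding jumps_def by blast
    ultimately show ?case using elim(1,2) by blast
  qed
qed

definition clock_sets :: "int \<Rightarrow> 'a set set" where
  "clock_sets i = sets (vimage_algebra (space M) (\<lambda>x. \<lambda>t\<in>{0..}. N i t x) path_space)"

text \<open>Dependence on finitely many times is expressed as invariance under agreement on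
  \<open>T\<close>. This suffices for measurability because every subset of a finite product of
  copies of \<open>nat\<close> is measurable.\<close>

lemma clock_setsI:
  assumes "finite T" "T \<subseteq> {0..}" and P: "\<And>f g. (\<And>t. t \<in> T \<Longrightarrow> f t = g t) \<Longrightarrow> P f \<longleftrightarrow> P g"
  shows "{x\<in>space M. P (\<lambda>t. N i t x)} \<in> clock_sets i"
proof -
  let ?S = "{f\<in>space path_space. P f}"
  have "P f \<longleftrightarrow> P (\<lambda>t. if t \<in> T then f t else 0)" for f by (rule P) simp
  then have "?S = {f\<in>space path_space. restrict f T \<in> {g \<in> space (Pi\<^sub>M T (\<lambda>_. count_space UNIV)). P g}}"
    using assms(2) P[of "restrict f T" f for f] by (auto simp: space_PiM)
  also have "\<dots> \<in> sets path_space"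
  proof -
    have "Pi\<^sub>M T (\<lambda>_. count_space (UNIV :: nat set)) = count_space (PiE T (\<lambda>_. UNIV))"
      using assms(1) by (intro count_space_PiM_finite) auto
    then have "{g \<in> space (Pi\<^sub>M T (\<lambda>_. count_space (UNIV :: nat set))). P g} \<in> sets (Pi\<^sub>M T (\<lambda>_. count_space UNIV))"
      by auto
    from measurable_sets[OF measurable_restrict_subset[OF assms(2)] this]
    show ?thesis by (simp add: vimage_def Int_def conj_commute)
  qed
  finally have "(\<lambda>x. \<lambda>t\<in>{0..}. N i t x) -` ?S \<inter> space M \<in> clock_sets i"
    unfolding clock_sets_def by (rule in_vimage_algebra)
  moreover have "P (\<lambda>t\<in>{0..}. N i t x) \<longleftrightarrow> P (\<lambda>t. N i t x)" for x
    using assms(2) by (intro P) auto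
  ultimately show ?thesis by (simp add: space_PiM vimage_def Int_def conj_commute)
qed


lemma clock_sets_events: "E \<in> clock_sets i \<Longrightarrow> E \<in> events"
proof -
  have "case_option (sets (vimage_algebra (space M) (\<omega> 0) config_space))
     (\<lambda>i. sets (vimage_algebra (space M) (\<lambda>x. \<lambda>t\<in>{0..}. N i t x) path_space)) (Some i) \<subseteq> events"
    using indep unfolding indep_sets_def by blast
  then show "E \<in> clock_sets i \<Longrightarrow> E \<in> events" by (auto simp: clock_sets_def)
qed

lemma prob_initial_clocks:
  assumes "finite J" "finite I" and E: "\<And>i. i \<in> I \<Longrightarrow> E i \<in> clock_sets i"
  shows "{x\<in>space M. \<forall>i\<in>J. \<omega> 0 x i = f i} \<in> events" (is "?A \<in> _")
    and "prob ({x\<in>space M. (\<forall>i\<in>J. \<omega> 0 x i = f i) \<and> (\<forall>i\<in>I. x \<in> E i)})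
       = (\<Prod>i\<in>J. pmf (geometric_pmf (1 - \<gamma>)) (f i)) * (\<Prod>i\<in>I. prob (E i))"
proof -
  let ?g = "measure_pmf (geometric_pmf (1 - \<gamma>))"
  let ?S = "{g\<in>space config_space. \<forall>i\<in>J. g i \<in> {f i}}"
  interpret P: product_prob_space "\<lambda>_::int. ?g" UNIV ..
  have S: "?S \<in> sets config_space"
  proof (rule sets.sets_Collect_finite_All[OF _ assms(1)])
    fix i
    have "(\<lambda>g. g i) \<in> measurable config_space (count_space UNIV)"
      by (rule measurable_component_singleton) simp
    then show "{g\<in>space config_space. g i \<in> {f i}} \<in> sets config_space"
      by (rule measurable_sets_Collect) simp
  qed
  have A: "?A = \<omega> 0 -` ?S \<inter> space M" by (auto simp: space_PiM)
  have m: "\<omega> 0 \<in> measurable M config_space" by (rule \<omega>_measurable) simp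
  show "?A \<in> events" unfolding A by (rule measurable_sets[OF m S])
  have "prob ?A = measure (distr M config_space (\<omega> 0)) ?S"
    unfolding A using measure_distr[OF m S] by simp
  also have "\<dots> = measure (Pi\<^sub>M UNIV (\<lambda>_. ?g)) {g\<in>space (Pi\<^sub>M UNIV (\<lambda>_. ?g)). \<forall>i\<in>J. g i \<in> {f i}}"
    unfolding distr_\<omega> geom_mu_eq by (simp add: space_PiM)
  also have "\<dots> = (\<Prod>i\<in>J. measure ?g {f i})"
  proof -
    have "emeasure (Pi\<^sub>M UNIV (\<lambda>_. ?g)) {g\<in>space (Pi\<^sub>M UNIV (\<lambda>_. ?g)). \<forall>i\<in>J. g i \<in> {f i}}
        = (\<Prod>i\<in>J. emeasure ?g {f i})"
      using assms(1) by (intro P.emeasure_PiM_Collect) auto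
    also have "\<dots> = ennreal (\<Prod>i\<in>J. measure ?g {f i})"
      by (simp only: measure_pmf.emeasure_eq_measure) (rule prod_ennreal, simp)
    finally show ?thesis
      unfolding measure_def[of "Pi\<^sub>M UNIV (\<lambda>_. ?g)"] by (simp only: enn2real_ennreal prod_nonneg measure_nonneg)
  qed
  finally have pA: "prob ?A = (\<Prod>i\<in>J. pmf (geometric_pmf (1 - \<gamma>)) (f i))"
    by (simp add: measure_pmf_single)
  define B where "B = case_option ?A E"
  have "prob (\<Inter>j\<in>insert None (Some ` I). B j) = (\<Prod>j\<in>insert None (Some ` I). prob (B j))"
  proof (rule indep_setsD[OF indep])
    show "\<forall>j\<in>insert None (Some ` I). B j \<in> case_option (sets (vimage_algebra (space M) (\<omega> 0) config_space))
       (\<lambda>i. sets (vimage_algebra (space M) (\<lambda>x. \<lambda>t\<in>{0..}. N i t x) path_space)) j"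
    proof (rule ballI)
      fix j assume "j \<in> insert None (Some ` I)"
      then consider "j = None" | i where "j = Some i" "i \<in> I" by blast
      then show "B j \<in> case_option (sets (vimage_algebra (space M) (\<omega> 0) config_space))
         (\<lambda>i. sets (vimage_algebra (space M) (\<lambda>x. \<lambda>t\<in>{0..}. N i t x) path_space)) j"
      proof cases
        case 1
        show ?thesis unfolding 1 B_def option.case A by (rule in_vimage_algebra[OF S])
      next
        case 2
        then show ?thesis using E[OF 2(2)] by (simp only: B_def option.case clock_sets_def)
      qed
    qed
  qed (use assms in auto)
  also have "(\<Inter>j\<in>insert None (Some ` I). B j) = {x\<in>space M. (\<forall>i\<in>J. \<omega> 0 x i = f i) \<and> (\<forall>i\<in>I. x \<in> E i)}"
    by (auto simp: B_def)
  also have "(\<Prod>j\<in>insert None (Some ` I). prob (B j)) = prob ?A * (\<Prod>i\<in>I. prob (E i))"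
    using assms by (simp add: B_def prod.reindex)
  finally show "prob ({x\<in>space M. (\<forall>i\<in>J. \<omega> 0 x i = f i) \<and> (\<forall>i\<in>I. x \<in> E i)})
       = (\<Prod>i\<in>J. pmf (geometric_pmf (1 - \<gamma>)) (f i)) * (\<Prod>i\<in>I. prob (E i))"
    by (simp add: pA)
qed

lemma prob_clocks:
  assumes "finite I" "\<And>i. i \<in> I \<Longrightarrow> E i \<in> clock_sets i"
  shows "prob {x\<in>space M. \<forall>i\<in>I. x \<in> E i} = (\<Prod>i\<in>I. prob (E i))"
  using prob_initial_clocks(2)[of "{}" I E] assms by simp

lemma prob_increment:
  assumes "0 \<le> s" "s < t"
  shows "prob {x\<in>space M. N i t x - N i s x \<in> A} = measure (measure_pmf (poisson_pmf (t - s))) A"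
proof -
  have "0 \<le> t" using assms by simp
  then have [measurable]: "(\<lambda>x. N i t x - N i s x) \<in> measurable M (count_space UNIV)"
    using assms by measurable
  have "distr M (count_space UNIV) (\<lambda>x. N i t x - N i s x) = measure_pmf (poisson_pmf (1 * (t - s)))"
    using poisson[of i] assms unfolding poisson_process_def by blast
  then have "measure (measure_pmf (poisson_pmf (t - s))) A
      = measure (distr M (count_space UNIV) (\<lambda>x. N i t x - N i s x)) A" by simp
  also have "\<dots> = prob {x\<in>space M. N i t x - N i s x \<in> A}"
    by (subst measure_distr) (auto simp: vimage_def Int_def conj_commute)
  finally show ?thesis ..
qed

lemma prob_ring:
  assumes "0 \<le> s" "s < t"
  shows "prob {x\<in>space M. (N i s x < N i t x) = b} = (if b then 1 - exp (- (t - s)) else exp (- (t - s)))"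
proof -
  have p: "measure (measure_pmf (poisson_pmf (t - s))) {0} = exp (- (t - s))"
    using assms by (simp add: measure_pmf_single)
  \<comment> \<open>Truncated subtraction vanishes exactly when the clock has not advanced, so this
    equality also holds on the null set of irregular paths.\<close>
  have "{x\<in>space M. (N i s x < N i t x) = b} = {x\<in>space M. N i t x - N i s x \<in> (if b then - {0} else {0})}"
    by auto
  then show ?thesis
    using prob_increment[OF assms, of i] p measure_pmf.prob_compl[of "{0}" "poisson_pmf (t - s)"]
    by (simp add: Compl_eq_Diff_UNIV)
qed

lemma ring_pattern:
  fixes i :: int and b :: "nat \<Rightarrow> bool"
  assumes "0 < \<delta>" "0 < n"
  defines "E \<equiv> {x\<in>space M. \<forall>l<n. (N i (real l * \<delta>) x < N i (real (Suc l) * \<delta>) x) = b l}"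
  shows "E \<in> clock_sets i" and "prob E = (\<Prod>l<n. pmf (bernoulli_pmf (1 - exp (- \<delta>))) (b l))"
proof -
  show "E \<in> clock_sets i" unfolding E_def
  proof (rule clock_setsI[where T = "(\<lambda>l. real l * \<delta>) ` {..n}"])
    fix f g :: "real \<Rightarrow> nat"
    assume "\<And>t. t \<in> (\<lambda>l. real l * \<delta>) ` {..n} \<Longrightarrow> f t = g t"
    then have "f (real l * \<delta>) = g (real l * \<delta>)" if "l \<le> n" for l using that by blast
    then show "(\<forall>l<n. (f (real l * \<delta>) < f (real (Suc l) * \<delta>)) = b l)
        \<longleftrightarrow> (\<forall>l<n. (g (real l * \<delta>) < g (real (Suc l) * \<delta>)) = b l)"
      by (metis Suc_leI less_imp_le)
  qed (use assms in auto)
  define \<xi> where "\<xi> = (\<lambda>l x. N i (real (Suc l) * \<delta>) x - N i (real l * \<delta>) x)"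
  define A where "A = (\<lambda>l. if b l then - {0} else {0::nat})"
  have "indep_vars (\<lambda>_. count_space UNIV) (\<lambda>k x. N i (real (Suc k) * \<delta>) x - N i (real k * \<delta>) x) {..<n}"
    using poisson[of i] assms(1) unfolding poisson_process_def
    by (elim conjE allE[of _ "\<lambda>l. real l * \<delta>"]) (auto simp: mono_def intro!: mult_right_mono)
  then have "indep_vars (\<lambda>_. count_space UNIV) \<xi> {..<n}" by (simp add: \<xi>_def)
  then have "prob (\<Inter>l\<in>{..<n}. \<xi> l -` A l \<inter> space M) = (\<Prod>l<n. prob (\<xi> l -` A l \<inter> space M))"
    using assms(2) by (intro indep_varsD_finite) auto
  also have "(\<Inter>l\<in>{..<n}. \<xi> l -` A l \<inter> space M) = E"
    using assms(2) by (auto simp: E_def \<xi>_def A_def split: if_splits)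
  also have "(\<Prod>l<n. prob (\<xi> l -` A l \<inter> space M)) = (\<Prod>l<n. pmf (bernoulli_pmf (1 - exp (- \<delta>))) (b l))"
  proof (rule prod.cong[OF refl])
    fix l
    have "\<xi> l -` A l \<inter> space M = {x\<in>space M. (N i (real l * \<delta>) x < N i (real (Suc l) * \<delta>) x) = b l}"
      by (auto simp: \<xi>_def A_def split: if_splits)
    then show "prob (\<xi> l -` A l \<inter> space M) = pmf (bernoulli_pmf (1 - exp (- \<delta>))) (b l)"
      using prob_ring[of "real l * \<delta>" "real (Suc l) * \<delta>" i "b l"] assms(1)
      by (cases "b l") (simp_all add: algebra_simps)
  qed
  finally show "prob E = (\<Prod>l<n. pmf (bernoulli_pmf (1 - exp (- \<delta>))) (b l))" .
qed

text \<open>Coordinates here and in \<open>rings\<close> are relative to \<open>j\<close>. Outside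
  \<open>{a..k}\<close> both take the default values of \<open>geo\<close> and \<open>bern\<close>,
  so that their joint law can be compared with a \<open>pmf\<close> on full configurations.\<close>

definition window :: "int \<Rightarrow> int \<Rightarrow> int \<Rightarrow> 'a \<Rightarrow> config" where
  "window j a k x = (\<lambda>i. if i \<in> {a..k} then \<omega> 0 x (j + i) else 0)"

definition rings :: "int \<Rightarrow> int \<Rightarrow> int \<Rightarrow> real \<Rightarrow> 'a \<Rightarrow> nat \<Rightarrow> int \<Rightarrow> bool" where
  "rings j a k \<delta> x l i \<longleftrightarrow>
     i \<in> {a..k} \<and> N (j + i) (real l * \<delta>) x < N (j + i) (real (Suc l) * \<delta>) x"

lemma prob_window_rings:
  fixes j :: int
  assumes ak: "a \<le> 0" "0 \<le> k" and \<delta>: "0 < \<delta>" "0 < n"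
    and y: "y \<in> set_pmf (pair_pmf (geo {a..k} (\<lambda>_. \<gamma>)) (replicate_pmf n (bern {a..k} (1 - exp (- \<delta>)))))"
  defines "A \<equiv> {x\<in>space M. (window j a k x, map (rings j a k \<delta> x) [0..<n]) = y}"
  shows "A \<in> events"
    and "prob A = pmf (pair_pmf (geo {a..k} (\<lambda>_. \<gamma>)) (replicate_pmf n (bern {a..k} (1 - exp (- \<delta>))))) y"
proof -
  obtain \<eta> bs where y_def: "y = (\<eta>, bs)" by (cases y)
  from y have \<eta>: "\<eta> \<in> set_pmf (geo {a..k} (\<lambda>_. \<gamma>))" and len: "length bs = n"
    and bs: "\<And>l. l < n \<Longrightarrow> bs ! l \<in> set_pmf (bern {a..k} (1 - exp (- \<delta>)))"
    by (auto simp: y_def set_replicate_pmf in_lists_conv_set)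
  have \<eta>0: "\<eta> i = 0" if "i \<notin> {a..k}" for i
    using \<eta> set_Pi_pmf_subset[of "{a..k}" 0 "\<lambda>_. geometric_pmf (1 - \<gamma>)"] that
    by (auto simp: geo_def)
  have bs0: "\<not> (bs ! l) i" if "l < n" "i \<notin> {a..k}" for l i
    using bs[OF that(1)] set_Pi_pmf_subset[of "{a..k}" False "\<lambda>_. bernoulli_pmf (1 - exp (- \<delta>))"] that
    by (auto simp: bern_def)
  define E where "E = (\<lambda>i. {x\<in>space M. \<forall>l<n. (N i (real l * \<delta>) x < N i (real (Suc l) * \<delta>) x) = (bs ! l) (i - j)})"
  define I where "I = (\<lambda>i. j + i) ` {a..k}"
  have inj: "inj_on (\<lambda>i. j + i) {a..k}" by (auto simp: inj_on_def)
  have prod_I: "(\<Prod>i\<in>I. P i) = (\<Prod>i\<in>{a..k}. P (j + i))" for P :: "int \<Rightarrow> real"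
    unfolding I_def prod.reindex[OF inj] o_def ..
  have ball_I: "(\<forall>i\<in>I. P i) \<longleftrightarrow> (\<forall>i\<in>{a..k}. P (j + i))" for P
    unfolding I_def by blast
  have E: "E i \<in> clock_sets i"
    and pE: "prob (E i) = (\<Prod>l<n. pmf (bernoulli_pmf (1 - exp (- \<delta>))) ((bs ! l) (i - j)))" for i
    unfolding E_def by (rule ring_pattern[OF \<delta>])+
  have A: "A = {x\<in>space M. (\<forall>i\<in>I. \<omega> 0 x i = \<eta> (i - j)) \<and> (\<forall>i\<in>I. x \<in> E i)}"
  proof -
    have "window j a k x = \<eta> \<longleftrightarrow> (\<forall>i\<in>I. \<omega> 0 x i = \<eta> (i - j))" for x
      unfolding ball_I using \<eta>0 by (auto simp: window_def fun_eq_iff)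
    moreover have "map (rings j a k \<delta> x) [0..<n] = bs \<longleftrightarrow> (\<forall>i\<in>I. x \<in> E i)" if "x \<in> space M" for x
    proof -
      have "map (rings j a k \<delta> x) [0..<n] = bs \<longleftrightarrow> (\<forall>l<n. rings j a k \<delta> x l = bs ! l)"
        using len by (simp add: list_eq_iff_nth_eq)
      also have "\<dots> \<longleftrightarrow> (\<forall>l<n. \<forall>i\<in>{a..k}. rings j a k \<delta> x l i = (bs ! l) i)"
        using bs0 by (fastforce simp: rings_def fun_eq_iff)
      also have "\<dots> \<longleftrightarrow> (\<forall>i\<in>I. x \<in> E i)"
        unfolding ball_I using that by (auto simp: E_def rings_def)
      finally show ?thesis .
    qed
    ultimately show ?thesis by (auto simp: A_def y_def)
  qed
  have fin: "finite I" by (simp add: I_def)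
  have "A = {x\<in>space M. \<forall>i\<in>I. \<omega> 0 x i = \<eta> (i - j)} \<inter> {x\<in>space M. \<forall>i\<in>I. x \<in> E i}"
    unfolding A by auto
  moreover have "{x\<in>space M. \<forall>i\<in>I. x \<in> E i} \<in> events"
  proof (rule sets.sets_Collect_finite_All[OF _ fin])
    fix i
    have "{x\<in>space M. x \<in> E i} = E i" by (auto simp: E_def)
    then show "{x\<in>space M. x \<in> E i} \<in> events" using clock_sets_events[OF E[of i]] by simp
  qed
  ultimately show "A \<in> events"
    using prob_initial_clocks(1)[OF fin fin, of E "\<lambda>i. \<eta> (i - j)"] E by auto
  have "prob A = (\<Prod>i\<in>I. pmf (geometric_pmf (1 - \<gamma>)) (\<eta> (i - j))) * (\<Prod>i\<in>I. prob (E i))"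
    unfolding A by (rule prob_initial_clocks(2)[OF fin fin E])
  also have "(\<Prod>i\<in>I. pmf (geometric_pmf (1 - \<gamma>)) (\<eta> (i - j))) = pmf (geo {a..k} (\<lambda>_. \<gamma>)) \<eta>"
    unfolding prod_I geo_def using \<eta>0 by (subst pmf_Pi') auto
  also have "(\<Prod>i\<in>I. prob (E i)) = (\<Prod>i\<in>{a..k}. \<Prod>l<n. pmf (bernoulli_pmf (1 - exp (- \<delta>))) ((bs ! l) i))"
    unfolding prod_I by (simp add: pE)
  \<comment> \<open>Independence was used clock by clock, with independent increments along each
    clock. The target law is organised cell by cell, with independent sites in each cell.\<close>
  also have "\<dots> = (\<Prod>l<n. \<Prod>i\<in>{a..k}. pmf (bernoulli_pmf (1 - exp (- \<delta>))) ((bs ! l) i))"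
    by (rule prod.swap)
  also have "\<dots> = (\<Prod>l<n. pmf (bern {a..k} (1 - exp (- \<delta>))) (bs ! l))"
    unfolding bern_def using bs0 by (intro prod.cong refl) (subst pmf_Pi', auto)
  also have "\<dots> = pmf (replicate_pmf n (bern {a..k} (1 - exp (- \<delta>)))) bs"
    using len by (rule pmf_replicate_pmf[symmetric])
  finally show "prob A = pmf (pair_pmf (geo {a..k} (\<lambda>_. \<gamma>)) (replicate_pmf n (bern {a..k} (1 - exp (- \<delta>))))) y"
    by (simp add: y_def pmf_pair)
qed


section \<open>Exponential moments of the heights\<close>

lemma prob_two_rings:
  assumes "0 < \<delta>" "p \<noteq> q"
  shows "{x\<in>space M. N p (real l * \<delta>) x < N p (real (Suc l) * \<delta>) x
       \<and> N q (real l * \<delta>) x < N q (real (Suc l) * \<delta>) x} \<in> events" (is "?A \<in> _")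
    and "prob {x\<in>space M. N p (real l * \<delta>) x < N p (real (Suc l) * \<delta>) x
       \<and> N q (real l * \<delta>) x < N q (real (Suc l) * \<delta>) x} \<le> \<delta>\<^sup>2"
proof -
  have st: "0 \<le> real l * \<delta>" "real l * \<delta> < real (Suc l) * \<delta>" using assms by auto
  define E where "E = (\<lambda>i. {x\<in>space M. N i (real l * \<delta>) x < N i (real (Suc l) * \<delta>) x})"
  have E: "E i \<in> clock_sets i" for i
    unfolding E_def by (rule clock_setsI[where T = "{real l * \<delta>, real (Suc l) * \<delta>}"]) (use st in auto)
  have A: "?A = {x\<in>space M. \<forall>i\<in>{p, q}. x \<in> E i}" by (auto simp: E_def)
  have "?A = E p \<inter> E q" by (auto simp: E_def)
  then show "?A \<in> events" using E[THEN clock_sets_events] by auto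
  have le: "prob (E i) \<le> \<delta>" for i
    using prob_ring[OF st, of i True] exp_ge_add_one_self[of "- \<delta>"] by (simp add: E_def algebra_simps)
  have "prob ?A = prob (E p) * prob (E q)"
    unfolding A using assms E by (subst prob_clocks) auto
  also have "\<dots> \<le> \<delta> * \<delta>" using le assms by (intro mult_mono) auto
  finally show "prob ?A \<le> \<delta>\<^sup>2" by (simp add: power2_eq_square)
qed

lemma prob_double_ring:
  assumes "0 < \<delta>"
  shows "{x\<in>space M. Suc (N p (real l * \<delta>) x) < N p (real (Suc l) * \<delta>) x} \<in> events" (is "?A \<in> _")
    and "prob {x\<in>space M. Suc (N p (real l * \<delta>) x) < N p (real (Suc l) * \<delta>) x} \<le> \<delta>\<^sup>2"
proof -
  have st: "0 \<le> real l * \<delta>" "real l * \<delta> < real (Suc l) * \<delta>" using assms by auto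
  have "?A \<in> clock_sets p"
    by (rule clock_setsI[where T = "{real l * \<delta>, real (Suc l) * \<delta>}"]) (use st in auto)
  then show "?A \<in> events" by (rule clock_sets_events)
  have "?A = {x\<in>space M. N p (real (Suc l) * \<delta>) x - N p (real l * \<delta>) x \<in> {2..}}" by auto
  then have "prob ?A = measure (measure_pmf (poisson_pmf \<delta>)) {2..}"
    using prob_increment[OF st, of p "{2..}"] by (simp add: algebra_simps)
  then show "prob ?A \<le> \<delta>\<^sup>2" using poisson_ge_2[OF assms] by simp
qed

lemma prob_no_silent:
  fixes j a :: int and n :: nat and \<delta> :: real
  assumes "0 < \<delta>" "0 < n" "a \<le> 0"
  defines "A \<equiv> {x\<in>space M. \<forall>\<sigma>\<in>{a..0}. \<exists>l<n. N (j + \<sigma>) (real l * \<delta>) x < N (j + \<sigma>) (real (Suc l) * \<delta>) x}"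
  shows "A \<in> events" and "prob A = (1 - exp (- (n * \<delta>))) ^ nat (1 - a)"
proof -
  define E where "E = (\<lambda>i. {x\<in>space M. \<exists>l<n. N i (real l * \<delta>) x < N i (real (Suc l) * \<delta>) x})"
  have E: "E i \<in> clock_sets i" for i
    unfolding E_def
  proof (rule clock_setsI[where T = "(\<lambda>l. real l * \<delta>) ` {..n}"])
    fix f g :: "real \<Rightarrow> nat"
    assume "\<And>t. t \<in> (\<lambda>l. real l * \<delta>) ` {..n} \<Longrightarrow> f t = g t"
    then have "f (real l * \<delta>) = g (real l * \<delta>)" if "l \<le> n" for l using that by blast
    then show "(\<exists>l<n. f (real l * \<delta>) < f (real (Suc l) * \<delta>)) \<longleftrightarrow> (\<exists>l<n. g (real l * \<delta>) < g (real (Suc l) * \<delta>))"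
      by (metis Suc_leI less_imp_le)
  qed (use assms in auto)
  define I where "I = (\<lambda>\<sigma>. j + \<sigma>) ` {a..0}"
  have fin: "finite I" by (simp add: I_def)
  have cI: "card I = nat (1 - a)"
    unfolding I_def by (subst card_image) (auto simp: inj_on_def)
  have A: "A = {x\<in>space M. \<forall>i\<in>I. x \<in> E i}"
    unfolding A_def I_def E_def by blast
  show "A \<in> events" unfolding A
  proof (rule sets.sets_Collect_finite_All[OF _ fin])
    fix i
    have "{x\<in>space M. x \<in> E i} = E i" by (auto simp: E_def)
    then show "{x\<in>space M. x \<in> E i} \<in> events" using clock_sets_events[OF E[of i]] by simp
  qed
  have pE: "prob (E i) = 1 - exp (- (n * \<delta>))" for i
  proof -
    define S where "S = {x\<in>space M. \<forall>l<n. (N i (real l * \<delta>) x < N i (real (Suc l) * \<delta>) x) = False}"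
    have "S \<in> events"
      unfolding S_def by (rule clock_sets_events[OF ring_pattern(1)[OF assms(1,2), where b = "\<lambda>_. False"]])
    moreover have "prob S = exp (- (n * \<delta>))"
      unfolding S_def ring_pattern(2)[OF assms(1,2), where b = "\<lambda>_. False"]
      using assms(1) by (simp add: exp_of_nat_mult[symmetric])
    moreover have "E i = space M - S" by (auto simp: E_def S_def)
    ultimately show ?thesis by (simp add: prob_compl)
  qed
  show "prob A = (1 - exp (- (n * \<delta>))) ^ nat (1 - a)"
    unfolding A using fin E by (subst prob_clocks) (auto simp: pE cI)
qed

text \<open>
  Off this event every grid interval contains at most one ring in the window, and some site to the left
  of the origin is silent.
\<close>

definition bad :: "int \<Rightarrow> int \<Rightarrow> int \<Rightarrow> real \<Rightarrow> nat \<Rightarrow> 'a set" where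
  "bad j a k \<delta> n =
     (\<Union>(l, p, q)\<in>{..<n} \<times> {a..k} \<times> {a..k}. {x\<in>space M. p \<noteq> q
         \<and> N (j + p) (real l * \<delta>) x < N (j + p) (real (Suc l) * \<delta>) x
         \<and> N (j + q) (real l * \<delta>) x < N (j + q) (real (Suc l) * \<delta>) x})
   \<union> (\<Union>(l, p)\<in>{..<n} \<times> {a..k}. {x\<in>space M. Suc (N (j + p) (real l * \<delta>) x) < N (j + p) (real (Suc l) * \<delta>) x})
   \<union> {x\<in>space M. \<forall>\<sigma>\<in>{a..0}. \<exists>l<n. N (j + \<sigma>) (real l * \<delta>) x < N (j + \<sigma>) (real (Suc l) * \<delta>) x}"

lemma bad_events:
  fixes \<delta> :: real
  assumes "0 < \<delta>" "0 < n" "a \<le> 0"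
  shows "bad j a k \<delta> n \<in> events"
    and "prob (bad j a k \<delta> n) \<le> n * ((card {a..k})\<^sup>2 + card {a..k}) * \<delta>\<^sup>2 + (1 - exp (- (n * \<delta>))) ^ nat (1 - a)"
proof -
  define A where "A = (\<lambda>(l, p, q). {x\<in>space M. p \<noteq> q
         \<and> N (j + p) (real l * \<delta>) x < N (j + p) (real (Suc l) * \<delta>) x
         \<and> N (j + q) (real l * \<delta>) x < N (j + q) (real (Suc l) * \<delta>) x})"
  define B where "B = (\<lambda>(l, p). {x\<in>space M. Suc (N (j + p) (real l * \<delta>) x) < N (j + p) (real (Suc l) * \<delta>) x})"
  define C where "C = {x\<in>space M. \<forall>\<sigma>\<in>{a..0}. \<exists>l<n. N (j + \<sigma>) (real l * \<delta>) x < N (j + \<sigma>) (real (Suc l) * \<delta>) x}"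
  define I where "I = {..<n} \<times> {a..k} \<times> {a..k}"
  define J where "J = {..<n} \<times> {a..k}"
  have bad: "bad j a k \<delta> n = (\<Union>i\<in>I. A i) \<union> (\<Union>i\<in>J. B i) \<union> C"
    unfolding bad_def A_def B_def C_def I_def J_def ..
  have A: "A i \<in> events \<and> prob (A i) \<le> \<delta>\<^sup>2" for i
  proof (cases i)
    case (fields l p q)
    then show ?thesis
      using prob_two_rings[OF assms(1), of "j + p" "j + q" l] by (cases "p = q") (auto simp: A_def)
  qed
  have B: "B i \<in> events \<and> prob (B i) \<le> \<delta>\<^sup>2" for i
    using prob_double_ring[OF assms(1)] by (cases i) (auto simp: B_def)
  have C: "C \<in> events" "prob C = (1 - exp (- (n * \<delta>))) ^ nat (1 - a)"
    unfolding C_def by (rule prob_no_silent[OF assms])+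
  have fin: "finite I" "finite J" by (auto simp: I_def J_def)
  have AB: "(\<Union>i\<in>I. A i) \<in> events" "(\<Union>i\<in>J. B i) \<in> events"
    using A B fin by auto
  then show "bad j a k \<delta> n \<in> events" unfolding bad using C by auto
  have "prob (bad j a k \<delta> n) \<le> prob (\<Union>i\<in>I. A i) + prob (\<Union>i\<in>J. B i) + prob C"
    unfolding bad using AB C
    by (intro order.trans[OF measure_Un_le] add_mono measure_Un_le) auto
  also have "prob (\<Union>i\<in>I. A i) \<le> (\<Sum>i\<in>I. prob (A i))"
    using A fin by (intro measure_UNION_le) auto
  also have "\<dots> \<le> (\<Sum>i\<in>I. \<delta>\<^sup>2)" using A by (intro sum_mono) auto
  also have "prob (\<Union>i\<in>J. B i) \<le> (\<Sum>i\<in>J. prob (B i))"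
    using B fin by (intro measure_UNION_le) auto
  also have "\<dots> \<le> (\<Sum>i\<in>J. \<delta>\<^sup>2)" using B by (intro sum_mono) auto
  finally have "prob (bad j a k \<delta> n) \<le> (\<Sum>i\<in>I. \<delta>\<^sup>2) + (\<Sum>i\<in>J. \<delta>\<^sup>2) + prob C" by simp
  also have "\<dots> = n * ((card {a..k})\<^sup>2 + card {a..k}) * \<delta>\<^sup>2 + prob C"
    unfolding I_def J_def by (simp add: card_cartesian_product power2_eq_square algebra_simps del: card_atLeastAtMost_int)
  finally show "prob (bad j a k \<delta> n) \<le> n * ((card {a..k})\<^sup>2 + card {a..k}) * \<delta>\<^sup>2 + (1 - exp (- (n * \<delta>))) ^ nat (1 - a)"
    unfolding C(2) .
qed

text \<open>Off \<open>bad\<close> the height increment is a deterministic function of the window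
  and the ring pattern. The joint law of these two is known, and the statement moves from paths to
  probability mass functions.\<close>

lemma nn_integral_not_bad_le:
  assumes "0 < \<delta>" "0 < n" "a \<le> 0" "0 \<le> k"
  shows "(\<integral>\<^sup>+x. indicator (space M - bad j a k \<delta> n) x
            * ennreal (exp (\<theta> * real_of_int (h (j + k) (real n * \<delta>) x - h j 0 x))) \<partial>M)
     \<le> (\<integral>\<^sup>+\<eta>. run_mgf \<theta> a k \<delta> n \<eta> \<partial>geo {a..k} (\<lambda>_. \<gamma>))"
proof -
  define F where "F = (\<lambda>(\<eta>, bs). indicator {bs. good a bs} bs * ennreal (exp (\<theta> * real_of_int (fold fire bs (hts \<eta>) k))))"
  define X where "X = (\<lambda>x. (window j a k x, map (rings j a k \<delta> x) [0..<n]))"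
  have "(\<integral>\<^sup>+x. indicator (space M - bad j a k \<delta> n) x
            * ennreal (exp (\<theta> * real_of_int (h (j + k) (real n * \<delta>) x - h j 0 x))) \<partial>M)
     \<le> (\<integral>\<^sup>+x. F (X x) \<partial>M)"
  proof (rule nn_integral_mono_AE)
    show "AE x in M. indicator (space M - bad j a k \<delta> n) x
            * ennreal (exp (\<theta> * real_of_int (h (j + k) (real n * \<delta>) x - h j 0 x))) \<le> F (X x)"
      using AE_paths
    proof eventually_elim
      case (elim x)
      show ?case
      proof (cases "x \<in> space M - bad j a k \<delta> n")
        case True
        have sep: "p = q" if "l < n" "rings j a k \<delta> x l p" "rings j a k \<delta> x l q" for l p q
          using True that unfolding bad_def rings_def by blast
        have simple: "N (j + p) (real (Suc l) * \<delta>) x \<le> Suc (N (j + p) (real l * \<delta>) x)"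
          if "l < n" "p \<in> {a..k}" for l p
          using True that by (auto simp: bad_def not_less)
        obtain \<sigma> where \<sigma>: "\<sigma> \<in> {a..0}" "\<And>l. l < n \<Longrightarrow> \<not> rings j a k \<delta> x l \<sigma>"
          using True by (auto simp: bad_def rings_def)
        have good: "good a (map (rings j a k \<delta> x) [0..<n])"
        proof -
          have "\<forall>b\<in>set (map (rings j a k \<delta> x) [0..<n]). \<not> b \<sigma>" using \<sigma>(2) by auto
          moreover have "\<forall>b\<in>set (map (rings j a k \<delta> x) [0..<n]). single b"
            using sep by (auto simp: single_def)
          ultimately show ?thesis using \<sigma>(1) unfolding good_def by blast
        qed
        have "h (j + k) (real n * \<delta>) x - h j 0 x
            = fold fire (map (rings j a k \<delta> x) [0..<n]) (hts (window j a k x)) k"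
        proof (rule heights_eq_fold_fire[where c = "\<lambda>i t. N i t x" and \<eta> = "\<lambda>t. \<omega> t x" and h = "\<lambda>i t. h i t x"])
          show "window j a k x i = \<omega> 0 x (j + i)" if "i \<in> {a..k}" for i
            using that by (simp add: window_def)
          show "mono_on {0..} (\<lambda>t. N i t x)" "\<forall>t\<ge>0. continuous (at_right t) (\<lambda>t. N i t x)" for i
            using elim by blast+
          show "h i t x = h i 0 x + int (card (jump_times (\<lambda>t. N i t x) (\<lambda>t. \<omega> t x) i t))"
            "h (i - 1) t x - h i t x = int (\<omega> t x i)" if "0 \<le> t" for i t
            using elim that by blast+
        qed (use assms good simple in \<open>auto simp: rings_def\<close>)
        then show ?thesis using good by (simp add: F_def X_def ennreal_le_indicator_mult)
      qed simp
    qed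
  qed
  also have "\<dots> = (\<integral>\<^sup>+y. F y \<partial>pair_pmf (geo {a..k} (\<lambda>_. \<gamma>)) (replicate_pmf n (bern {a..k} (1 - exp (- \<delta>)))))"
  proof (rule nn_integral_countable_law[OF prob_space_axioms])
    fix y assume "y \<in> set_pmf (pair_pmf (geo {a..k} (\<lambda>_. \<gamma>)) (replicate_pmf n (bern {a..k} (1 - exp (- \<delta>)))))"
    from prob_window_rings[OF assms(3,4,1,2) this, of j]
    show "{x \<in> space M. X x = y} \<in> events"
      "prob {x \<in> space M. X x = y} = pmf (pair_pmf (geo {a..k} (\<lambda>_. \<gamma>)) (replicate_pmf n (bern {a..k} (1 - exp (- \<delta>))))) y"
      unfolding X_def by blast+
  qed
  also have "\<dots> = (\<integral>\<^sup>+\<eta>. run_mgf \<theta> a k \<delta> n \<eta> \<partial>geo {a..k} (\<lambda>_. \<gamma>))"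
    unfolding nn_integral_pair_pmf' run_mgf_def F_def by simp
  finally show ?thesis .
qed

text \<open>The order of choices matters: \<open>a\<close> comes first, making the absence of a
  silent site unlikely uniformly in \<open>n\<close>, and then \<open>n\<close>, since the
  probability of two rings in one cell is of order \<open>1 / n\<close> with a constant that depends
  on the window.\<close>

lemma height_mgf_le:
  assumes t: "0 < t" and k: "0 \<le> k" and R: "0 \<le> R"
    and bound: "\<And>a e. a \<le> 0 \<Longrightarrow> 0 < e \<Longrightarrow> \<forall>\<^sub>F n in sequentially.
       (\<integral>\<^sup>+\<eta>. run_mgf \<theta> a k (t / real n) n \<eta> \<partial>geo {a..k} (\<lambda>_. \<gamma>)) \<le> ennreal (R + e)"
  shows "(\<integral>\<^sup>+x. ennreal (exp (\<theta> * real_of_int (h (j + k) t x - h j 0 x))) \<partial>M) \<le> ennreal R"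
proof (rule nn_integral_le_of_large_sets[OF prob_space_axioms _ R])
  show "(\<lambda>x. ennreal (exp (\<theta> * real_of_int (h (j + k) t x - h j 0 x)))) \<in> borel_measurable M"
  proof -
    have "0 \<le> t" using t by simp
    then show ?thesis by measurable
  qed
  fix e :: real assume e: "0 < e"
  have "(\<lambda>m. (1 - exp (- t)) ^ m) \<longlonglongrightarrow> 0"
    using t by (intro LIMSEQ_power_zero) auto
  then have "\<forall>\<^sub>F m in sequentially. (1 - exp (- t)) ^ m < e / 2"
    using e by (intro order_tendstoD(2)) auto
  then obtain m where m: "\<And>m'. m' \<ge> m \<Longrightarrow> (1 - exp (- t)) ^ m' < e / 2"
    by (auto simp: eventually_sequentially)
  define a where "a = - int m"
  have a: "a \<le> 0" "(1 - exp (- t)) ^ nat (1 - a) < e / 2"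
    using m[of "nat (1 - a)"] by (auto simp: a_def)
  define C where "C = real ((card {a..k})\<^sup>2 + card {a..k})"
  have "(\<lambda>n. C * t\<^sup>2 / real n) \<longlonglongrightarrow> 0"
    by (intro tendsto_divide_0[OF tendsto_const] filterlim_real_at_infinity_sequentially)
  then have "\<forall>\<^sub>F n in sequentially. C * t\<^sup>2 / real n < e / 2"
    using e by (intro order_tendstoD(2)) auto
  then have "\<forall>\<^sub>F n in sequentially. C * t\<^sup>2 / real n < e / 2 \<and> 0 < n
       \<and> (\<integral>\<^sup>+\<eta>. run_mgf \<theta> a k (t / real n) n \<eta> \<partial>geo {a..k} (\<lambda>_. \<gamma>)) \<le> ennreal (R + e)"
    using bound[OF a(1) e] eventually_gt_at_top[of 0] by eventually_elim auto
  then obtain n where n: "C * t\<^sup>2 / real n < e / 2" "0 < n"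
    "(\<integral>\<^sup>+\<eta>. run_mgf \<theta> a k (t / real n) n \<eta> \<partial>geo {a..k} (\<lambda>_. \<gamma>)) \<le> ennreal (R + e)"
    by (auto simp: eventually_sequentially)
  define \<delta> where "\<delta> = t / real n"
  have \<delta>: "0 < \<delta>" "real n * \<delta> = t" using t n by (auto simp: \<delta>_def)
  show "\<exists>G\<in>events. prob (space M - G) \<le> e
      \<and> (\<integral>\<^sup>+x. indicator G x * ennreal (exp (\<theta> * real_of_int (h (j + k) t x - h j 0 x))) \<partial>M) \<le> ennreal (R + e)"
  proof (intro bexI conjI)
    show G: "space M - bad j a k \<delta> n \<in> events" using bad_events(1)[OF \<delta>(1) n(2) a(1)] by auto
    have compl: "space M - (space M - bad j a k \<delta> n) = bad j a k \<delta> n"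
      using sets.sets_into_space[OF bad_events(1)[OF \<delta>(1) n(2) a(1)]] by auto
    have "prob (bad j a k \<delta> n) \<le> n * C * \<delta>\<^sup>2 + (1 - exp (- t)) ^ nat (1 - a)"
      using bad_events(2)[OF \<delta>(1) n(2) a(1), of j k] unfolding \<delta>(2) C_def by simp
    moreover have "n * C * \<delta>\<^sup>2 = C * t\<^sup>2 / real n"
      using n(2) by (simp add: \<delta>_def power2_eq_square)
    ultimately show "prob (space M - (space M - bad j a k \<delta> n)) \<le> e"
      using n(1) a(2) unfolding compl by linarith
    show "(\<integral>\<^sup>+x. indicator (space M - bad j a k \<delta> n) x
        * ennreal (exp (\<theta> * real_of_int (h (j + k) t x - h j 0 x))) \<partial>M) \<le> ennreal (R + e)"
      using nn_integral_not_bad_le[OF \<delta>(1) n(2) a(1) k, of j \<theta>] n(3)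
      unfolding \<delta>(2) unfolding \<delta>_def by (rule order.trans)
  qed
qed

text \<open>For \<open>k = 0\<close> no window site lies to the right of the origin, so the step
  profile is the stationary state itself: Burke's bound applies without comparison and without
  normalising factor.\<close>

lemma jump_mgf_le:
  assumes t: "0 < t" and \<theta>: "\<gamma> * exp \<theta> < 1"
  shows "(\<integral>\<^sup>+x. ennreal (exp (\<theta> * real_of_int (h j t x - h j 0 x))) \<partial>M)
     \<le> ennreal (exp (\<gamma> * (exp \<theta> - 1) * t))"
proof -
  have "(\<integral>\<^sup>+x. ennreal (exp (\<theta> * real_of_int (h (j + 0) t x - h j 0 x))) \<partial>M)
     \<le> ennreal (exp (\<gamma> * (exp \<theta> - 1) * t))"
  proof (rule height_mgf_le[OF t])
    fix a :: int and e :: real assume a: "a \<le> 0" and e: "0 < e"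
    have "geo {a..0} (\<lambda>i. if i \<le> 0 then \<gamma> else \<gamma> * exp \<theta>) = geo {a..0} (\<lambda>_. \<gamma>)"
      unfolding geo_def by (intro Pi_pmf_cong) auto
    then show "\<forall>\<^sub>F n in sequentially. (\<integral>\<^sup>+\<eta>. run_mgf \<theta> a 0 (t / real n) n \<eta> \<partial>geo {a..0} (\<lambda>_. \<gamma>))
      \<le> ennreal (exp (\<gamma> * (exp \<theta> - 1) * t) + e)"
      using step_profile_bound[of \<gamma> \<theta> a 0 t e] \<gamma> assms a e by simp
  qed auto
  then show ?thesis by simp
qed

lemma lower_tail_mgf_le:
  assumes t: "0 < t" and k: "0 \<le> k" and \<epsilon>: "0 \<le> \<epsilon>" "\<gamma> * exp \<epsilon> < 1"
  shows "(\<integral>\<^sup>+x. ennreal (exp (- \<epsilon> * real_of_int (h (j + k) t x - h j 0 x))) \<partial>M)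
     \<le> ennreal (((1 - \<gamma> * exp (- \<epsilon>)) / (1 - \<gamma>)) ^ nat k * exp (\<gamma> * (exp (- \<epsilon>) - 1) * t)
        + ((1 - \<gamma>) / (1 - \<gamma> * exp \<epsilon>)) ^ nat k * exp (\<gamma> * (1 - exp \<epsilon>) * t))"
proof (rule height_mgf_le[OF t k])
  have "\<gamma> * exp (- \<epsilon>) \<le> \<gamma> * 1" using \<gamma> \<epsilon> by (intro mult_left_mono) auto
  then have e1: "\<gamma> * exp (- \<epsilon>) < 1" using \<gamma>(2) by linarith
  \<comment> \<open>The second profile starts from ratio \<open>\<gamma> * exp \<epsilon>\<close>,
    and its tilt by \<open>- \<epsilon>\<close> restores \<gamma> on the right. Subcriticality of
    \<open>\<gamma> * exp \<epsilon>\<close> is what makes its left half a geometric law.\<close>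
  have e2: "\<gamma> * exp \<epsilon> * exp (- \<epsilon>) = \<gamma>" by (simp add: mult.assoc flip: exp_add)
  let ?R1 = "((1 - \<gamma> * exp (- \<epsilon>)) / (1 - \<gamma>)) ^ nat k * exp (\<gamma> * (exp (- \<epsilon>) - 1) * t)"
  let ?R2 = "((1 - \<gamma>) / (1 - \<gamma> * exp \<epsilon>)) ^ nat k * exp (\<gamma> * (1 - exp \<epsilon>) * t)"
  have R: "0 \<le> ?R1" "0 \<le> ?R2" using e1 \<epsilon> \<gamma>(1,2) by auto
  then show "0 \<le> ?R1 + ?R2" by simp
  fix a :: int and e :: real assume a: "a \<le> 0" and e: "0 < e"
  have "\<forall>\<^sub>F n in sequentially.
      (\<integral>\<^sup>+\<eta>. run_mgf (- \<epsilon>) a k (t / real n) n \<eta> \<partial>geo {a..k} (\<lambda>i. if i \<le> 0 then \<gamma> else \<gamma> * exp (- \<epsilon>)))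
        \<le> ennreal (?R1 + e / 2)"
    using \<gamma> e1 e a k t by (intro step_profile_bound) auto
  moreover have "\<forall>\<^sub>F n in sequentially.
      (\<integral>\<^sup>+\<eta>. run_mgf (- \<epsilon>) a k (t / real n) n \<eta> \<partial>geo {a..k} (\<lambda>i. if i \<le> 0 then \<gamma> * exp \<epsilon> else \<gamma>))
        \<le> ennreal (?R2 + e / 2)"
  proof -
    have e3: "\<gamma> * exp \<epsilon> * (exp (- \<epsilon>) - 1) = \<gamma> * (1 - exp \<epsilon>)"
      using e2 by (simp add: algebra_simps)
    show ?thesis
      using step_profile_bound[of "\<gamma> * exp \<epsilon>" "- \<epsilon>" a k t "e / 2", unfolded e2 e3] \<gamma>(1,2) \<epsilon> e a k t
      by simp
  qed
  ultimately show "\<forall>\<^sub>F n in sequentially. (\<integral>\<^sup>+\<eta>. run_mgf (- \<epsilon>) a k (t / real n) n \<eta> \<partial>geo {a..k} (\<lambda>_. \<gamma>))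
      \<le> ennreal (?R1 + ?R2 + e)"
  proof eventually_elim
    case (elim n)
    have "(\<integral>\<^sup>+\<eta>. run_mgf (- \<epsilon>) a k (t / real n) n \<eta> \<partial>geo {a..k} (\<lambda>_. \<gamma>))
       \<le> ennreal (?R1 + e / 2) + ennreal (?R2 + e / 2)"
      by (rule order.trans[OF stationary_le_step_profiles add_mono[OF elim]]) (use \<epsilon> a k in auto)
    also have "\<dots> = ennreal (?R1 + ?R2 + e)"
      using R e by (simp flip: ennreal_plus)
    finally show ?case .
  qed
qed

end

section \<open>Variance of the current\<close>

text \<open>Logarithmic moment generating functions of a centred Poisson variable of mean
  \<open>t\<close> at the tilts \<open>- s / sqrt t\<close> and \<open>s / sqrt t\<close>. The limit
  is half its variance times the squared tilt.\<close>

lemma poisson_exponent_limits: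
  fixes s :: real
  assumes "0 < s"
  shows "((\<lambda>t. t * (s / sqrt t + exp (- (s / sqrt t)) - 1)) \<longlongrightarrow> s\<^sup>2 / 2) at_top"
    and "((\<lambda>t. t * (exp (s / sqrt t) - 1 - s / sqrt t)) \<longlongrightarrow> s\<^sup>2 / 2) at_top"
proof -
  have 1: "s * s / 2 = s\<^sup>2 / 2"
    by (simp add: power2_eq_square)
  show "((\<lambda>t. t * (s / sqrt t + exp (- (s / sqrt t)) - 1)) \<longlongrightarrow> s\<^sup>2 / 2) at_top"
    unfolding 1[symmetric] using assms by real_asymp
  show "((\<lambda>t. t * (exp (s / sqrt t) - 1 - s / sqrt t)) \<longlongrightarrow> s\<^sup>2 / 2) at_top"
    unfolding 1[symmetric] using assms by real_asymp
qed

text \<open>Since \<open>1 / (1 + \<rho> * (1 - exp u))\<close> is the moment generating function of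
  the geometric law of mean \<rho>, these are \<open>t\<close> times the negated cumulant functions
  of the centred law, whose variance is \<open>\<rho> + \<rho>\<^sup>2\<close>.\<close>

lemma geometric_exponent_limits:
  fixes \<rho> s :: real
  assumes "0 < \<rho>" "0 < s"
  shows "((\<lambda>t. t * (ln (1 + \<rho> * (1 - exp (- (s / sqrt t)))) - \<rho> * (s / sqrt t)))
            \<longlongrightarrow> - ((\<rho> + \<rho>\<^sup>2) * s\<^sup>2 / 2)) at_top"
    and "((\<lambda>t. t * (ln (1 + \<rho> * (1 - exp (s / sqrt t))) + \<rho> * (s / sqrt t)))
            \<longlongrightarrow> - ((\<rho> + \<rho>\<^sup>2) * s\<^sup>2 / 2)) at_top"
proof -
  have 2: "- (\<rho> * (s * s) / 2) - \<rho> * s * (\<rho> * s) / 2 = - ((\<rho> + \<rho>\<^sup>2) * s\<^sup>2 / 2)"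
    by (simp add: power2_eq_square field_simps)
  show "((\<lambda>t. t * (ln (1 + \<rho> * (1 - exp (- (s / sqrt t)))) - \<rho> * (s / sqrt t)))
            \<longlongrightarrow> - ((\<rho> + \<rho>\<^sup>2) * s\<^sup>2 / 2)) at_top"
    unfolding 2[symmetric] using assms by real_asymp
  show "((\<lambda>t. t * (ln (1 + \<rho> * (1 - exp (s / sqrt t))) + \<rho> * (s / sqrt t)))
            \<longlongrightarrow> - ((\<rho> + \<rho>\<^sup>2) * s\<^sup>2 / 2)) at_top"
    unfolding 2[symmetric] using assms by real_asymp
qed

lemma power_eq_exp_ln: "0 < x \<Longrightarrow> x ^ n = exp (real n * ln x)" for x :: real
  by (simp add: exp_of_nat_mult)

lemma integrable_of_nn_integral_le:
  fixes Z :: "'a \<Rightarrow> real"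
  assumes "Z \<in> borel_measurable M" "\<And>x. 0 \<le> Z x" "(\<integral>\<^sup>+x. ennreal (Z x) \<partial>M) \<le> ennreal C" "0 \<le> C"
  shows "integrable M Z" and "(\<integral>x. Z x \<partial>M) \<le> C"
proof -
  have "(\<integral>\<^sup>+x. ennreal (Z x) \<partial>M) < \<infinity>" using assms(3) by (rule order.strict_trans1) simp
  then show int: "integrable M Z" using assms(1,2) by (intro integrableI_nonneg) auto
  have "ennreal (\<integral>x. Z x \<partial>M) \<le> ennreal C"
    using assms(3) nn_integral_eq_integral[OF int] assms(2) by simp
  then show "(\<integral>x. Z x \<partial>M) \<le> C" using assms(4) by simp
qed

text \<open>For \<open>\<bar>y\<bar> \<le> K\<close> use
  \<open>y\<^sup>2 \<le> K * \<bar>y\<bar>\<close>, where \<open>\<bar>y\<bar>\<close> is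
  \<open>y\<close> plus twice the negative part and the latter is at most
  \<open>exp (- s * y) / s\<close>. For larger values use
  \<open>y\<^sup>2 \<le> y ^ 4 / K\<^sup>2\<close>; the constant 256 is \<open>4 ^ 4\<close>, from
  \<open>(1 + \<bar>y\<bar> / 4) ^ 4 \<le> exp \<bar>y\<bar>\<close>.\<close>

lemma square_le_exp_bounds:
  fixes y s K :: real
  assumes "0 < s" "0 < K"
  shows "\<bar>y\<bar> \<le> exp y + exp (- y)"
    and "y\<^sup>2 \<le> K * (y + 2 * exp (- s * y) / s) + 256 * (exp y + exp (- y)) / K\<^sup>2"
proof -
  have abs_exp: "exp \<bar>y\<bar> \<le> exp y + exp (- y)" by (simp add: abs_if)
  then show "\<bar>y\<bar> \<le> exp y + exp (- y)" using exp_ge_add_one_self[of "\<bar>y\<bar>"] by linarith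
  have abs: "\<bar>y\<bar> \<le> y + 2 * exp (- s * y) / s"
  proof (cases "0 \<le> y")
    case False
    have "- s * y \<le> exp (- s * y)" using exp_ge_add_one_self[of "- s * y"] by linarith
    then show ?thesis using False assms by (simp add: field_simps)
  qed (use assms in auto)
  show "y\<^sup>2 \<le> K * (y + 2 * exp (- s * y) / s) + 256 * (exp y + exp (- y)) / K\<^sup>2"
  proof (cases "\<bar>y\<bar> \<le> K")
    case True
    then have "y\<^sup>2 \<le> K * \<bar>y\<bar>"
      using mult_right_mono[OF True, of "\<bar>y\<bar>"] by (simp add: power2_eq_square)
    also have "\<dots> \<le> K * (y + 2 * exp (- s * y) / s)" using abs assms by (intro mult_left_mono) auto
    finally show ?thesis by (rule order.trans) (auto intro: add_pos_pos)
  next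
    case False
    have "(\<bar>y\<bar> / 4) ^ 4 \<le> (1 + \<bar>y\<bar> / of_nat 4) ^ 4" by (intro power_mono) auto
    also have "\<dots> \<le> exp \<bar>y\<bar>" by (rule exp_ge_one_plus_x_over_n_power_n) auto
    finally have y4: "y ^ 4 \<le> 256 * (exp y + exp (- y))" using abs_exp by (simp add: power_divide)
    have "K\<^sup>2 \<le> y\<^sup>2" using False assms by (metis abs_le_square_iff abs_of_pos less_le not_le)
    then have "K\<^sup>2 * y\<^sup>2 \<le> y\<^sup>2 * y\<^sup>2" by (intro mult_right_mono) auto
    also have "\<dots> = y ^ 4" by (simp add: power2_eq_square power4_eq_xxxx mult.assoc)
    finally have "y\<^sup>2 \<le> 256 * (exp y + exp (- y)) / K\<^sup>2"
      using y4 assms by (simp add: field_simps)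
    moreover have "0 \<le> K * (y + 2 * exp (- s * y) / s)"
      using abs assms by (intro mult_nonneg_nonneg) auto
    ultimately show ?thesis by linarith
  qed
qed

text \<open>
  Exponential moments at \<open>\<plusminus>1\<close> control the region \<open>\<bar>Y\<bar> > K\<close>; on the rest \<open>Y\<^sup>2 \<le> K \<bar>Y\<bar>\<close>, and
  \<open>E \<bar>Y\<bar>\<close> is small because the negative part is (large \<open>s\<close>) and the mean is not positive.
\<close>

lemma (in prob_space) second_moment_le_of_mgf:
  fixes Y :: "'a \<Rightarrow> real"
  assumes Y: "Y \<in> borel_measurable M" and sK: "0 < s" "0 < K" and B: "0 \<le> B"
    and Es: "(\<integral>\<^sup>+x. ennreal (exp (- s * Y x)) \<partial>M) \<le> ennreal 3"
    and Em: "(\<integral>\<^sup>+x. ennreal (exp (- 1 * Y x)) \<partial>M) \<le> ennreal 3"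
    and Ep: "(\<integral>\<^sup>+x. ennreal (exp (Y x)) \<partial>M) \<le> ennreal B"
    and mean: "expectation Y \<le> 0"
  shows "integrable M (\<lambda>x. (Y x)\<^sup>2)" and "expectation (\<lambda>x. (Y x)\<^sup>2) \<le> 6 * K / s + 256 * (B + 3) / K\<^sup>2"
proof -
  have [measurable]: "Y \<in> borel_measurable M" by fact
  have s: "integrable M (\<lambda>x. exp (- s * Y x))" "expectation (\<lambda>x. exp (- s * Y x)) \<le> 3"
    by (rule integrable_of_nn_integral_le[OF _ _ Es]; simp)+
  have m: "integrable M (\<lambda>x. exp (- Y x))" "expectation (\<lambda>x. exp (- Y x)) \<le> 3"
    using integrable_of_nn_integral_le[OF _ _ Em] by simp_all
  have p: "integrable M (\<lambda>x. exp (Y x))" "expectation (\<lambda>x. exp (Y x)) \<le> B"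
    using integrable_of_nn_integral_le[OF _ _ Ep B] by simp_all
  have iY: "integrable M Y"
  proof (rule Bochner_Integration.integrable_bound)
    show "integrable M (\<lambda>x. exp (Y x) + exp (- Y x))" using m p by auto
    show "AE x in M. norm (Y x) \<le> norm (exp (Y x) + exp (- Y x))"
      using square_le_exp_bounds(1)[of 1 1] by (intro AE_I2) (simp add: abs_of_pos add_pos_pos)
  qed simp
  let ?R = "\<lambda>x. K * (Y x + 2 * exp (- s * Y x) / s) + 256 * (exp (Y x) + exp (- Y x)) / K\<^sup>2"
  have iR: "integrable M ?R" using iY s m p by auto
  show i2: "integrable M (\<lambda>x. (Y x)\<^sup>2)"
  proof (rule Bochner_Integration.integrable_bound[OF iR])
    show "AE x in M. norm ((Y x)\<^sup>2) \<le> norm (?R x)"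
      using square_le_exp_bounds(2)[OF sK] by (intro AE_I2) (force intro: order.trans[OF _ abs_ge_self])
  qed simp
  have "expectation (\<lambda>x. (Y x)\<^sup>2) \<le> expectation ?R"
    by (intro integral_mono i2 iR square_le_exp_bounds(2) sK)
  also have "\<dots> = K * (expectation Y + 2 * expectation (\<lambda>x. exp (- s * Y x)) / s)
      + 256 * (expectation (\<lambda>x. exp (Y x)) + expectation (\<lambda>x. exp (- Y x))) / K\<^sup>2"
    using iY s(1) m(1) p(1) by simp
  also have "\<dots> \<le> K * (0 + 2 * 3 / s) + 256 * (B + 3) / K\<^sup>2"
    using sK mean s(2) m(2) p(2) by (intro add_mono mult_left_mono divide_right_mono) auto
  finally show "expectation (\<lambda>x. (Y x)\<^sup>2) \<le> 6 * K / s + 256 * (B + 3) / K\<^sup>2" by (simp add: mult.commute)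
qed

text \<open>The covariance is bounded by Cauchy-Schwarz in the weighted form
  \<open>2 * u * w \<le> l * u\<^sup>2 + w\<^sup>2 / l\<close>. The free weight \<open>l\<close>
  lets the first part be made small first and the second moment of \<open>Z\<close> be chosen
  accordingly.\<close>

lemma (in prob_space) variance_perturbation:
  fixes A Z :: "'a \<Rightarrow> real"
  assumes A: "integrable M A" "integrable M (\<lambda>x. (A x)\<^sup>2)" "A \<in> borel_measurable M"
    and Z: "Z \<in> borel_measurable M" "integrable M (\<lambda>x. (Z x)\<^sup>2)" and l: "0 < l"
  shows "\<bar>variance (\<lambda>x. A x + Z x + m) - variance A\<bar> \<le> l * variance A + (1 + 1 / l) * expectation (\<lambda>x. (Z x)\<^sup>2)"
proof -
  have [measurable]: "A \<in> borel_measurable M" "Z \<in> borel_measurable M" by fact+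
  have iZ: "integrable M Z" by (rule square_integrable_imp_integrable[OF Z])
  define U where "U = (\<lambda>x. A x - expectation A)"
  define W where "W = (\<lambda>x. Z x - expectation Z)"
  have [measurable]: "U \<in> borel_measurable M" "W \<in> borel_measurable M" by (simp_all add: U_def W_def)
  have iU: "integrable M (\<lambda>x. (U x)\<^sup>2)" using A iZ by (simp add: U_def power2_diff)
  have iW: "integrable M (\<lambda>x. (W x)\<^sup>2)" using Z iZ by (simp add: W_def power2_diff)
  have UW: "\<bar>2 * (u * w)\<bar> \<le> l * u\<^sup>2 + w\<^sup>2 / l" for u w :: real
  proof -
    have "0 \<le> (l * u - w)\<^sup>2 / l" "0 \<le> (l * u + w)\<^sup>2 / l" using l by auto
    then show ?thesis using l by (simp add: power2_eq_square field_simps abs_le_iff)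
  qed
  have iUW: "integrable M (\<lambda>x. 2 * (U x * W x))"
  proof (rule Bochner_Integration.integrable_bound)
    show "integrable M (\<lambda>x. l * (U x)\<^sup>2 + (W x)\<^sup>2 / l)" using iU iW by auto
    show "AE x in M. norm (2 * (U x * W x)) \<le> norm (l * (U x)\<^sup>2 + (W x)\<^sup>2 / l)"
      using UW by (intro AE_I2) (metis abs_ge_self order.trans real_norm_def)
  qed simp
  have "expectation (\<lambda>x. A x + Z x + m) = expectation A + expectation Z + m"
    using A iZ by (simp add: prob_space)
  then have "variance (\<lambda>x. A x + Z x + m) = expectation (\<lambda>x. (U x)\<^sup>2 + 2 * (U x * W x) + (W x)\<^sup>2)"
    by (intro Bochner_Integration.integral_cong) (simp_all add: U_def W_def power2_eq_square algebra_simps)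
  also have "\<dots> = variance A + expectation (\<lambda>x. 2 * (U x * W x)) + expectation (\<lambda>x. (W x)\<^sup>2)"
    using iU iW iUW by (simp add: U_def)
  finally have *: "variance (\<lambda>x. A x + Z x + m) - variance A
      = expectation (\<lambda>x. 2 * (U x * W x)) + expectation (\<lambda>x. (W x)\<^sup>2)" by simp
  have "\<bar>expectation (\<lambda>x. 2 * (U x * W x))\<bar> \<le> expectation (\<lambda>x. \<bar>2 * (U x * W x)\<bar>)"
    by (rule integral_abs_bound)
  also have "\<dots> \<le> expectation (\<lambda>x. l * (U x)\<^sup>2 + (W x)\<^sup>2 / l)"
    using iU iW iUW UW by (intro integral_mono) auto
  also have "\<dots> = l * variance A + expectation (\<lambda>x. (W x)\<^sup>2) / l"
    using iU iW by (simp add: U_def)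
  finally have **: "\<bar>expectation (\<lambda>x. 2 * (U x * W x))\<bar> \<le> l * variance A + expectation (\<lambda>x. (W x)\<^sup>2) / l" .
  have W: "0 \<le> expectation (\<lambda>x. (W x)\<^sup>2)" by simp
  have WZ: "expectation (\<lambda>x. (W x)\<^sup>2) \<le> expectation (\<lambda>x. (Z x)\<^sup>2)"
    using variance_eq[OF iZ Z(2)] zero_le_power2[of "expectation Z"] unfolding W_def by linarith
  have "\<bar>variance (\<lambda>x. A x + Z x + m) - variance A\<bar>
      \<le> l * variance A + (1 + 1 / l) * expectation (\<lambda>x. (W x)\<^sup>2)"
  proof -
    have "(1 + 1 / l) * expectation (\<lambda>x. (W x)\<^sup>2) = expectation (\<lambda>x. (W x)\<^sup>2) + expectation (\<lambda>x. (W x)\<^sup>2) / l"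
      by (simp add: distrib_right)
    then show ?thesis using * ** W by linarith
  qed
  also have "\<dots> \<le> l * variance A + (1 + 1 / l) * expectation (\<lambda>x. (Z x)\<^sup>2)"
    using WZ l by (intro add_mono mult_left_mono) auto
  finally show ?thesis .
qed

section \<open>Moments of the initial heights and of the number of jumps\<close>

context stationary_tazrp_process
begin

lemma initial_mgf:
  assumes "0 \<le> k" "\<gamma> * exp u < 1"
  shows "(\<integral>\<^sup>+x. ennreal (exp (- u * real_of_int (h (j + k) 0 x - h j 0 x))) \<partial>M)
     = ennreal (((1 - \<gamma>) / (1 - \<gamma> * exp u)) ^ nat k)"
proof -
  \<comment> \<open>A single cell of length 1 is attached only to reuse
    \<open>prob_window_rings\<close>; its ring pattern is integrated out again.\<close>
  define P where "P = pair_pmf (geo {0..k} (\<lambda>_. \<gamma>)) (replicate_pmf 1 (bern {0..k} (1 - exp (- 1))))"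
  define X where "X = (\<lambda>x. (window j 0 k x, map (rings j 0 k 1 x) [0..<1]))"
  let ?E = "\<lambda>\<eta>. ennreal (exp (- u * real_of_int (hts \<eta> k)))"
  have "(\<integral>\<^sup>+x. ennreal (exp (- u * real_of_int (h (j + k) 0 x - h j 0 x))) \<partial>M) = (\<integral>\<^sup>+x. ?E (fst (X x)) \<partial>M)"
  proof (rule nn_integral_cong_AE)
    show "AE x in M. ennreal (exp (- u * real_of_int (h (j + k) 0 x - h j 0 x))) = ?E (fst (X x))"
      using AE_paths
    proof eventually_elim
      case (elim x)
      have "hts (window j 0 k x) k = h (j + k) 0 x - h j 0 x"
      proof (rule hts_eqI[of 0 k "\<lambda>i. h (j + i) 0 x - h j 0 x"])
        show "h (j + (i - 1)) 0 x - h j 0 x - (h (j + i) 0 x - h j 0 x) = int (window j 0 k x i)"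
          if i: "i \<in> {0..k}" for i
        proof -
          have "h (j + i - 1) 0 x - h (j + i) 0 x = int (\<omega> 0 x (j + i))" using elim by blast
          then show ?thesis using i by (simp add: window_def algebra_simps)
        qed
      qed (use assms in auto)
      then show ?case by (simp add: X_def)
    qed
  qed
  also have "\<dots> = (\<integral>\<^sup>+y. ?E (fst y) \<partial>P)"
  proof (rule nn_integral_countable_law[OF prob_space_axioms])
    fix y assume "y \<in> set_pmf P"
    then show "{x \<in> space M. X x = y} \<in> events" "prob {x \<in> space M. X x = y} = pmf P y"
      using prob_window_rings[of 0 k 1 1 y j] assms by (simp_all add: P_def X_def)
  qed
  also have "\<dots> = (\<integral>\<^sup>+\<eta>. ?E \<eta> \<partial>geo {0..k} (\<lambda>_. \<gamma>))"
    unfolding P_def nn_integral_pair_pmf' by (simp add: measure_pmf.emeasure_space_1[simplified])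
  also have "\<dots> = ennreal (((1 - \<gamma>) / (1 - \<gamma> * exp u)) ^ nat k)"
  proof -
    let ?I = "\<integral>\<^sup>+\<eta>. ?E \<eta> \<partial>geo {0..k} (\<lambda>_. \<gamma>)"
    define c where "c = ((1 - \<gamma> * exp u) / (1 - \<gamma>)) ^ nat k"
    have c: "0 < c" using assms \<gamma>(2) by (simp add: c_def)
    \<comment> \<open>The tilt identity with integrand 1 expresses that the tilted law has total
      mass 1, which determines the exponential moment.\<close>
    have "1 = ennreal c * ?I"
      using nn_integral_geo_tilt[of \<gamma> u 0 k "\<lambda>_. 1"] \<gamma>(1,2) assms
      by (simp add: c_def measure_pmf.emeasure_space_1[simplified])
    then have "ennreal (1 / c) * 1 = ennreal (1 / c) * (ennreal c * ?I)" by simp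
    also have "\<dots> = ennreal (1 / c * c) * ?I"
      using c by (simp only: ennreal_mult mult.assoc less_imp_le zero_le_divide_1_iff)
    also have "\<dots> = ?I" using c by simp
    finally show ?thesis unfolding c_def by (simp add: power_divide)
  qed
  finally show ?thesis .
qed

lemma \<omega>0_measurable [measurable]: "(\<lambda>x. \<omega> 0 x i) \<in> measurable M (count_space UNIV)"
  using measurable_compose[OF \<omega>_measurable[of 0] measurable_component_singleton[of i UNIV]] by simp

lemma distr_\<omega>0: "distr M (count_space UNIV) (\<lambda>x. \<omega> 0 x i) = measure_pmf (geometric_pmf (1 - \<gamma>))"
proof -
  interpret P: product_prob_space "\<lambda>_::int. measure_pmf (geom_mu \<rho>)" UNIV ..
  have "distr (distr M config_space (\<omega> 0)) (count_space UNIV) (\<lambda>f. f i) = distr M (count_space UNIV) (\<lambda>x. \<omega> 0 x i)"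
    using \<omega>_measurable[of 0] by (subst distr_distr) (auto simp: comp_def)
  then have "distr M (count_space UNIV) (\<lambda>x. \<omega> 0 x i)
     = distr (Pi\<^sub>M UNIV (\<lambda>_. measure_pmf (geom_mu \<rho>))) (count_space UNIV) (\<lambda>f. f i)"
    unfolding distr_\<omega> by simp
  also have "\<dots> = distr (Pi\<^sub>M UNIV (\<lambda>_. measure_pmf (geom_mu \<rho>))) (measure_pmf (geom_mu \<rho>)) (\<lambda>f. f i)"
    by (rule distr_cong) auto
  also have "\<dots> = measure_pmf (geom_mu \<rho>)" by (rule P.PiM_component) simp
  finally show ?thesis by (simp add: geom_mu_eq)
qed

lemma indep_\<omega>0: "indep_vars (\<lambda>_. count_space UNIV) (\<lambda>i x. \<omega> 0 x i) UNIV"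
proof (subst indep_vars_iff_distr_eq_PiM')
  have "distr M config_space (\<lambda>x. \<lambda>i\<in>UNIV. \<omega> 0 x i) = Pi\<^sub>M UNIV (\<lambda>_. measure_pmf (geometric_pmf (1 - \<gamma>)))"
  proof -
    have "(\<lambda>x. \<lambda>i\<in>UNIV. \<omega> 0 x i) = \<omega> 0" by (simp add: fun_eq_iff)
    then show ?thesis using distr_\<omega> by (simp only: geom_mu_eq)
  qed
  then show "distr M config_space (\<lambda>x. \<lambda>i\<in>UNIV. \<omega> 0 x i)
      = Pi\<^sub>M UNIV (\<lambda>i. distr M (count_space UNIV) (\<lambda>x. \<omega> 0 x i))"
    by (simp add: distr_\<omega>0)
qed auto

lemma integral_\<omega>0:
  fixes f :: "nat \<Rightarrow> real"
  shows "integrable M (\<lambda>x. f (\<omega> 0 x i)) \<longleftrightarrow> integrable (measure_pmf (geometric_pmf (1 - \<gamma>))) f"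
    and "expectation (\<lambda>x. f (\<omega> 0 x i)) = measure_pmf.expectation (geometric_pmf (1 - \<gamma>)) f"
  unfolding distr_\<omega>0[of i, symmetric]
  by (simp_all add: integrable_distr_eq integral_distr)

lemma \<omega>0_moments:
  shows "integrable M (\<lambda>x. real (\<omega> 0 x i))" and "expectation (\<lambda>x. real (\<omega> 0 x i)) = \<rho>"
    and "integrable M (\<lambda>x. (real (\<omega> 0 x i))\<^sup>2)"
proof -
  have "expectation (\<lambda>x. real (\<omega> 0 x i)) = \<gamma> / (1 - \<gamma>)"
    using integral_\<omega>0(2)[of real i] expectation_geometric_pmf[of "1 - \<gamma>"] \<gamma>(1,2) by simp
  then show "expectation (\<lambda>x. real (\<omega> 0 x i)) = \<rho>" using \<gamma>(4) by simp
  show "integrable M (\<lambda>x. real (\<omega> 0 x i))"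
    unfolding integral_\<omega>0(1)[of real] using integrable_real_geometric_pmf[of "1 - \<gamma>"] \<gamma>(1,2) by simp
  \<comment> \<open>With this choice \<open>\<gamma> * exp u\<close> is the square root of \<gamma>,
    so the exponential moment at \<open>u\<close> is finite and dominates the second moment.\<close>
  define u where "u = - ln \<gamma> / 2"
  have u: "0 < u" using \<gamma>(1,2) by (simp add: u_def)
  have "exp (ln \<gamma> + u) < 1" using \<gamma>(1,2) by (simp add: u_def)
  then have \<gamma>u: "\<gamma> * exp u < 1" using \<gamma>(1) by (simp add: exp_add)
  have 1: "(\<integral>\<^sup>+x. ennreal (exp (- u * real_of_int (h (i - 1 + 1) 0 x - h (i - 1) 0 x))) \<partial>M)
      \<le> ennreal ((1 - \<gamma>) / (1 - \<gamma> * exp u))"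
    using initial_mgf[of 1 u "i - 1"] \<gamma>u by simp
  have "integrable M (\<lambda>x. exp (- u * real_of_int (h (i - 1 + 1) 0 x - h (i - 1) 0 x)))"
    by (rule integrable_of_nn_integral_le(1)[OF _ _ 1]) (use \<gamma>u \<gamma>(2) in auto)
  then have int: "integrable M (\<lambda>x. 2 / u\<^sup>2 * exp (- u * real_of_int (h i 0 x - h (i - 1) 0 x)))"
    by simp
  show "integrable M (\<lambda>x. (real (\<omega> 0 x i))\<^sup>2)"
  proof (rule Bochner_Integration.integrable_bound[OF int])
    show "AE x in M. norm ((real (\<omega> 0 x i))\<^sup>2) \<le> norm (2 / u\<^sup>2 * exp (- u * real_of_int (h i 0 x - h (i - 1) 0 x)))"
      using AE_paths
    proof eventually_elim
      case (elim x)
      define w where "w = real (\<omega> 0 x i)"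
      have "h (i - 1) 0 x - h i 0 x = int (\<omega> 0 x i)" using elim by blast
      then have w: "real_of_int (h i 0 x - h (i - 1) 0 x) = - w"
        unfolding w_def by (metis minus_diff_eq of_int_minus of_int_of_nat_eq)
      have "(u * w)\<^sup>2 / 2 \<le> exp (u * w)"
      proof -
        have "0 \<le> u * w" using u by (simp add: w_def)
        then show ?thesis using exp_lower_Taylor_quadratic[of "u * w"] by linarith
      qed
      then have "w\<^sup>2 \<le> 2 / u\<^sup>2 * exp (u * w)"
        using u by (simp add: field_simps power2_eq_square)
      then show ?case unfolding w by (simp add: w_def)
    qed
  qed simp
qed

lemma variance_\<omega>0: "variance (\<lambda>x. real (\<omega> 0 x i)) = variance (\<lambda>x. real (\<omega> 0 x 0))"
  unfolding \<omega>0_moments(2)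
  using integral_\<omega>0(2)[of "\<lambda>n. (real n - \<rho>)\<^sup>2" i] integral_\<omega>0(2)[of "\<lambda>n. (real n - \<rho>)\<^sup>2" 0] by simp

lemma sum_\<omega>0_moments:
  assumes "finite I"
  shows "integrable M (\<lambda>x. \<Sum>i\<in>I. real (\<omega> 0 x i))"
    and "expectation (\<lambda>x. \<Sum>i\<in>I. real (\<omega> 0 x i)) = card I * \<rho>"
    and "integrable M (\<lambda>x. (\<Sum>i\<in>I. real (\<omega> 0 x i))\<^sup>2)"
    and "variance (\<lambda>x. \<Sum>i\<in>I. real (\<omega> 0 x i)) = card I * variance (\<lambda>x. real (\<omega> 0 x 0))"
proof -
  define X where "X = (\<lambda>i x. real (\<omega> 0 x i) - \<rho>)"
  define S where "S = (\<lambda>x. \<Sum>i\<in>I. X i x)"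
  have [measurable]: "X i \<in> borel_measurable M" for i by (simp add: X_def)
  show "integrable M (\<lambda>x. \<Sum>i\<in>I. real (\<omega> 0 x i))"
    and E: "expectation (\<lambda>x. \<Sum>i\<in>I. real (\<omega> 0 x i)) = card I * \<rho>"
    using \<omega>0_moments by simp_all
  have iX: "integrable M (X i)" "expectation (X i) = 0" "integrable M (\<lambda>x. X i x * X i x)" for i
    unfolding X_def using \<omega>0_moments[of i]
    by (simp_all add: prob_space power2_diff flip: power2_eq_square)
  have ind: "indep_vars (\<lambda>_. borel) X UNIV"
    unfolding X_def by (rule indep_vars_compose2[OF indep_\<omega>0]) auto
  have prod: "integrable M (\<lambda>x. X i x * X i' x) \<and>
      expectation (\<lambda>x. X i x * X i' x) = (if i = i' then variance (\<lambda>x. real (\<omega> 0 x 0)) else 0)" for i i'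
  proof (cases "i = i'")
    case True
    have "expectation (\<lambda>x. X i x * X i x) = variance (\<lambda>x. real (\<omega> 0 x i))"
      by (simp add: X_def \<omega>0_moments(2) power2_eq_square)
    then show ?thesis using iX True variance_\<omega>0[of i] by simp
  next
    case False
    have ind': "indep_vars (\<lambda>_. borel) X {i, i'}" by (rule indep_vars_subset[OF ind]) auto
    have "integrable M (\<lambda>x. \<Prod>q\<in>{i, i'}. X q x)"
      by (rule indep_vars_integrable[OF _ ind']) (auto simp: iX)
    moreover have "expectation (\<lambda>x. \<Prod>q\<in>{i, i'}. X q x) = (\<Prod>q\<in>{i, i'}. expectation (X q))"
      by (rule indep_vars_lebesgue_integral[OF _ ind']) (auto simp: iX)
    ultimately show ?thesis using False by (simp add: iX(2))
  qed
  have S2: "(S x)\<^sup>2 = (\<Sum>i\<in>I. \<Sum>i'\<in>I. X i x * X i' x)" for x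
    by (simp add: S_def power2_eq_square sum_product)
  have iS2: "integrable M (\<lambda>x. (S x)\<^sup>2)" unfolding S2 using prod by auto
  have iS: "integrable M S" unfolding S_def using iX by auto
  have ES2: "expectation (\<lambda>x. (S x)\<^sup>2) = card I * variance (\<lambda>x. real (\<omega> 0 x 0))"
    unfolding S2 using prod assms by (simp add: sum.delta)
  have Seq: "(\<Sum>i\<in>I. real (\<omega> 0 x i)) = S x + card I * \<rho>" for x
    by (simp add: S_def X_def sum_subtractf)
  show "integrable M (\<lambda>x. (\<Sum>i\<in>I. real (\<omega> 0 x i))\<^sup>2)"
    unfolding Seq power2_sum using iS iS2 by auto
  show "variance (\<lambda>x. \<Sum>i\<in>I. real (\<omega> 0 x i)) = card I * variance (\<lambda>x. real (\<omega> 0 x 0))"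
    unfolding E ES2[symmetric] by (simp add: Seq)
qed

lemma initial_height_moments:
  shows "integrable M (\<lambda>x. real_of_int (h j 0 x))"
    and "expectation (\<lambda>x. real_of_int (h j 0 x)) = - real_of_int j * \<rho>"
    and "integrable M (\<lambda>x. (real_of_int (h j 0 x))\<^sup>2)"
    and "variance (\<lambda>x. real_of_int (h j 0 x)) = \<bar>real_of_int j\<bar> * variance (\<lambda>x. real (\<omega> 0 x 0))"
proof -
  define I where "I = (if 0 \<le> j then {0<..j} else {j<..0})"
  define c :: real where "c = (if 0 \<le> j then -1 else 1)"
  define S where "S = (\<lambda>x. \<Sum>i\<in>I. real (\<omega> 0 x i))"
  have I: "finite I" "card I = nat \<bar>j\<bar>" by (auto simp: I_def)
  have c2: "c * c = 1" by (simp add: c_def)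
  have S: "integrable M S" "expectation S = card I * \<rho>" "integrable M (\<lambda>x. (S x)\<^sup>2)"
     "variance S = card I * variance (\<lambda>x. real (\<omega> 0 x 0))"
    unfolding S_def by (rule sum_\<omega>0_moments[OF I(1)])+
  have [measurable]: "S \<in> borel_measurable M" by (simp add: S_def)
  have [measurable]: "(\<lambda>x. real_of_int (h j 0 x)) \<in> borel_measurable M" by simp
  have ae: "AE x in M. real_of_int (h j 0 x) = c * S x"
    using AE_paths
  proof eventually_elim
    case (elim x)
    have "hts (\<omega> 0 x) j = h j 0 x"
    proof (rule hts_eqI[of "min j 0" "max j 0" "\<lambda>i. h i 0 x"])
      show "h (i - 1) 0 x - h i 0 x = int (\<omega> 0 x i)" for i using elim by blast
      show "h 0 0 x = 0" using elim by blast
    qed auto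
    then show ?case by (auto simp: hts_def S_def c_def I_def simp flip: \<open>hts (\<omega> 0 x) j = h j 0 x\<close>)
  qed
  show "integrable M (\<lambda>x. real_of_int (h j 0 x))"
    using S(1) by (subst integrable_cong_AE[OF _ _ ae]) auto
  have cI: "c * card I = - real_of_int j" by (auto simp: c_def I(2))
  have E: "expectation (\<lambda>x. real_of_int (h j 0 x)) = c * (card I * \<rho>)"
    by (subst integral_cong_AE[OF _ _ ae]) (auto simp: S(2))
  then show "expectation (\<lambda>x. real_of_int (h j 0 x)) = - real_of_int j * \<rho>"
    using cI by (metis mult.assoc)
  have ae2: "AE x in M. (real_of_int (h j 0 x))\<^sup>2 = (S x)\<^sup>2"
    using ae by eventually_elim (simp add: power_mult_distrib power2_eq_square[of c] c2)
  show "integrable M (\<lambda>x. (real_of_int (h j 0 x))\<^sup>2)"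
    using S(3) by (subst integrable_cong_AE[OF _ _ ae2]) auto
  have ae3: "AE x in M. (real_of_int (h j 0 x) - c * (card I * \<rho>))\<^sup>2 = (S x - card I * \<rho>)\<^sup>2"
    using ae
  proof eventually_elim
    case (elim x)
    have "(c * S x - c * (card I * \<rho>))\<^sup>2 = c * c * (S x - card I * \<rho>)\<^sup>2"
      by (simp add: power2_eq_square algebra_simps)
    then show ?case unfolding elim c2 by simp
  qed
  have "variance (\<lambda>x. real_of_int (h j 0 x)) = variance S"
    unfolding E S(2) by (rule integral_cong_AE[OF _ _ ae3]) auto
  then show "variance (\<lambda>x. real_of_int (h j 0 x)) = \<bar>real_of_int j\<bar> * variance (\<lambda>x. real (\<omega> 0 x 0))"
    using S(4) I(2) by simp
qed


text \<open>The mean is obtained from the exponential bound: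
  \<open>1 + \<theta> * J \<le> exp (\<theta> * J)\<close> bounds it by a difference quotient whose
  limit at 0 from the right is \<open>\<gamma> * t\<close>. An upper bound is all that the one-sided
  condition on the mean of \<open>Y\<close> asks for.\<close>

lemma jump_mean:
  assumes t: "0 < t"
  shows "integrable M (\<lambda>x. real_of_int (h j t x - h j 0 x))"
    and "expectation (\<lambda>x. real_of_int (h j t x - h j 0 x)) \<le> \<gamma> * t"
proof -
  define J where "J = (\<lambda>x. real_of_int (h j t x - h j 0 x))"
  have t0: "0 \<le> t" using t by simp
  have [measurable]: "J \<in> borel_measurable M"
    unfolding J_def using h_measurable[OF t0, of j] h_measurable[of 0 j] by measurable
  have J0: "AE x in M. 0 \<le> J x"
    using AE_paths
  proof eventually_elim
    case (elim x)
    have "h j t x = h j 0 x + int (card (jump_times (\<lambda>s. N j s x) (\<lambda>s. \<omega> s x) j t))"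
      using elim t0 by blast
    then show ?case by (simp add: J_def)
  qed
  define u where "u = - ln \<gamma> / 2"
  have u: "0 < u" using \<gamma>(1,2) by (simp add: u_def)
  have mgf: "integrable M (\<lambda>x. exp (\<theta> * J x))" "expectation (\<lambda>x. exp (\<theta> * J x)) \<le> exp (\<gamma> * (exp \<theta> - 1) * t)"
    if \<theta>: "\<theta> \<le> u" for \<theta>
  proof -
    have "ln \<gamma> < 0" using \<gamma>(1,2) by simp
    then have "exp (ln \<gamma> + \<theta>) < 1" using \<theta> by (simp add: u_def)
    then have "\<gamma> * exp \<theta> < 1" using \<gamma>(1) by (simp add: exp_add)
    then have *: "(\<integral>\<^sup>+x. ennreal (exp (\<theta> * J x)) \<partial>M) \<le> ennreal (exp (\<gamma> * (exp \<theta> - 1) * t))"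
      unfolding J_def by (rule jump_mgf_le[OF t])
    show "integrable M (\<lambda>x. exp (\<theta> * J x))" "expectation (\<lambda>x. exp (\<theta> * J x)) \<le> exp (\<gamma> * (exp \<theta> - 1) * t)"
      by (rule integrable_of_nn_integral_le[OF _ _ *]; simp)+
  qed
  have int: "integrable M J"
  proof (rule Bochner_Integration.integrable_bound)
    show "integrable M (\<lambda>x. exp (u * J x) / u)" using mgf(1)[of u] by simp
    show "AE x in M. norm (J x) \<le> norm (exp (u * J x) / u)"
      using J0
    proof eventually_elim
      case (elim x)
      have "u * J x \<le> exp (u * J x)" using exp_ge_add_one_self[of "u * J x"] by linarith
      then show ?case using u elim by (simp add: field_simps)
    qed
  qed simp
  then show "integrable M (\<lambda>x. real_of_int (h j t x - h j 0 x))" by (simp add: J_def)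
  have "expectation J \<le> (exp (\<gamma> * (exp \<theta> - 1) * t) - 1) / \<theta>" if \<theta>: "0 < \<theta>" "\<theta> < u" for \<theta>
  proof -
    have "expectation (\<lambda>x. 1 + \<theta> * J x) \<le> expectation (\<lambda>x. exp (\<theta> * J x))"
      using int mgf(1)[of \<theta>] \<theta> by (intro integral_mono) (auto simp: exp_ge_add_one_self)
    also have "\<dots> \<le> exp (\<gamma> * (exp \<theta> - 1) * t)" using mgf(2)[of \<theta>] \<theta> by simp
    finally show ?thesis using \<theta> int by (simp add: prob_space field_simps)
  qed
  then have "\<forall>\<^sub>F \<theta> in at_right 0. expectation J \<le> (exp (\<gamma> * (exp \<theta> - 1) * t) - 1) / \<theta>"
    using u by (auto simp: eventually_at_right_field)
  moreover have "((\<lambda>\<theta>. (exp (\<gamma> * (exp \<theta> - 1) * t) - 1) / \<theta>) \<longlongrightarrow> \<gamma> * t) (at_right 0)"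
    by real_asymp
  ultimately have "expectation J \<le> \<gamma> * t"
    by (intro tendsto_lowerbound) auto
  then show "expectation (\<lambda>x. real_of_int (h j t x - h j 0 x)) \<le> \<gamma> * t" by (simp add: J_def)
qed

section \<open>The increment along the characteristic\<close>

definition shift :: "real \<Rightarrow> int" where
  "shift t = \<lfloor>char_speed \<rho> * t\<rfloor>"

text \<open>The centring adds the Poisson mean \<open>\<gamma> * t\<close> of the jumps to the mean
  of the initial height difference. It uses the integer \<open>shift t\<close> itself, so that
  rounding enters the exponents only through the limit of \<open>shift t / t\<close>.\<close>

definition dev :: "int \<Rightarrow> real \<Rightarrow> 'a \<Rightarrow> real" where
  "dev j t x = real_of_int (h (j + shift t) t x - h j 0 x) - (\<gamma> * t - real_of_int (shift t) * \<rho>)"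

lemma char_speed_pos: "0 < char_speed \<rho>"
  using rho by (simp add: char_speed_def)

lemma shift_nonneg: "0 < t \<Longrightarrow> 0 \<le> shift t"
  using char_speed_pos by (simp add: shift_def)

lemma shift_limit: "((\<lambda>t. real_of_int (shift t) / t) \<longlongrightarrow> char_speed \<rho>) at_top"
  unfolding shift_def using char_speed_pos by real_asymp

lemma dev_measurable [measurable]: "0 < t \<Longrightarrow> dev j t \<in> borel_measurable M"
  unfolding dev_def using h_measurable[of t "j + shift t"] h_measurable[of 0 j] by simp

lemma dev_mean_le:
  assumes t: "0 < t"
  shows "expectation (dev j t) \<le> 0"
proof -
  let ?k = "shift t"
  have eq: "dev j t = (\<lambda>x. real_of_int (h (j + ?k) t x - h (j + ?k) 0 x)
      + (real_of_int (h (j + ?k) 0 x) - real_of_int (h j 0 x)) - (\<gamma> * t - real_of_int ?k * \<rho>))"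
    by (simp add: dev_def fun_eq_iff)
  note int = jump_mean(1)[OF t, of "j + ?k"] initial_height_moments(1)[of "j + ?k"] initial_height_moments(1)[of j]
  have "expectation (dev j t) = expectation (\<lambda>x. real_of_int (h (j + ?k) t x - h (j + ?k) 0 x))
      + (expectation (\<lambda>x. real_of_int (h (j + ?k) 0 x)) - expectation (\<lambda>x. real_of_int (h j 0 x)))
      - (\<gamma> * t - real_of_int ?k * \<rho>)"
    unfolding eq using int by (simp only: Bochner_Integration.integral_diff Bochner_Integration.integral_add
        Bochner_Integration.integrable_diff Bochner_Integration.integrable_add integrable_const) (simp add: prob_space)
  also have "\<dots> \<le> \<gamma> * t + (- real_of_int ?k * \<rho>) - (\<gamma> * t - real_of_int ?k * \<rho>)"
    using jump_mean(2)[OF t, of "j + ?k"] unfolding initial_height_moments(2)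
    by (simp add: algebra_simps)
  finally show "expectation (dev j t) \<le> 0" by simp
qed

lemma \<gamma>_ratio: "(1 - \<gamma> * y) / (1 - \<gamma>) = 1 + \<rho> * (1 - y)"
  using rho by (simp add: \<gamma>_def field_simps)

text \<open>This is where the characteristic speed is singled out: as the derivative of the flux
  \<open>\<rho> / (1 + \<rho>)\<close>, it makes the variance
  \<open>char_speed \<rho> * (\<rho> + \<rho>\<^sup>2)\<close> per unit time of the initial height
  equal to the variance \<gamma> of the Poisson departures.\<close>

lemma \<gamma>_cancel: "\<gamma> * (s\<^sup>2 / 2) + char_speed \<rho> * (- ((\<rho> + \<rho>\<^sup>2) * s\<^sup>2 / 2)) = 0"
proof -
  have "char_speed \<rho> * (\<rho> + \<rho>\<^sup>2) = \<gamma>"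
  proof -
    have "\<rho> + \<rho>\<^sup>2 = \<rho> * (1 + \<rho>)" by (simp add: power2_eq_square distrib_left)
    then show ?thesis
      unfolding char_speed_def \<gamma>_def using rho by (simp add: power2_eq_square)
  qed
  moreover have "char_speed \<rho> * ((\<rho> + \<rho>\<^sup>2) * s\<^sup>2 / 2) = char_speed \<rho> * (\<rho> + \<rho>\<^sup>2) * (s\<^sup>2 / 2)"
    by simp
  ultimately have "char_speed \<rho> * ((\<rho> + \<rho>\<^sup>2) * s\<^sup>2 / 2) = \<gamma> * (s\<^sup>2 / 2)" by (simp only:)
  then show ?thesis by (simp only: mult_minus_right right_minus)
qed

lemma eventually_tilt_subcritical: "0 < s \<Longrightarrow> \<forall>\<^sub>F t in at_top. 0 < t \<and> \<gamma> * exp (s / sqrt t) < 1"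
proof -
  assume s: "0 < s"
  have "((\<lambda>t. \<gamma> * exp (s / sqrt t)) \<longlongrightarrow> \<gamma>) at_top" by real_asymp
  then have "\<forall>\<^sub>F t in at_top. \<gamma> * exp (s / sqrt t) < 1"
    using \<gamma>(2) by (rule order_tendstoD(2))
  then show ?thesis using eventually_gt_at_top[of 0] by eventually_elim auto
qed

text \<open>In both exponents the centring removes the first order in \<open>s / sqrt t\<close> and
  \<open>\<gamma>_cancel\<close> the second, so the bound tends to 2 and 3 leaves room. Uniformity
  in \<open>j\<close> is needed because the starting point later varies with
  \<open>t\<close>.\<close>

lemma dev_lower_mgf:
  assumes s: "0 < s"
  shows "\<forall>\<^sub>F t in at_top. \<forall>j. (\<integral>\<^sup>+x. ennreal (exp (- s * (dev j t x / sqrt t))) \<partial>M) \<le> ennreal 3"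
proof -
  \<comment> \<open>\<open>e1\<close> and \<open>e2\<close> are the logarithms of the two terms of
    \<open>lower_tail_mgf_le\<close> after centring, grouped so that each factor has a known
    limit.\<close>
  define e1 where "e1 = (\<lambda>t. \<gamma> * (t * (s / sqrt t + exp (- (s / sqrt t)) - 1))
      + real_of_int (shift t) / t * (t * (ln (1 + \<rho> * (1 - exp (- (s / sqrt t)))) - \<rho> * (s / sqrt t))))"
  define e2 where "e2 = (\<lambda>t. - (\<gamma> * (t * (exp (s / sqrt t) - 1 - s / sqrt t))
      + real_of_int (shift t) / t * (t * (ln (1 + \<rho> * (1 - exp (s / sqrt t))) + \<rho> * (s / sqrt t)))))"
  have "(e1 \<longlongrightarrow> \<gamma> * (s\<^sup>2 / 2) + char_speed \<rho> * (- ((\<rho> + \<rho>\<^sup>2) * s\<^sup>2 / 2))) at_top"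
    unfolding e1_def by (intro tendsto_intros shift_limit poisson_exponent_limits geometric_exponent_limits rho s)
  moreover have "(e2 \<longlongrightarrow> - (\<gamma> * (s\<^sup>2 / 2) + char_speed \<rho> * (- ((\<rho> + \<rho>\<^sup>2) * s\<^sup>2 / 2)))) at_top"
    unfolding e2_def by (intro tendsto_intros shift_limit poisson_exponent_limits geometric_exponent_limits rho s)
  ultimately have "((\<lambda>t. exp (e1 t) + exp (e2 t)) \<longlongrightarrow> exp 0 + exp 0) at_top"
    unfolding \<gamma>_cancel by (intro tendsto_intros) simp_all
  then have "\<forall>\<^sub>F t in at_top. exp (e1 t) + exp (e2 t) < 3"
    by (intro order_tendstoD(2)) auto
  then show ?thesis using eventually_tilt_subcritical[OF s]
  proof eventually_elim
    case (elim t)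
    define \<epsilon> where "\<epsilon> = s / sqrt t"
    define k where "k = shift t"
    define m where "m = \<gamma> * t - real_of_int k * \<rho>"
    have t: "0 < t" and \<epsilon>: "0 \<le> \<epsilon>" "\<gamma> * exp \<epsilon> < 1" using elim s by (auto simp: \<epsilon>_def)
    have k: "0 \<le> k" "real (nat k) = real_of_int k" using shift_nonneg[OF t] by (auto simp: k_def)
    have p1: "0 < 1 + \<rho> * (1 - exp (- \<epsilon>))" using rho \<epsilon>(1) by (simp add: add_pos_nonneg)
    have p2: "0 < 1 + \<rho> * (1 - exp \<epsilon>)"
      unfolding \<gamma>_ratio[symmetric] using \<epsilon>(2) \<gamma>(2) by simp
    have E1: "exp (\<epsilon> * m) * (((1 - \<gamma> * exp (- \<epsilon>)) / (1 - \<gamma>)) ^ nat k * exp (\<gamma> * (exp (- \<epsilon>) - 1) * t)) = exp (e1 t)"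
      unfolding \<gamma>_ratio power_eq_exp_ln[OF p1] k(2) exp_add[symmetric]
    proof -
      have "e1 t = \<gamma> * (t * (\<epsilon> + exp (- \<epsilon>) - 1)) + real_of_int k * (ln (1 + \<rho> * (1 - exp (- \<epsilon>))) - \<rho> * \<epsilon>)"
        using t unfolding e1_def \<epsilon>_def k_def by simp
      then show "exp (\<epsilon> * m + (real_of_int k * ln (1 + \<rho> * (1 - exp (- \<epsilon>))) + \<gamma> * (exp (- \<epsilon>) - 1) * t)) = exp (e1 t)"
        by (simp add: m_def algebra_simps)
    qed
    have "(1 - \<gamma>) / (1 - \<gamma> * exp \<epsilon>) = inverse (1 + \<rho> * (1 - exp \<epsilon>))"
      unfolding \<gamma>_ratio[symmetric] by simp
    then have pw: "((1 - \<gamma>) / (1 - \<gamma> * exp \<epsilon>)) ^ nat k = exp (- (real_of_int k * ln (1 + \<rho> * (1 - exp \<epsilon>))))"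
      using power_eq_exp_ln[OF p2, of "nat k"] k(2) by (simp add: power_inverse exp_minus)
    have E2: "exp (\<epsilon> * m) * (((1 - \<gamma>) / (1 - \<gamma> * exp \<epsilon>)) ^ nat k * exp (\<gamma> * (1 - exp \<epsilon>) * t)) = exp (e2 t)"
    proof -
      have "e2 t = - (\<gamma> * (t * (exp \<epsilon> - 1 - \<epsilon>)) + real_of_int k * (ln (1 + \<rho> * (1 - exp \<epsilon>)) + \<rho> * \<epsilon>))"
        using t unfolding e2_def \<epsilon>_def k_def by simp
      then have "e2 t = \<epsilon> * m + (- (real_of_int k * ln (1 + \<rho> * (1 - exp \<epsilon>))) + \<gamma> * (1 - exp \<epsilon>) * t)"
        by (simp add: m_def algebra_simps)
      then show ?thesis
        using pw by (simp only: exp_add)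
    qed
    show ?case
    proof
      fix j
      have "(\<integral>\<^sup>+x. ennreal (exp (- s * (dev j t x / sqrt t))) \<partial>M)
         = (\<integral>\<^sup>+x. ennreal (exp (\<epsilon> * m)) * ennreal (exp (- \<epsilon> * real_of_int (h (j + k) t x - h j 0 x))) \<partial>M)"
      proof (rule nn_integral_cong)
        fix x
        have "- s * (dev j t x / sqrt t) = - \<epsilon> * dev j t x" by (simp add: \<epsilon>_def)
        also have "\<dots> = \<epsilon> * m + - \<epsilon> * real_of_int (h (j + k) t x - h j 0 x)"
          unfolding dev_def m_def k_def by (simp add: algebra_simps)
        finally have eq: "- s * (dev j t x / sqrt t) = \<epsilon> * m + - \<epsilon> * real_of_int (h (j + k) t x - h j 0 x)" .
        show "ennreal (exp (- s * (dev j t x / sqrt t)))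
            = ennreal (exp (\<epsilon> * m)) * ennreal (exp (- \<epsilon> * real_of_int (h (j + k) t x - h j 0 x)))"
          unfolding eq exp_add by (rule ennreal_mult) simp_all
      qed
      also have "\<dots> = ennreal (exp (\<epsilon> * m)) * (\<integral>\<^sup>+x. ennreal (exp (- \<epsilon> * real_of_int (h (j + k) t x - h j 0 x))) \<partial>M)"
        using h_measurable[of t "j + k"] h_measurable[of 0 j] t by (intro nn_integral_cmult) simp
      also have "\<dots> \<le> ennreal (exp (\<epsilon> * m)) * ennreal (((1 - \<gamma> * exp (- \<epsilon>)) / (1 - \<gamma>)) ^ nat k * exp (\<gamma> * (exp (- \<epsilon>) - 1) * t)
        + ((1 - \<gamma>) / (1 - \<gamma> * exp \<epsilon>)) ^ nat k * exp (\<gamma> * (1 - exp \<epsilon>) * t))"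
        by (intro mult_left_mono lower_tail_mgf_le t k \<epsilon>) simp
      also have "\<dots> = ennreal (exp (e1 t) + exp (e2 t))"
        unfolding E1[symmetric] E2[symmetric] distrib_left[symmetric] by (subst ennreal_mult') auto
      also have "\<dots> \<le> ennreal 3" using elim by (intro ennreal_leI) simp
      finally show "(\<integral>\<^sup>+x. ennreal (exp (- s * (dev j t x / sqrt t))) \<partial>M) \<le> ennreal 3" .
    qed
  qed
qed

text \<open>Only boundedness is wanted here, so the jumps and the initial height difference, which
  are dependent, are separated by \<open>exp (p + q) \<le> (exp (2 * p) + exp (2 * q)) / 2\<close>.
  The doubling explains the tilt \<open>2 / sqrt t\<close>; both exponents tend to
  \<open>2 * \<gamma>\<close>, and 1 is slack.\<close>

lemma dev_upper_mgf:
  "\<forall>\<^sub>F t in at_top. \<forall>j. (\<integral>\<^sup>+x. ennreal (exp (dev j t x / sqrt t)) \<partial>M) \<le> ennreal (exp (2 * \<gamma>) + 1)"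
proof -
  define e1 where "e1 = (\<lambda>t. \<gamma> * (t * (exp (2 / sqrt t) - 1 - 2 / sqrt t)))"
  define e2 where "e2 = (\<lambda>t. - (real_of_int (shift t) / t *
      (t * (ln (1 + \<rho> * (1 - exp (- (2 / sqrt t)))) - \<rho> * (2 / sqrt t)))))"
  have "(e1 \<longlongrightarrow> \<gamma> * (2\<^sup>2 / 2)) at_top"
    unfolding e1_def by (intro tendsto_intros poisson_exponent_limits geometric_exponent_limits rho) simp
  then have "(e1 \<longlongrightarrow> 2 * \<gamma>) at_top" by (simp add: mult.commute)
  moreover have "(e2 \<longlongrightarrow> - (char_speed \<rho> * (- ((\<rho> + \<rho>\<^sup>2) * 2\<^sup>2 / 2)))) at_top"
    unfolding e2_def by (intro tendsto_intros shift_limit poisson_exponent_limits geometric_exponent_limits rho) simp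
  moreover have "- (char_speed \<rho> * (- ((\<rho> + \<rho>\<^sup>2) * 2\<^sup>2 / 2))) = 2 * \<gamma>"
    using \<gamma>_cancel[of 2] by simp
  ultimately have "((\<lambda>t. (exp (e1 t) + exp (e2 t)) / 2) \<longlongrightarrow> (exp (2 * \<gamma>) + exp (2 * \<gamma>)) / 2) at_top"
    by (intro tendsto_intros) simp_all
  then have "\<forall>\<^sub>F t in at_top. (exp (e1 t) + exp (e2 t)) / 2 < exp (2 * \<gamma>) + 1"
    by (intro order_tendstoD(2)) auto
  then show ?thesis using eventually_tilt_subcritical[of 2, simplified]
  proof eventually_elim
    case (elim t)
    define \<epsilon> where "\<epsilon> = 2 / sqrt t"
    define k where "k = shift t"
    have t: "0 < t" and \<epsilon>: "0 \<le> \<epsilon>" "\<gamma> * exp \<epsilon> < 1" using elim by (auto simp: \<epsilon>_def)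
    have "\<gamma> * exp (- \<epsilon>) \<le> \<gamma> * 1" using \<gamma>(1) \<epsilon>(1) by (intro mult_left_mono) auto
    then have \<epsilon>': "\<gamma> * exp (- \<epsilon>) < 1" using \<gamma>(2) by linarith
    have k: "0 \<le> k" "real (nat k) = real_of_int k" using shift_nonneg[OF t] by (auto simp: k_def)
    have p1: "0 < 1 + \<rho> * (1 - exp (- \<epsilon>))" using rho \<epsilon>(1) by (simp add: add_pos_nonneg)
    show ?case
    proof
      fix j
      define a where "a = (\<lambda>x. \<epsilon> * real_of_int (h (j + k) t x - h (j + k) 0 x))"
      define b where "b = (\<lambda>x. \<epsilon> * real_of_int (h (j + k) 0 x - h j 0 x))"
      have [measurable]: "a \<in> borel_measurable M" "b \<in> borel_measurable M"
        unfolding a_def b_def using h_measurable[of t "j + k"] h_measurable[of 0 "j + k"] h_measurable[of 0 j] t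
        by simp_all
      have "(\<integral>\<^sup>+x. ennreal (exp (dev j t x / sqrt t)) \<partial>M)
        \<le> (\<integral>\<^sup>+x. ennreal (exp (- \<epsilon> * (\<gamma> * t)) / 2) * ennreal (exp (a x))
              + ennreal (exp (\<epsilon> * (k * \<rho>)) / 2) * ennreal (exp (b x)) \<partial>M)"
      proof (rule nn_integral_mono)
        fix x
        define p where "p = (a x - \<epsilon> * (\<gamma> * t)) / 2"
        define q where "q = (b x + \<epsilon> * (k * \<rho>)) / 2"
        have "dev j t x / sqrt t = \<epsilon> * dev j t x / 2" by (simp add: \<epsilon>_def)
        also have "\<dots> = p + q"
          by (simp add: dev_def p_def q_def a_def b_def k_def algebra_simps add_divide_distrib diff_divide_distrib)
        finally have "dev j t x / sqrt t = p + q" .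
        moreover have "exp (p + q) \<le> (exp (2 * p) + exp (2 * q)) / 2"
        proof -
          have d: "exp (2 * p) = exp p * exp p" "exp (2 * q) = exp q * exp q"
            by (simp_all flip: exp_add)
          show ?thesis
            using zero_le_power2[of "exp p - exp q"] unfolding d exp_add
            by (simp add: power2_eq_square algebra_simps)
        qed
        ultimately have "exp (dev j t x / sqrt t) \<le> exp (- \<epsilon> * (\<gamma> * t)) / 2 * exp (a x) + exp (\<epsilon> * (k * \<rho>)) / 2 * exp (b x)"
        proof -
          have "exp (2 * p) = exp (- \<epsilon> * (\<gamma> * t)) * exp (a x)" "exp (2 * q) = exp (\<epsilon> * (k * \<rho>)) * exp (b x)"
            by (simp_all add: p_def q_def add.commute flip: exp_add)
          then show ?thesis
            using \<open>dev j t x / sqrt t = p + q\<close> \<open>exp (p + q) \<le> (exp (2 * p) + exp (2 * q)) / 2\<close>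
            by (simp add: add_divide_distrib)
        qed
        then show "ennreal (exp (dev j t x / sqrt t)) \<le> ennreal (exp (- \<epsilon> * (\<gamma> * t)) / 2) * ennreal (exp (a x))
              + ennreal (exp (\<epsilon> * (k * \<rho>)) / 2) * ennreal (exp (b x))"
          by (simp add: ennreal_leI flip: ennreal_mult ennreal_plus)
      qed
      also have "\<dots> = ennreal (exp (- \<epsilon> * (\<gamma> * t)) / 2) * (\<integral>\<^sup>+x. ennreal (exp (a x)) \<partial>M)
          + ennreal (exp (\<epsilon> * (k * \<rho>)) / 2) * (\<integral>\<^sup>+x. ennreal (exp (b x)) \<partial>M)"
        by (simp add: nn_integral_add nn_integral_cmult)
      also have "\<dots> \<le> ennreal (exp (- \<epsilon> * (\<gamma> * t)) / 2) * ennreal (exp (\<gamma> * (exp \<epsilon> - 1) * t))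
          + ennreal (exp (\<epsilon> * (k * \<rho>)) / 2) * ennreal (((1 - \<gamma>) / (1 - \<gamma> * exp (- \<epsilon>))) ^ nat k)"
      proof (intro add_mono mult_left_mono)
        show "(\<integral>\<^sup>+x. ennreal (exp (a x)) \<partial>M) \<le> ennreal (exp (\<gamma> * (exp \<epsilon> - 1) * t))"
          unfolding a_def by (rule jump_mgf_le[OF t \<epsilon>(2)])
        show "(\<integral>\<^sup>+x. ennreal (exp (b x)) \<partial>M) \<le> ennreal (((1 - \<gamma>) / (1 - \<gamma> * exp (- \<epsilon>))) ^ nat k)"
          unfolding b_def using initial_mgf[OF k(1) \<epsilon>', of j] by simp
      qed auto
      also have "\<dots> = ennreal ((exp (e1 t) + exp (e2 t)) / 2)"
      proof -
        have 1: "exp (- \<epsilon> * (\<gamma> * t)) / 2 * exp (\<gamma> * (exp \<epsilon> - 1) * t) = exp (e1 t) / 2"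
        proof -
          have "e1 t = - \<epsilon> * (\<gamma> * t) + \<gamma> * (exp \<epsilon> - 1) * t"
            unfolding e1_def \<epsilon>_def[symmetric] by (simp add: algebra_simps)
          then show ?thesis by (simp only: exp_add)
        qed
        have "(1 - \<gamma>) / (1 - \<gamma> * exp (- \<epsilon>)) = inverse (1 + \<rho> * (1 - exp (- \<epsilon>)))"
          unfolding \<gamma>_ratio[symmetric] by simp
        then have pw: "((1 - \<gamma>) / (1 - \<gamma> * exp (- \<epsilon>))) ^ nat k = exp (- (real_of_int k * ln (1 + \<rho> * (1 - exp (- \<epsilon>)))))"
          using power_eq_exp_ln[OF p1, of "nat k"] k(2) by (simp add: power_inverse exp_minus)
        have 2: "exp (\<epsilon> * (k * \<rho>)) / 2 * ((1 - \<gamma>) / (1 - \<gamma> * exp (- \<epsilon>))) ^ nat k = exp (e2 t) / 2"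
        proof -
          have "e2 t = - (real_of_int k * (ln (1 + \<rho> * (1 - exp (- \<epsilon>))) - \<rho> * \<epsilon>))"
            using t unfolding e2_def \<epsilon>_def k_def by simp
          then have "e2 t = \<epsilon> * (k * \<rho>) + - (real_of_int k * ln (1 + \<rho> * (1 - exp (- \<epsilon>))))"
            by (simp add: algebra_simps)
          then show ?thesis
            using pw by (simp only: exp_add)
        qed
        have "0 \<le> ((1 - \<gamma>) / (1 - \<gamma> * exp (- \<epsilon>))) ^ nat k" using \<epsilon>' \<gamma>(2) by simp
        then have "ennreal (exp (- \<epsilon> * (\<gamma> * t)) / 2) * ennreal (exp (\<gamma> * (exp \<epsilon> - 1) * t))
          + ennreal (exp (\<epsilon> * (k * \<rho>)) / 2) * ennreal (((1 - \<gamma>) / (1 - \<gamma> * exp (- \<epsilon>))) ^ nat k)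
          = ennreal (exp (e1 t) / 2) + ennreal (exp (e2 t) / 2)"
          unfolding 1[symmetric] 2[symmetric] by (simp only: ennreal_mult[symmetric] exp_ge_zero divide_nonneg_nonneg zero_le_numeral)
        then show ?thesis by (simp add: add_divide_distrib flip: ennreal_plus)
      qed
      also have "\<dots> \<le> ennreal (exp (2 * \<gamma>) + 1)" using elim by (intro ennreal_leI) simp
      finally show "(\<integral>\<^sup>+x. ennreal (exp (dev j t x / sqrt t)) \<partial>M) \<le> ennreal (exp (2 * \<gamma>) + 1)" .
    qed
  qed
qed

lemma dev_second_moment:
  assumes \<eta>: "0 < \<eta>"
  shows "\<forall>\<^sub>F t in at_top. 0 < t \<and> (\<forall>j. integrable M (\<lambda>x. (dev j t x)\<^sup>2) \<and> expectation (\<lambda>x. (dev j t x)\<^sup>2) \<le> \<eta> * t)"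
proof -
  define B where "B = exp (2 * \<gamma>) + 1"
  have B: "0 \<le> B" by (simp add: B_def)
  \<comment> \<open>\<open>K\<close> makes the contribution of large values equal to
    \<open>\<eta> / 2\<close>, which is possible because \<open>B\<close> does not depend on
    \<open>s\<close>; afterwards \<open>s\<close> is taken large enough for the other term to be
    \<open>\<eta> / 2\<close> as well.\<close>
  define K where "K = sqrt (512 * (B + 3) / \<eta>)"
  have K: "0 < K" "256 * (B + 3) / K\<^sup>2 = \<eta> / 2"
  proof -
    define c where "c = B + 3"
    have "0 < c" using B by (simp add: c_def)
    then show "0 < K" "256 * (B + 3) / K\<^sup>2 = \<eta> / 2" using \<eta> by (simp_all add: K_def flip: c_def)
  qed
  define s where "s = 12 * K / \<eta>"
  have s: "0 < s" "6 * K / s = \<eta> / 2" using \<eta> K by (auto simp: s_def)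
  show ?thesis
    using dev_lower_mgf[OF s(1)] dev_lower_mgf[OF zero_less_one] dev_upper_mgf eventually_gt_at_top[of 0]
  proof eventually_elim
    case (elim t)
    have t: "0 < t" by fact
    show ?case
    proof (intro conjI allI t)
      fix j
      define Y where "Y = (\<lambda>x. dev j t x / sqrt t)"
      have [measurable]: "dev j t \<in> borel_measurable M" by (rule dev_measurable[OF t])
      have mean: "expectation Y \<le> 0"
        unfolding Y_def using dev_mean_le[OF t, of j] t by (simp add: divide_nonpos_pos)
      have Y: "Y \<in> borel_measurable M" by (simp add: Y_def)
      have m: "integrable M (\<lambda>x. (Y x)\<^sup>2)" "expectation (\<lambda>x. (Y x)\<^sup>2) \<le> 6 * K / s + 256 * (B + 3) / K\<^sup>2"
        by (rule second_moment_le_of_mgf[OF Y s(1) K(1) B _ _ _ mean]; use elim in \<open>simp add: Y_def B_def\<close>)+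
      have eq: "(dev j t x)\<^sup>2 = t * (Y x)\<^sup>2" for x
        using t by (simp add: Y_def power_divide)
      show "integrable M (\<lambda>x. (dev j t x)\<^sup>2)" unfolding eq using m(1) by simp
      have "expectation (\<lambda>x. (dev j t x)\<^sup>2) = t * expectation (\<lambda>x. (Y x)\<^sup>2)" unfolding eq by simp
      also have "\<dots> \<le> t * \<eta>"
        using m(2) t unfolding s(2) K(2) by (intro mult_left_mono) auto
      finally show "expectation (\<lambda>x. (dev j t x)\<^sup>2) \<le> \<eta> * t" by (simp add: mult.commute)
    qed
  qed
qed

lemma toward_zero_limit: "((\<lambda>t. real_of_int (toward_zero (V * t)) / t) \<longlongrightarrow> V) at_top"
proof (rule tendsto_sandwich)
  have bd: "\<bar>real_of_int (toward_zero y) - y\<bar> \<le> 1" for y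
    by (auto simp: toward_zero_def) linarith+
  show "\<forall>\<^sub>F t in at_top. V - 1 / t \<le> real_of_int (toward_zero (V * t)) / t"
    using eventually_gt_at_top[of 0]
  proof eventually_elim
    case (elim t)
    have "(V * t - 1) / t \<le> real_of_int (toward_zero (V * t)) / t"
      using bd[of "V * t"] elim by (intro divide_right_mono) linarith+
    then show ?case using elim by (simp add: diff_divide_distrib)
  qed
  show "\<forall>\<^sub>F t in at_top. real_of_int (toward_zero (V * t)) / t \<le> V + 1 / t"
    using eventually_gt_at_top[of 0]
  proof eventually_elim
    case (elim t)
    have "real_of_int (toward_zero (V * t)) / t \<le> (V * t + 1) / t"
      using bd[of "V * t"] elim by (intro divide_right_mono) linarith+
    then show ?case using elim by (simp add: add_divide_distrib)
  qed
  show "((\<lambda>t. V - 1 / t) \<longlongrightarrow> V) at_top" by real_asymp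
  show "((\<lambda>t. V + 1 / t) \<longlongrightarrow> V) at_top" by real_asymp
qed

lemma current_variance_limit:
  "((\<lambda>t. variance (\<lambda>x. real_of_int (current h V t x)) / t) \<longlongrightarrow>
     variance (\<lambda>x. real (\<omega> 0 x 0)) * \<bar>char_speed \<rho> - V\<bar>) at_top"
proof -
  define \<sigma>2 where "\<sigma>2 = variance (\<lambda>x. real (\<omega> 0 x 0))"
  define j where "j = (\<lambda>t. toward_zero (V * t) - shift t)"
  define v where "v = (\<lambda>t. \<bar>real_of_int (j t)\<bar> / t * \<sigma>2)"
  have \<sigma>2: "0 \<le> \<sigma>2" by (simp add: \<sigma>2_def)
  have "((\<lambda>t. \<bar>real_of_int (toward_zero (V * t)) / t - real_of_int (shift t) / t\<bar> * \<sigma>2)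
      \<longlongrightarrow> \<bar>V - char_speed \<rho>\<bar> * \<sigma>2) at_top"
    by (intro tendsto_intros toward_zero_limit shift_limit)
  then have v: "(v \<longlongrightarrow> \<bar>V - char_speed \<rho>\<bar> * \<sigma>2) at_top"
  proof (rule Lim_transform_eventually)
    show "\<forall>\<^sub>F t in at_top. \<bar>real_of_int (toward_zero (V * t)) / t - real_of_int (shift t) / t\<bar> * \<sigma>2 = v t"
      using eventually_gt_at_top[of 0]
    proof eventually_elim
      case (elim t)
      then show ?case by (simp add: v_def j_def flip: diff_divide_distrib)
    qed
  qed
  have "((\<lambda>t. variance (\<lambda>x. real_of_int (current h V t x)) / t - v t) \<longlongrightarrow> 0) at_top"
  proof (rule tendstoI)
    fix e :: real assume e: "0 < e"
    \<comment> \<open>\<open>C\<close> eventually exceeds \<open>v t\<close>. The weight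
      \<open>l\<close> then keeps the term with the initial height below \<open>e / 2\<close>, and
      \<eta> is chosen after \<open>l\<close> so that the term with the deviation is at most
      \<open>e / 4\<close>.\<close>
    define C where "C = \<bar>V - char_speed \<rho>\<bar> * \<sigma>2 + 1"
    have C: "0 < C" using \<sigma>2 by (simp add: C_def add_nonneg_pos)
    define l where "l = e / (2 * C)"
    have l: "0 < l" using e C by (simp add: l_def)
    define \<eta> where "\<eta> = e / (4 * (1 + 1 / l))"
    have \<eta>: "0 < \<eta>" "(1 + 1 / l) * \<eta> = e / 4"
    proof -
      define c where "c = 1 + 1 / l"
      have "0 < c" using l by (simp add: c_def add_pos_pos)
      then show "0 < \<eta>" "(1 + 1 / l) * \<eta> = e / 4" using e by (simp_all add: \<eta>_def flip: c_def)
    qed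
    have "\<forall>\<^sub>F t in at_top. v t < C"
      using v by (rule order_tendstoD(2)) (simp add: C_def)
    then show "\<forall>\<^sub>F t in at_top. dist (variance (\<lambda>x. real_of_int (current h V t x)) / t - v t) 0 < e"
      using dev_second_moment[OF \<eta>(1)]
    proof eventually_elim
      case (elim t)
      then have t: "0 < t" by simp
      define A where "A = (\<lambda>x. real_of_int (h (j t) 0 x))"
      define m where "m = \<gamma> * t - real_of_int (shift t) * \<rho>"
      have cur: "real_of_int (current h V t x) = A x + dev (j t) t x + m" for x
        by (simp add: current_def A_def dev_def m_def j_def)
      have Av: "variance A = t * v t"
        unfolding A_def initial_height_moments(4) using t by (simp add: v_def \<sigma>2_def)
      have "\<bar>variance (\<lambda>x. A x + dev (j t) t x + m) - variance A\<bar>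
          \<le> l * variance A + (1 + 1 / l) * expectation (\<lambda>x. (dev (j t) t x)\<^sup>2)"
      proof (rule variance_perturbation)
        show "integrable M A" "integrable M (\<lambda>x. (A x)\<^sup>2)"
          unfolding A_def by (rule initial_height_moments)+
        show "A \<in> borel_measurable M" by (simp add: A_def)
        show "dev (j t) t \<in> borel_measurable M" by (rule dev_measurable[OF t])
        show "integrable M (\<lambda>x. (dev (j t) t x)\<^sup>2)" using elim by blast
      qed (rule l)
      also have "\<dots> \<le> l * (t * v t) + (1 + 1 / l) * (\<eta> * t)"
        unfolding Av using elim l by (intro add_mono mult_left_mono) auto
      also have "\<dots> = t * (l * v t + e / 4)"
        unfolding \<eta>(2)[symmetric] by (simp add: algebra_simps)
      also have "\<dots> < t * e"
      proof (rule mult_strict_left_mono[OF _ t])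
        have "l * v t < l * C" using elim l by (intro mult_strict_left_mono) auto
        also have "l * C = e / 2" using C by (simp add: l_def)
        finally show "l * v t + e / 4 < e" using e by simp
      qed
      finally have "\<bar>variance (\<lambda>x. real_of_int (current h V t x)) - t * v t\<bar> < t * e"
        unfolding cur Av .
      moreover have "variance (\<lambda>x. real_of_int (current h V t x)) / t - v t
          = (variance (\<lambda>x. real_of_int (current h V t x)) - t * v t) / t"
        using t by (simp add: diff_divide_distrib)
      ultimately show ?case using t
        by (simp add: dist_real_def abs_divide pos_divide_less_eq mult.commute del: divide_diff_eq_iff)
    qed
  qed
  from tendsto_add[OF this v] show ?thesis
    by (simp add: \<sigma>2_def mult.commute abs_minus_commute)
qed

end

theorem mainTheorem5:
  fixes M :: "'a measure" and \<rho> V :: real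
    and N :: "int \<Rightarrow> real \<Rightarrow> 'a \<Rightarrow> nat"
    and \<omega> :: "real \<Rightarrow> 'a \<Rightarrow> int \<Rightarrow> nat"
    and h :: "int \<Rightarrow> real \<Rightarrow> 'a \<Rightarrow> int"
  assumes "\<rho> > 0"
    and "stationary_tazrp M \<rho> N \<omega>"
    and "heights M N \<omega> h"
    and "V \<noteq> char_speed \<rho>"
  shows "((\<lambda>t. prob_space.variance M (\<lambda>x. real_of_int (current h V t x)) / t) \<longlongrightarrow>
           prob_space.variance M (\<lambda>x. real (\<omega> 0 x 0)) * \<bar>char_speed \<rho> - V\<bar>) at_top"
proof -
  interpret stationary_tazrp_process M \<rho> N \<omega> h
    by unfold_locales fact+
  show ?thesis by (rule current_variance_limit)
qed

end
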